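(* Let $d\ge 1$ and $\alpha>d$, let $(\xi(z)\colon z\in\mathbb{Z}^d)$ be independent and identically distributed with $\operatorname{Prob}(\xi(z)<x)=1-x^{-\alpha}$ for $x\ge 1$, and let $u\colon(0,\infty)\times\mathbb{Z}^d\to[0,\infty)$ be the (almost surely unique) nonnegative solution of $\partial_t u(t,z)=\Delta u(t,z)+\xi(z)u(t,z)$ for $(t,z)\in(0,\infty)\times\mathbb{Z}^d$, $u(0,z)=\mathbf{1}_{\{0\}}(z)$. Let $U(t)=\sum_{z\in\mathbb{Z}^d}u(t,z)$. Then there exist $\mathbb{Z}^d$-valued processes $(Z_t^{(1)}\colon t>0)$ and $(Z_t^{(2)}\colon t>0)$ with $Z_t^{(1)}\neq Z_t^{(2)}$ for all $t>0$ such that $$\lim_{t\to\infty}\frac{u(t,Z_t^{(1)})+u(t,Z_t^{(2)})}{U(t)}=1\quad\text{almost surely}$$ and moreover $$\lim_{t\to\infty}\frac{u(t,Z_t^{(1)})}{U(t)}=1\quad\text{in probability.}$$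
   Context: The discrete Laplacian is $(\Delta f)(z)=\sum_{y\sim z}[f(y)-f(z)]$ for $f\colon\mathbb{Z}^d\to\mathbb{R}$, where $y\sim z$ means that $y,z\in\mathbb{Z}^d$ are nearest neighbours. Probability statements refer to the law of the potential $\xi$; the processes $Z^{(1)},Z^{(2)}$ are random, defined on the probability space of $\xi$. It is known that $\alpha>d$ guarantees existence and uniqueness of the nonnegative solution, which is given by the Feynman--Kac formula $u(t,z)=\mathbb{E}_0[\exp\{\int_0^t\xi(X_s)\,ds\}\mathbf{1}\{X_t=z\}]$, where $(X_s)_{s\ge 0}$ is the continuous-time simple random walk on $\mathbb{Z}^d$ with generator $\Delta$ started at $0$. *)

theory Defs
  imports "HOL-Probability.Probability"
begin

text \<open>The lattice $Z^d$ is the type \<open>int ^ 'd\<close>, with \<open>d = CARD('d)\<close>.\<close>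

definition neighbours :: "int ^ 'd \<Rightarrow> (int ^ 'd) set" where
  "neighbours z = {y. (\<Sum>i\<in>UNIV. \<bar>y $ i - z $ i\<bar>) = 1}"

lemma finite_neighbours: "finite (neighbours (z :: int ^ 'd))"
proof -
  have "($) ` neighbours z \<subseteq> PiE UNIV (\<lambda>i. {z $ i - 1..z $ i + 1})"
  proof (intro image_subsetI PiE_I)
    fix y :: "int ^ 'd" and i assume "y \<in> neighbours z"
    then have "\<bar>y $ i - z $ i\<bar> \<le> 1"
      using member_le_sum[of i UNIV "\<lambda>i. \<bar>y $ i - z $ i\<bar>"] by (simp add: neighbours_def)
    then show "y $ i \<in> {z $ i - 1..z $ i + 1}"
      by auto
  qed simp
  then have "finite (($) ` neighbours z)"
    by (rule finite_subset) (simp add: finite_PiE)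
  then show ?thesis
    by (rule finite_imageD) (simp add: inj_on_def vec_nth_inject)
qed

definition discrete_laplacian :: "(int ^ 'd \<Rightarrow> real) \<Rightarrow> int ^ 'd \<Rightarrow> real" where
  "discrete_laplacian f z = (\<Sum>y\<in>neighbours z. f y - f z)"

text \<open>
  Nonnegative classical solutions of the Cauchy problem with potential \<open>V\<close> and initial condition
  concentrated at the origin. Continuity at time \<open>0\<close> ties the initial value to the values at
  positive times. Negative times are irrelevant.
\<close>

definition nonneg_pam_solution :: "(int ^ 'd \<Rightarrow> real) \<Rightarrow> (real \<Rightarrow> int ^ 'd \<Rightarrow> real) \<Rightarrow> bool" where
  "nonneg_pam_solution V u \<longleftrightarrow>
     (\<forall>t\<ge>0. \<forall>z. 0 \<le> u t z) \<and>
     (\<forall>t>0. \<forall>z. ((\<lambda>s. u s z) has_real_derivative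
                    discrete_laplacian (u t) z + V z * u t z) (at t)) \<and>
     (\<forall>z. u 0 z = (if z = 0 then 1 else 0)) \<and>
     (\<forall>z. continuous (at 0 within {0..}) (\<lambda>t. u t z))"

definition total_mass :: "(real \<Rightarrow> int ^ 'd \<Rightarrow> real) \<Rightarrow> real \<Rightarrow> real" where
  "total_mass u t = (\<Sum>\<^sub>\<infinity>z. u t z)"

text \<open>
  Convergence in probability to a constant. The measurability clause is needed because
  \<^const>\<open>measure\<close> assigns \<open>0\<close> to nonmeasurable sets.
\<close>

definition tendsto_in_prob :: "'a measure \<Rightarrow> ('i \<Rightarrow> 'a \<Rightarrow> real) \<Rightarrow> real \<Rightarrow> 'i filter \<Rightarrow> bool" where
  "tendsto_in_prob M X c F \<longleftrightarrow>
     (\<forall>\<^sub>F i in F. X i \<in> borel_measurable M) \<and>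
     (\<forall>\<epsilon>>0. ((\<lambda>i. measure M {\<omega> \<in> space M. \<bar>X i \<omega> - c\<bar> > \<epsilon>}) \<longlongrightarrow> 0) F)"

text \<open>
  A random function \<open>u\<close> that is only known to solve the Cauchy problem almost surely is, by
  almost sure uniqueness, a random variable up to a null set. Convergence in probability of
  functionals of \<open>u\<close> is therefore meant with respect to \<^term>\<open>completion M\<close>, which agrees with
  \<open>M\<close> on the measurable sets of \<open>M\<close>.
\<close>

end

theory Submission
  imports Defs
begin

text \<open>
  A nonnegative solution has nonnegative time derivatives of all orders after multiplication by an
  exponential, so it equals a power series whose coefficients are total weights of lazy nearest neighbour
  walks. A walk that spends its time at its highest site \<open>z\<close> contributes \<open>exp (t * \<Psi>\<^sub>t(z))\<close> up to
  lower order, where \<open>t * \<Psi>\<^sub>t(z) = t * \<xi>(z) - |z| ln \<xi>(z) + \<eta>(z)\<close> and \<open>exp \<eta>(z)\<close> is the number of geodesics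
  from \<open>0\<close> to \<open>z\<close>. The lower bound follows from walks along geodesics. The upper bound comes from
  the estimate \<open>t ^ k / k! \<le> exp (t * s) / s ^ k\<close>, which turns the series into a resolvent at an energy \<open>s\<close> slightly
  above \<open>\<xi>(z)\<close>, because sites of high potential are locally sparse.

  If the peak values of a set \<open>S\<close> of at most two sites exceed all others by a gap, then walks whose highest
  site is not in \<open>S\<close> are negligible, and the remaining mass sits on \<open>S\<close>: away from \<open>S\<close> the weight of a walk grows at
  a smaller rate than on \<open>S\<close>. The peak values at different sites are independent with explicit
  distributions. Three of them are close to the maximum with a probability that is summable along a grid of
  times fine enough to control all times, which gives the almost sure statement with two cities; two of them are
  close with vanishing probability, which gives one city in probability.
\<close>

section \<open>The lattice\<close>

text \<open>Precision is the obstacle. At time \<open>T\<close> the relevant distances and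
  logarithms of weights have order \<open>T powr (1 + \<rho>)\<close>, while the gap between peak
  values is only \<open>T powr (1 + \<rho> - \<kappa>)\<close>. Upper and lower bounds must agree up
  to factors whose logarithm is below that gap. Counting paths by \<open>deg ^ n\<close> would lose
  a term proportional to the distance, which is too much; the upper bound must carry the same number
  of geodesics as the lower one, and exponential tilting supplies it. Revisits are the second
  danger: at an energy just above the maximum, the resolvent factor of a high site is large. Excess
  jumps and local sparseness of high sites pay for it.

  A tie of \<open>k\<close> peak values within the gap has probability about
  \<open>T powr (- (k - 1) * \<kappa>)\<close>: there are about \<open>T powr \<kappa>\<close> bins,
  and each of the \<open>k\<close> sites contributes \<open>T powr (- \<kappa>)\<close>. A grid on
  which peak values move by less than the gap is so fine that the bound for \<open>k = 3\<close> is
  summable while the one for \<open>k = 2\<close> is not. Hence two cities almost surely, but one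
  only in probability.\<close>

definition norm1 :: "int ^ 'd \<Rightarrow> nat" where
  "norm1 z = (\<Sum>i\<in>UNIV. nat \<bar>z $ i\<bar>)"

definition lball :: "int ^ 'd \<Rightarrow> nat \<Rightarrow> (int ^ 'd) set" where
  "lball x n = {y. norm1 (y - x) \<le> n}"

lemma of_nat_norm1: "int (norm1 z) = (\<Sum>i\<in>UNIV. \<bar>z $ i\<bar>)"
  by (simp add: norm1_def)

lemma norm1_0 [simp]: "norm1 0 = 0"
  by (simp add: norm1_def)

lemma norm1_uminus [simp]: "norm1 (- z) = norm1 z"
  by (simp add: norm1_def)

lemma norm1_triangle: "norm1 (x + y) \<le> norm1 x + norm1 y"
  unfolding norm1_def sum.distrib[symmetric] by (intro sum_mono) auto

lemma norm1_triangle_diff: "norm1 (x - z) \<le> norm1 (x - y) + norm1 (y - z)"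
  using norm1_triangle[of "x - y" "y - z"] by simp

lemma norm1_commute: "norm1 (x - y) = norm1 (y - x)"
  using norm1_uminus[of "x - y"] by simp

lemma in_neighbours_iff: "y \<in> neighbours z \<longleftrightarrow> norm1 (y - z) = 1"
proof -
  have "int (norm1 (y - z)) = (\<Sum>i\<in>UNIV. \<bar>y $ i - z $ i\<bar>)"
    unfolding of_nat_norm1 by simp
  then show ?thesis
    by (metis (mono_tags, lifting) mem_Collect_eq neighbours_def of_nat_1 of_nat_eq_iff)
qed

lemma neighbours_sym: "y \<in> neighbours z \<longleftrightarrow> z \<in> neighbours y"
  by (simp add: in_neighbours_iff norm1_commute)

lemma neighbours_translate: "neighbours z = (\<lambda>e. z + e) ` neighbours 0"
proof (intro equalityI subsetI)
  fix x assume "x \<in> neighbours z"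
  then show "x \<in> (\<lambda>e. z + e) ` neighbours 0"
    by (intro image_eqI[of _ _ "x - z"]) (auto simp: in_neighbours_iff)
qed (auto simp: in_neighbours_iff)

definition deg :: "'d::finite itself \<Rightarrow> real" where
  "deg _ = real (card (neighbours (0 :: int ^ 'd)))"


lemma card_neighbours: "real (card (neighbours (z :: int ^ 'd))) = deg TYPE('d)"
  unfolding deg_def neighbours_translate[of z]
  by (subst card_image) (auto simp: inj_on_def)

lemma sum_neighbours_const: "(\<Sum>y\<in>neighbours (z :: int ^ 'd). c) = deg TYPE('d) * (c :: real)"
  by (simp add: card_neighbours)

lemma norm1_axis [simp]: "norm1 (axis i c :: int ^ 'd) = nat \<bar>c\<bar>"
  by (simp add: norm1_def axis_def if_distrib cong: if_cong)

lemma neighbours_0_axis: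
  assumes "e \<in> neighbours (0 :: int ^ 'd)"
  obtains i where "e = axis i 1 \<or> e = axis i (-1)"
proof -
  have s: "(\<Sum>i\<in>UNIV. nat \<bar>e $ i\<bar>) = 1"
    using assms by (simp add: in_neighbours_iff norm1_def)
  obtain i where i: "nat \<bar>e $ i\<bar> \<noteq> 0"
    using s by (metis sum.neutral zero_neq_one)
  have s': "nat \<bar>e $ i\<bar> + (\<Sum>j\<in>UNIV - {i}. nat \<bar>e $ j\<bar>) = 1"
    using s by (subst (asm) sum.remove[of _ i]) auto
  then have "nat \<bar>e $ i\<bar> = 1" and z: "(\<Sum>j\<in>UNIV - {i}. nat \<bar>e $ j\<bar>) = 0"
    using i by linarith+
  then have "e $ i = 1 \<or> e $ i = -1" by linarith
  moreover have "e $ j = 0" if "j \<noteq> i" for j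
    using z that by simp
  ultimately have "e = axis i 1 \<or> e = axis i (-1)"
    by (auto simp: vec_eq_iff axis_def)
  then show ?thesis using that by blast
qed

lemma axis_in_neighbours: "axis i 1 \<in> neighbours (0 :: int ^ 'd)" "axis i (-1) \<in> neighbours (0 :: int ^ 'd)"
  by (auto simp: in_neighbours_iff)

lemma neighbours_0_eq:
  "neighbours (0 :: int ^ 'd) = (\<lambda>i. axis i 1) ` UNIV \<union> (\<lambda>i. axis i (-1)) ` UNIV"
  using axis_in_neighbours by (auto elim!: neighbours_0_axis)

lemma sum_neighbours_0:
  "(\<Sum>e\<in>neighbours (0 :: int ^ 'd). f e) = (\<Sum>i\<in>UNIV. f (axis i 1) + f (axis i (-1)))"
proof -
  have "inj (\<lambda>i::'d. axis i (c::int))" if "c \<noteq> 0" for c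
    using that by (auto simp: inj_on_def axis_eq_axis)
  moreover have "(\<lambda>i::'d. axis i 1) ` UNIV \<inter> (\<lambda>i. axis i (-1 :: int)) ` UNIV = {}"
    by (auto simp: axis_eq_axis)
  ultimately show ?thesis
    unfolding neighbours_0_eq by (subst sum.union_disjoint) (auto simp: sum.reindex sum.distrib)
qed

lemma deg_eq: "deg TYPE('d::finite) = 2 * real CARD('d)"
proof -
  have "deg TYPE('d) = (\<Sum>e\<in>neighbours (0 :: int ^ 'd). 1)"
    by (simp add: deg_def)
  then show ?thesis unfolding sum_neighbours_0 by simp
qed

lemma deg_ge_2: "deg TYPE('d::finite) \<ge> 2"
  using deg_eq[where 'd='d] by (simp add: Suc_leI)

lemma norm1_neighbour_le:
  assumes "y \<in> neighbours z" shows "norm1 y \<le> Suc (norm1 z)"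
  using norm1_triangle[of "y - z" z] assms by (simp add: in_neighbours_iff)

lemma norm1_component_le: "nat \<bar>z $ i\<bar> \<le> norm1 z"
  unfolding norm1_def by (intro member_le_sum) auto

lemma bij_vec_fun: "bij_betw ($) {z :: 'b ^ 'd. \<forall>i. z $ i \<in> A} (PiE UNIV (\<lambda>_. A))"
proof (rule bij_betwI')
  fix x y :: "'b ^ 'd" show "(($) x = ($) y) = (x = y)" by (simp add: vec_nth_inject)
next
  fix f :: "'d \<Rightarrow> 'b" assume "f \<in> PiE UNIV (\<lambda>_. A)"
  then show "\<exists>x\<in>{z. \<forall>i. z $ i \<in> A}. f = ($) x"
    by (intro bexI[of _ "vec_lambda f"]) (auto simp: fun_eq_iff)
qed auto

lemma card_vec_box: "card {z :: 'b ^ 'd. \<forall>i. z $ i \<in> A} = card A ^ CARD('d)"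
  using bij_betw_same_card[OF bij_vec_fun[of A]] by (simp add: card_PiE)

lemma finite_vec_box: "finite A \<Longrightarrow> finite {z :: 'b ^ 'd. \<forall>i. z $ i \<in> A}"
  using bij_betw_finite[OF bij_vec_fun[of A, where 'd='d]] by (simp add: finite_PiE)

lemma lball_0_subset: "lball (0 :: int ^ 'd) n \<subseteq> {z. \<forall>i. z $ i \<in> {- int n..int n}}"
proof safe
  fix z :: "int ^ 'd" and i assume "z \<in> lball 0 n"
  then have "nat \<bar>z $ i\<bar> \<le> n"
    using norm1_component_le[of z i] by (simp add: lball_def)
  then show "z $ i \<in> {- int n..int n}" by auto
qed

lemma lball_translate: "lball x n = (\<lambda>e. x + e) ` lball 0 n"
proof (intro equalityI subsetI)
  fix y assume "y \<in> lball x n"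
  then show "y \<in> (\<lambda>e. x + e) ` lball 0 n"
    by (intro image_eqI[of _ _ "y - x"]) (auto simp: lball_def)
qed (auto simp: lball_def)

lemma finite_lball [simp]: "finite (lball (x :: int ^ 'd) n)"
proof -
  have "finite (lball (0 :: int ^ 'd) n)"
    by (rule finite_subset[OF lball_0_subset], rule finite_vec_box) simp
  then show ?thesis by (subst lball_translate) simp
qed

lemma card_lball_le: "card (lball (x :: int ^ 'd) n) \<le> (2 * n + 1) ^ CARD('d)"
proof -
  have "card (lball x n) = card (lball (0 :: int ^ 'd) n)"
    by (subst lball_translate) (auto intro!: card_image simp: inj_on_def)
  also have "\<dots> \<le> card {z :: int ^ 'd. \<forall>i. z $ i \<in> {- int n..int n}}"
    by (intro card_mono lball_0_subset finite_vec_box) auto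
  also have "\<dots> = (2 * n + 1) ^ CARD('d)"
    by (subst card_vec_box) (simp add: nat_add_distrib nat_mult_distrib)
  finally show ?thesis .
qed

lemma real_card_lball_le: "real (card (lball (x :: int ^ 'd) n)) \<le> (2 * real n + 1) ^ CARD('d)"
proof -
  have "real (card (lball x n)) \<le> real ((2 * n + 1) ^ CARD('d))"
    by (rule of_nat_mono[OF card_lball_le])
  then show ?thesis by (simp add: add.commute)
qed

text \<open>The cube with all coordinates between \<open>0\<close> and \<open>n div CARD('d)\<close>
  lies in the ball. It has \<open>n div CARD('d) + 1\<close> points per side, which makes up for the
  rounding.\<close>

lemma card_lball_ge: "(real n / real CARD('d)) ^ CARD('d) \<le> real (card (lball (0 :: int ^ 'd) n))"
proof -
  let ?d = "CARD('d)"
  have sub: "{z :: int ^ 'd. \<forall>i. z $ i \<in> {0..int (n div ?d)}} \<subseteq> lball 0 n"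
  proof safe
    fix z :: "int ^ 'd" assume z: "\<forall>i. z $ i \<in> {0..int (n div ?d)}"
    have "norm1 z \<le> (\<Sum>i\<in>(UNIV::'d set). n div ?d)"
      unfolding norm1_def
    proof (rule sum_mono)
      fix i show "nat \<bar>z $ i\<bar> \<le> n div ?d"
        using z[THEN spec, of i] by (simp add: nat_le_iff)
    qed
    also have "\<dots> \<le> n" by simp
    finally show "z \<in> lball 0 n" by (simp add: lball_def)
  qed
  have "real n / real ?d \<le> real (n div ?d + 1)"
  proof -
    have "n < (n div ?d + 1) * ?d"
      using dividend_less_div_times[of ?d n] by simp
    then have "real n < real (n div ?d + 1) * real ?d"
      by (metis of_nat_less_iff of_nat_mult)
    then show ?thesis by (simp add: divide_le_eq)
  qed
  then have "(real n / real ?d) ^ ?d \<le> real (n div ?d + 1) ^ ?d"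
    by (intro power_mono) auto
  also have "\<dots> = real (card {z :: int ^ 'd. \<forall>i. z $ i \<in> {0..int (n div ?d)}})"
    by (subst card_vec_box) (simp add: nat_add_distrib add.commute)
  also have "\<dots> \<le> real (card (lball (0 :: int ^ 'd) n))"
    by (intro of_nat_mono card_mono sub) simp
  finally show ?thesis .
qed

section \<open>Power series of nonnegative solutions\<close>

text \<open>The generator \<open>\<Delta> + V\<close> with \<open>deg\<close> added on the diagonal.
  The shift cancels the negative diagonal of the Laplacian, so nonnegativity is preserved whenever
  \<open>V\<close> is nonnegative.\<close>

definition path_operator :: "(int ^ 'd \<Rightarrow> real) \<Rightarrow> (int ^ 'd \<Rightarrow> real) \<Rightarrow> int ^ 'd \<Rightarrow> real" where
  "path_operator V f z = V z * f z + (\<Sum>y\<in>neighbours z. f y)"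

definition path_weight :: "(int ^ 'd \<Rightarrow> real) \<Rightarrow> nat \<Rightarrow> int ^ 'd \<Rightarrow> real" where
  "path_weight V k = (path_operator V ^^ k) (\<lambda>z. if z = 0 then 1 else 0)"

lemma path_weight_0: "path_weight V 0 z = (if z = 0 then 1 else 0)"
  by (simp add: path_weight_def)

lemma path_weight_Suc:
  "path_weight V (Suc k) z = V z * path_weight V k z + (\<Sum>y\<in>neighbours z. path_weight V k y)"
  by (simp add: path_weight_def path_operator_def)

lemma path_operator_power_nonneg:
  assumes "\<And>z. 0 \<le> V z" "\<And>z. 0 \<le> f z"
  shows "0 \<le> (path_operator V ^^ k) f z"
  by (induction k arbitrary: z) (auto simp: path_operator_def assms intro!: add_nonneg_nonneg mult_nonneg_nonneg sum_nonneg)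

lemma path_weight_nonneg: "(\<And>z. 0 \<le> V z) \<Longrightarrow> 0 \<le> path_weight V k z"
  unfolding path_weight_def by (rule path_operator_power_nonneg) auto

lemma path_operator_power_tendsto:
  assumes "\<And>z. ((\<lambda>s. f s z) \<longlongrightarrow> g z) F"
  shows "((\<lambda>s. (path_operator V ^^ k) (f s) z) \<longlongrightarrow> (path_operator V ^^ k) g z) F"
  by (induction k arbitrary: z) (auto simp: path_operator_def assms intro!: tendsto_intros)

lemma path_operator_power_deriv:
  assumes "\<And>z. ((\<lambda>s. f s z) has_real_derivative path_operator V (f t) z) (at t)"
  shows "((\<lambda>s. (path_operator V ^^ k) (f s) z) has_real_derivative (path_operator V ^^ Suc k) (f t) z) (at t)"
proof (induction k arbitrary: z)
  case 0 then show ?case using assms by simp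
next
  case (Suc k)
  have rec: "(path_operator V ^^ Suc n) g z =
      V z * (path_operator V ^^ n) g z + (\<Sum>y\<in>neighbours z. (path_operator V ^^ n) g y)" for n g
    by (simp add: path_operator_def)
  show ?case
    by (subst rec[of "Suc k" "f t"], subst rec[of k]) (intro DERIV_add DERIV_cmult DERIV_sum Suc)
qed

text \<open>
  All time derivatives of \<open>exp (deg * t) * u t z\<close> are nonnegative, so by Bernstein's argument the Taylor
  remainder at time \<open>t\<close> is at most \<open>2 ^ (-n)\<close> times the value at time \<open>3 * t\<close>. Hence every nonnegative
  solution is given by this series, whatever the growth of \<open>V\<close>; in particular it is unique.
\<close>

lemma pam_solution_sums:
  fixes V :: "int ^ 'd \<Rightarrow> real"
  assumes V: "\<And>z. 0 \<le> V z" and sol: "nonneg_pam_solution V u" and t: "t > 0"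
  shows "(\<lambda>k. t ^ k / fact k * path_weight V k z) sums (exp (deg TYPE('d) * t) * u t z)"
proof -
  define D where "D = deg TYPE('d)"
  define w where "w s y = exp (D * s) * u s y" for s y
  define W where "W k s y = (path_operator V ^^ k) (w s) y" for k s y
  have u0: "0 \<le> u s y" if "s \<ge> 0" for s y using sol that by (auto simp: nonneg_pam_solution_def)
  have dw: "((\<lambda>s. w s y) has_real_derivative path_operator V (w s) y) (at s)" if "s > 0" for s y
  proof -
    have "((\<lambda>s. u s y) has_real_derivative discrete_laplacian (u s) y + V y * u s y) (at s)"
      using sol that by (auto simp: nonneg_pam_solution_def)
    then have "((\<lambda>s. exp (D * s) * u s y) has_real_derivative
        exp (D * s) * D * u s y + exp (D * s) * (discrete_laplacian (u s) y + V y * u s y)) (at s)"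
      by (auto intro!: derivative_eq_intros)
    moreover have "discrete_laplacian (u s) y = (\<Sum>x\<in>neighbours y. u s x) - D * u s y"
      by (simp add: discrete_laplacian_def sum_subtractf card_neighbours D_def)
    ultimately show ?thesis
      unfolding w_def path_operator_def by (simp add: algebra_simps sum_distrib_left)
  qed
  have dW: "((\<lambda>s. W k s y) has_real_derivative W (Suc k) s y) (at s)" if "s > 0" for s k y
    unfolding W_def by (intro path_operator_power_deriv dw that)
  have W_nonneg: "0 \<le> W k s y" if "s \<ge> 0" for k s y
    unfolding W_def by (intro path_operator_power_nonneg V) (auto simp: w_def u0 that)
  have W_mono: "W k s y \<le> W k s' y" if "0 < s" "s \<le> s'" for k s s' y
    by (rule DERIV_nonneg_imp_nondecreasing[OF that(2)])
       (use dW W_nonneg that in \<open>meson less_le_trans order_less_imp_le\<close>)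
  have lim0: "((\<lambda>s. W k s z) \<longlongrightarrow> path_weight V k z) (at_right 0)" for k
    unfolding W_def path_weight_def
  proof (rule path_operator_power_tendsto)
    fix y
    have "((\<lambda>s. u s y) \<longlongrightarrow> u 0 y) (at 0 within {0..})"
      using sol unfolding nonneg_pam_solution_def continuous_within by blast
    then have "((\<lambda>s. u s y) \<longlongrightarrow> u 0 y) (at_right 0)"
      by (rule tendsto_within_subset) auto
    then have "((\<lambda>s. exp (D * s) * u s y) \<longlongrightarrow> exp (D * 0) * u 0 y) (at_right 0)"
      by (intro tendsto_intros)
    then show "((\<lambda>s. w s y) \<longlongrightarrow> (if y = 0 then 1 else 0)) (at_right 0)"
      using sol by (simp add: w_def nonneg_pam_solution_def)
  qed
  have taylor: "\<exists>c. s < c \<and> c < s' \<and> w s' z = (\<Sum>k<n. W k s z / fact k * (s' - s) ^ k) + W n c z / fact n * (s' - s) ^ n"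
    if "0 < s" "s < s'" "n > 0" for s s' n
    using Taylor_up[of n "\<lambda>k x. W k x z" "\<lambda>x. w x z" s s' s] that dW
    by (auto simp: W_def)
  \<comment> \<open>The expansion from \<open>t\<close> to \<open>3 * t\<close> has step
    \<open>2 * t\<close>; the steps in \<open>rem\<close> are at most \<open>t\<close>, and the
    quotient gives the factor \<open>(1/2) ^ n\<close>.\<close>
  have bound1: "w t z * 0 \<le> W n t z / fact n * (2 * t) ^ n" "W n t z / fact n * (2 * t) ^ n \<le> w (3 * t) z"
    if "n > 0" for n
  proof -
    from taylor[of t "3 * t" n] t that obtain c where c: "t < c"
      "w (3 * t) z = (\<Sum>k<n. W k t z / fact k * (2 * t) ^ k) + W n c z / fact n * (2 * t) ^ n" by auto
    have "W n t z / fact n * (2 * t) ^ n \<le> W n c z / fact n * (2 * t) ^ n"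
      using W_mono[of t c n z] c t by (intro mult_right_mono divide_right_mono) auto
    moreover have "0 \<le> (\<Sum>k<n. W k t z / fact k * (2 * t) ^ k)"
      using W_nonneg t by (intro sum_nonneg) auto
    ultimately show "W n t z / fact n * (2 * t) ^ n \<le> w (3 * t) z" using c by linarith
  qed (use W_nonneg[of t n z] t in auto)
  have rem: "\<bar>w t z - (\<Sum>k<n. t ^ k / fact k * path_weight V k z)\<bar> \<le> w (3 * t) z * (1/2) ^ n" if n: "n > 0" for n
  proof -
    \<comment> \<open>The equation is only assumed at positive times, so the expansion starts at
      \<open>s > 0\<close> and \<open>s\<close> tends to \<open>0\<close> afterwards. Continuity at
      \<open>0\<close> enters through \<open>lim0\<close>.\<close>
    let ?S = "\<lambda>s. \<Sum>k<n. W k s z / fact k * (t - s) ^ k"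
    have "(?S \<longlongrightarrow> (\<Sum>k<n. path_weight V k z / fact k * (t - 0) ^ k)) (at_right 0)"
    proof (rule tendsto_sum)
      fix k
      show "((\<lambda>s. W k s z / fact k * (t - s) ^ k) \<longlongrightarrow> path_weight V k z / fact k * (t - 0) ^ k) (at_right 0)"
        by (rule tendsto_mult[OF tendsto_divide[OF lim0 tendsto_const] tendsto_power[OF tendsto_diff[OF tendsto_const tendsto_ident_at]]]) simp
    qed
    then have lim: "((\<lambda>s. \<bar>w t z - ?S s\<bar>) \<longlongrightarrow> \<bar>w t z - (\<Sum>k<n. path_weight V k z / fact k * (t - 0) ^ k)\<bar>) (at_right 0)"
      by (rule tendsto_rabs[OF tendsto_diff[OF tendsto_const]])
    have ev: "\<forall>\<^sub>F s in at_right 0. \<bar>w t z - ?S s\<bar> \<le> w (3 * t) z * (1/2) ^ n"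
      unfolding eventually_at_right_field
    proof (intro exI[of _ t] conjI allI impI t)
      fix s assume s: "0 < s" "s < t"
      from taylor[OF s n] obtain c where c: "s < c" "c < t"
        "w t z = ?S s + W n c z / fact n * (t - s) ^ n" by auto
      have "W n c z / fact n * (t - s) ^ n \<le> W n t z / fact n * t ^ n"
        using W_mono[of c t n z] c s W_nonneg[of t n z] t
        by (intro mult_mono divide_right_mono power_mono) auto
      also have "\<dots> = W n t z / fact n * (2 * t) ^ n * (1/2) ^ n"
        by (simp add: power_mult_distrib power_one_over)
      also have "\<dots> \<le> w (3 * t) z * (1/2) ^ n"
        by (intro mult_right_mono bound1 n) auto
      finally have "W n c z / fact n * (t - s) ^ n \<le> w (3 * t) z * (1/2) ^ n" .
      moreover have "0 \<le> W n c z / fact n * (t - s) ^ n"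
        using W_nonneg[of c n z] c s by auto
      ultimately show "\<bar>w t z - ?S s\<bar> \<le> w (3 * t) z * (1/2) ^ n" using c by simp
    qed
    have "\<bar>w t z - (\<Sum>k<n. path_weight V k z / fact k * (t - 0) ^ k)\<bar> \<le> w (3 * t) z * (1/2) ^ n"
      by (rule tendsto_upperbound[OF lim ev]) simp
    then show ?thesis by (simp add: mult.commute)
  qed
  have "(\<lambda>n. w (3 * t) z * (1/2) ^ n) \<longlonglongrightarrow> w (3 * t) z * 0"
    by (intro tendsto_intros) (auto intro: LIMSEQ_power_zero)
  then have lim: "(\<lambda>n. w (3 * t) z * (1/2) ^ n) \<longlonglongrightarrow> 0"
    by simp
  have "\<forall>\<^sub>F n in sequentially. norm (w t z - (\<Sum>k<n. t ^ k / fact k * path_weight V k z)) \<le> w (3 * t) z * (1/2) ^ n"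
    using eventually_gt_at_top[of 0] by eventually_elim (simp only: real_norm_def rem)
  then have "(\<lambda>n. w t z - (\<Sum>k<n. t ^ k / fact k * path_weight V k z)) \<longlonglongrightarrow> 0"
    by (rule Lim_null_comparison[OF _ lim])
  from tendsto_diff[OF tendsto_const[of "w t z"] this]
  have "(\<lambda>n. \<Sum>k<n. t ^ k / fact k * path_weight V k z) \<longlonglongrightarrow> w t z"
    by simp
  then show ?thesis by (simp add: sums_def w_def D_def)
qed

section \<open>Lazy walks\<close>

text \<open>
  A walk is the list of its positions in reverse order, so its head is the current site. A step that
  stays at \<open>x\<close> has weight \<open>V x\<close>, a jump has weight \<open>1\<close>.
\<close>

primrec lazy_walks :: "nat \<Rightarrow> (int ^ 'd) list set" where
  "lazy_walks 0 = {[0]}"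
| "lazy_walks (Suc k) = (\<Union>p\<in>lazy_walks k. (\<lambda>y. y # p) ` insert (hd p) (neighbours (hd p)))"

fun walk_weight :: "('b \<Rightarrow> real) \<Rightarrow> 'b list \<Rightarrow> real" where
  "walk_weight V (y # x # p) = (if y = x then V x else 1) * walk_weight V (x # p)"
| "walk_weight V p = 1"

definition walk_sum :: "(int ^ 'd \<Rightarrow> real) \<Rightarrow> nat \<Rightarrow> ((int ^ 'd) list \<Rightarrow> real) \<Rightarrow> real" where
  "walk_sum V k f = (\<Sum>p\<in>lazy_walks k. walk_weight V p * f p)"

lemma finite_lazy_walks: "finite (lazy_walks k)"
  by (induction k) (auto simp: finite_neighbours)

lemma lazy_walks_nonempty: "p \<in> lazy_walks k \<Longrightarrow> p \<noteq> []"
  by (cases k) auto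

lemma walk_weight_nonneg: "(\<And>z. 0 \<le> V z) \<Longrightarrow> 0 \<le> walk_weight V p"
  by (induction V p rule: walk_weight.induct) auto

lemma not_in_neighbours_self [simp]: "z \<notin> neighbours z"
  by (simp add: in_neighbours_iff)

lemma walk_sum_0: "walk_sum V 0 f = f [0]"
  by (simp add: walk_sum_def)

lemma walk_weight_Cons:
  "q \<noteq> [] \<Longrightarrow> walk_weight V (y # q) = (if y = hd q then V y else 1) * walk_weight V q"
  by (cases q) auto

lemma walk_sum_Suc:
  "walk_sum V (Suc k) f =
     walk_sum V k (\<lambda>q. V (hd q) * f (hd q # q) + (\<Sum>y\<in>neighbours (hd q). f (y # q)))"
proof -
  have "walk_sum V (Suc k) f =
      (\<Sum>q\<in>lazy_walks k. \<Sum>p\<in>(\<lambda>y. y # q) ` insert (hd q) (neighbours (hd q)). walk_weight V p * f p)"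
    unfolding walk_sum_def lazy_walks.simps
    by (intro sum.UNION_disjoint finite_lazy_walks ballI impI)
       (auto simp: finite_neighbours)
  also have "\<dots> = (\<Sum>q\<in>lazy_walks k. \<Sum>y\<in>insert (hd q) (neighbours (hd q)). walk_weight V (y # q) * f (y # q))"
    by (simp add: sum.reindex inj_on_def del: sum.insert image_insert)
  also have "\<dots> = (\<Sum>q\<in>lazy_walks k. walk_weight V q * (V (hd q) * f (hd q # q) + (\<Sum>y\<in>neighbours (hd q). f (y # q))))"
  proof (rule sum.cong[OF refl])
    fix q :: "(int ^ 'a) list" assume "q \<in> lazy_walks k"
    then have q: "q \<noteq> []" by (rule lazy_walks_nonempty)
    have "(\<Sum>y\<in>neighbours (hd q). walk_weight V (y # q) * f (y # q)) =
        (\<Sum>y\<in>neighbours (hd q). walk_weight V q * f (y # q))"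
      by (intro sum.cong refl) (auto simp: walk_weight_Cons[OF q])
    then show "(\<Sum>y\<in>insert (hd q) (neighbours (hd q)). walk_weight V (y # q) * f (y # q)) =
        walk_weight V q * (V (hd q) * f (hd q # q) + (\<Sum>y\<in>neighbours (hd q). f (y # q)))"
      by (simp add: finite_neighbours walk_weight_Cons[OF q] distrib_left sum_distrib_left)
  qed
  finally show ?thesis by (simp add: walk_sum_def)
qed

lemma walk_sum_mono:
  assumes "\<And>z. 0 \<le> V z" "\<And>p. p \<in> lazy_walks k \<Longrightarrow> f p \<le> g p"
  shows "walk_sum V k f \<le> walk_sum V k g"
  unfolding walk_sum_def by (intro sum_mono mult_left_mono assms walk_weight_nonneg)

lemma walk_sum_nonneg:
  assumes "\<And>z. 0 \<le> V z" "\<And>p. p \<in> lazy_walks k \<Longrightarrow> 0 \<le> f p"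
  shows "0 \<le> walk_sum V k f"
  unfolding walk_sum_def by (intro sum_nonneg mult_nonneg_nonneg assms walk_weight_nonneg)

lemma walk_sum_cong: "(\<And>p. p \<in> lazy_walks k \<Longrightarrow> f p = g p) \<Longrightarrow> walk_sum V k f = walk_sum V k g"
  unfolding walk_sum_def by (intro sum.cong refl) auto

lemma walk_sum_add: "walk_sum V k (\<lambda>p. f p + g p) = walk_sum V k f + walk_sum V k g"
  by (simp add: walk_sum_def distrib_left sum.distrib)

lemma walk_sum_cmult: "walk_sum V k (\<lambda>p. c * f p) = c * walk_sum V k f"
  by (simp add: walk_sum_def sum_distrib_left mult.left_commute)

lemma walk_sum_sum: "walk_sum V k (\<lambda>p. \<Sum>i\<in>I. f i p) = (\<Sum>i\<in>I. walk_sum V k (f i))"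
  unfolding walk_sum_def sum_distrib_left by (rule sum.swap)

definition confined_weight :: "(int ^ 'd \<Rightarrow> real) \<Rightarrow> (int ^ 'd) set \<Rightarrow> nat \<Rightarrow> int ^ 'd \<Rightarrow> real" where
  "confined_weight V D k z = walk_sum V k (\<lambda>p. of_bool (hd p = z \<and> set p \<subseteq> D))"

lemma confined_weight_0: "confined_weight V D 0 z = of_bool (z = 0 \<and> z \<in> D)"
  by (auto simp: confined_weight_def walk_sum_0)

lemma confined_weight_Suc:
  "confined_weight V D (Suc k) z =
     of_bool (z \<in> D) * (V z * confined_weight V D k z + (\<Sum>y\<in>neighbours z. confined_weight V D k y))"
proof -
  have "V (hd q) * of_bool (hd (hd q # q) = z \<and> set (hd q # q) \<subseteq> D) +
      (\<Sum>y\<in>neighbours (hd q). of_bool (hd (y # q) = z \<and> set (y # q) \<subseteq> D)) =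
      of_bool (z \<in> D) * (V z * of_bool (hd q = z \<and> set q \<subseteq> D) +
        (\<Sum>y\<in>neighbours z. of_bool (hd q = y \<and> set q \<subseteq> D)))"
    if "q \<in> lazy_walks k" for q
  proof -
    have q: "hd q \<in> set q" using lazy_walks_nonempty[OF that] by simp
    have "(\<Sum>y\<in>neighbours (hd q). of_bool (hd (y # q) = z \<and> set (y # q) \<subseteq> D)) =
        (\<Sum>y\<in>neighbours (hd q). if y = z then of_bool (z \<in> D \<and> set q \<subseteq> D) else (0::real))"
      by (intro sum.cong refl) auto
    also have "\<dots> = of_bool (z \<in> neighbours (hd q) \<and> z \<in> D \<and> set q \<subseteq> D)"
      by (simp add: finite_neighbours)
    also have "\<dots> = of_bool (z \<in> D) * of_bool (hd q \<in> neighbours z \<and> set q \<subseteq> D)"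
      by (auto simp: neighbours_sym[of z])
    also have "of_bool (hd q \<in> neighbours z \<and> set q \<subseteq> D) =
        (\<Sum>y\<in>neighbours z. if y = hd q then of_bool (set q \<subseteq> D) else (0::real))"
      by (simp add: finite_neighbours)
    also have "\<dots> = (\<Sum>y\<in>neighbours z. of_bool (hd q = y \<and> set q \<subseteq> D))"
      by (intro sum.cong refl) auto
    finally show ?thesis using q by (auto simp: algebra_simps)
  qed
  then show ?thesis
    unfolding confined_weight_def walk_sum_Suc
    by (subst walk_sum_cong[where g = "\<lambda>q. of_bool (z \<in> D) * (V z * of_bool (hd q = z \<and> set q \<subseteq> D) +
        (\<Sum>y\<in>neighbours z. of_bool (hd q = y \<and> set q \<subseteq> D)))"])
       (simp_all only: walk_sum_cmult walk_sum_add walk_sum_sum)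
qed

lemma path_weight_eq_walk_sum: "path_weight V k z = walk_sum V k (\<lambda>p. of_bool (hd p = z))"
proof -
  have "path_weight V k z = confined_weight V UNIV k z"
    by (induction k arbitrary: z) (simp_all add: path_weight_0 confined_weight_0 path_weight_Suc confined_weight_Suc)
  then show ?thesis by (simp add: confined_weight_def)
qed

lemma path_weight_Suc_ge:
  assumes "\<And>z. 0 \<le> V z" shows "V z * path_weight V k z \<le> path_weight V (Suc k) z"
  using sum_nonneg[of "neighbours z" "path_weight V k"] path_weight_nonneg[of V k] assms
  by (simp add: path_weight_Suc)

text \<open>
  The sites of \<open>T\<close> dominate: \<^term>\<open>path_weight V k z\<close> grows by a factor \<open>V z\<close> with each step, which exceeds
  the growth rate \<open>m + deg\<close> of the mass in \<open>D\<close> that is fed by jumps out of \<open>T\<close>.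
\<close>

lemma mass_near_peaks_le:
  fixes V :: "int ^ 'd \<Rightarrow> real"
  assumes V: "\<And>z. 0 \<le> V z" and T: "finite T" and DT: "D \<inter> T = {}"
    and D: "\<And>y. y \<in> D \<Longrightarrow> V y \<le> m" and TV: "\<And>z. z \<in> T \<Longrightarrow> m + gap \<le> V z" and gap: "gap > deg TYPE('d)" and m: "m \<ge> 0"
  shows "walk_sum V k (\<lambda>p. of_bool (hd p \<notin> T \<and> set p \<subseteq> T \<union> D \<and> set p \<inter> T \<noteq> {}))
      \<le> deg TYPE('d) / (gap - deg TYPE('d)) * (\<Sum>z\<in>T. path_weight V k z)"
proof (induction k)
  case 0
  have "0 \<le> (\<Sum>z\<in>T. path_weight V 0 z)" by (intro sum_nonneg path_weight_nonneg V)
  then show ?case using gap deg_ge_2[where 'd='d] by (auto simp: walk_sum_0)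
next
  case (Suc k)
  let ?d = "deg TYPE('d)" and ?f = "\<lambda>p. of_bool (hd p \<notin> T \<and> set p \<subseteq> T \<union> D \<and> set p \<inter> T \<noteq> {}) :: real"
  \<comment> \<open>The fixed point of the recursion:
    \<open>(m + ?d) * ?\<kappa> + ?d = (m + gap) * ?\<kappa>\<close>.\<close>
  let ?\<kappa> = "?d / (gap - ?d)"
  have d: "?d \<ge> 2" by (rule deg_ge_2)
  have "walk_sum V (Suc k) ?f \<le> walk_sum V k (\<lambda>q. (m + ?d) * ?f q + ?d * (\<Sum>z\<in>T. of_bool (hd q = z)))"
    unfolding walk_sum_Suc
  proof (rule walk_sum_mono[OF V])
    fix q :: "(int ^ 'd) list" assume "q \<in> lazy_walks k"
    then have q: "hd q \<in> set q" using lazy_walks_nonempty[of q k] by simp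
    have 1: "V (hd q) * ?f (hd q # q) \<le> m * ?f q"
      using q D by (auto simp: insert_absorb)
    \<comment> \<open>A walk counted after the jump was already outside \<open>T\<close>, and then
      was counted before, or it has just left a site of \<open>T\<close>.\<close>
    have "?f (y # q) \<le> ?f q + (\<Sum>z\<in>T. of_bool (hd q = z))" for y
    proof (cases "hd q \<in> T")
      case True
      then have "(\<Sum>z\<in>T. of_bool (hd q = z)) = (1::real)"
        using T by (simp add: of_bool_def)
      then show ?thesis by simp
    next
      case False
      then have "(\<Sum>z\<in>T. of_bool (hd q = z)) = (0::real)"
        by (intro sum.neutral) auto
      then show ?thesis using False by auto
    qed
    then have "(\<Sum>y\<in>neighbours (hd q). ?f (y # q)) \<le> (\<Sum>y\<in>neighbours (hd q). ?f q + (\<Sum>z\<in>T. of_bool (hd q = z)))"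
      by (intro sum_mono)
    also have "\<dots> = ?d * (?f q + (\<Sum>z\<in>T. of_bool (hd q = z)))"
      by (rule sum_neighbours_const)
    finally show "V (hd q) * ?f (hd q # q) + (\<Sum>y\<in>neighbours (hd q). ?f (y # q)) \<le>
        (m + ?d) * ?f q + ?d * (\<Sum>z\<in>T. of_bool (hd q = z))"
      using 1 by (simp only: distrib_left distrib_right)
  qed
  also have "\<dots> = (m + ?d) * walk_sum V k ?f + ?d * (\<Sum>z\<in>T. path_weight V k z)"
    by (simp only: walk_sum_add walk_sum_cmult walk_sum_sum path_weight_eq_walk_sum)
  also have "\<dots> \<le> (m + ?d) * (?\<kappa> * (\<Sum>z\<in>T. path_weight V k z)) + ?d * (\<Sum>z\<in>T. path_weight V k z)"
    using Suc m d by (intro add_right_mono mult_left_mono) auto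
  also have "\<dots> = ?\<kappa> * (\<Sum>z\<in>T. (m + gap) * path_weight V k z)"
    unfolding sum_distrib_left[symmetric] using gap by (simp add: field_simps)
  also have "\<dots> \<le> ?\<kappa> * (\<Sum>z\<in>T. path_weight V (Suc k) z)"
  proof (intro mult_left_mono sum_mono)
    fix z assume "z \<in> T"
    then have "(m + gap) * path_weight V k z \<le> V z * path_weight V k z"
      by (intro mult_right_mono TV path_weight_nonneg V)
    also have "\<dots> \<le> path_weight V (Suc k) z" by (rule path_weight_Suc_ge[OF V])
    finally show "(m + gap) * path_weight V k z \<le> path_weight V (Suc k) z" .
  qed (use gap d in auto)
  finally show ?case .
qed

text \<open>A walk that has met \<open>w\<close> either did so before its last step, and then one
  step multiplies its mass by at most \<open>m + deg\<close>, or it sits at \<open>w\<close>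
  now.\<close>

lemma visiting_mass_Suc_le:
  fixes V :: "int ^ 'd \<Rightarrow> real"
  assumes V: "\<And>z. 0 \<le> V z" and D: "\<And>y. y \<in> D \<Longrightarrow> V y \<le> m"
  shows "walk_sum V (Suc k) (\<lambda>p. of_bool (w \<in> set p \<and> set p \<subseteq> D)) \<le>
     (m + deg TYPE('d)) * walk_sum V k (\<lambda>p. of_bool (w \<in> set p \<and> set p \<subseteq> D)) + confined_weight V D (Suc k) w"
proof -
  let ?d = "deg TYPE('d)" and ?f = "\<lambda>p. of_bool (w \<in> set p \<and> set p \<subseteq> D) :: real"
  let ?g = "\<lambda>p. of_bool (hd p = w \<and> set p \<subseteq> D) :: real"
  have "walk_sum V (Suc k) ?f \<le> walk_sum V k (\<lambda>q. (m + ?d) * ?f q +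
      (V (hd q) * ?g (hd q # q) + (\<Sum>y\<in>neighbours (hd q). ?g (y # q))))"
    unfolding walk_sum_Suc
  proof (rule walk_sum_mono[OF V])
    fix q :: "(int ^ 'd) list" assume "q \<in> lazy_walks k"
    then have q: "hd q \<in> set q" using lazy_walks_nonempty[of q k] by simp
    have 1: "V (hd q) * ?f (hd q # q) \<le> m * ?f q"
      using q D by (auto simp: insert_absorb)
    have "(\<Sum>y\<in>neighbours (hd q). ?f (y # q)) \<le> (\<Sum>y\<in>neighbours (hd q). ?f q + ?g (y # q))"
      by (intro sum_mono) auto
    also have "\<dots> = ?d * ?f q + (\<Sum>y\<in>neighbours (hd q). ?g (y # q))"
      by (simp only: sum.distrib sum_neighbours_const)
    finally have "(\<Sum>y\<in>neighbours (hd q). ?f (y # q)) \<le> ?d * ?f q + (\<Sum>y\<in>neighbours (hd q). ?g (y # q))" .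
    moreover have "0 \<le> V (hd q) * ?g (hd q # q)" using V by simp
    ultimately show "V (hd q) * ?f (hd q # q) + (\<Sum>y\<in>neighbours (hd q). ?f (y # q)) \<le>
        (m + ?d) * ?f q + (V (hd q) * ?g (hd q # q) + (\<Sum>y\<in>neighbours (hd q). ?g (y # q)))"
      using 1 unfolding distrib_right by linarith
  qed
  also have "\<dots> = (m + ?d) * walk_sum V k ?f + walk_sum V (Suc k) ?g"
    by (simp only: walk_sum_add walk_sum_cmult walk_sum_Suc)
  finally show ?thesis by (simp only: confined_weight_def)
qed

text \<open>
  The resolvent at energy \<open>s\<close> of \<open>D\<close>, restricted to paths with exactly \<open>n\<close> jumps: the geometric series of
  the steps that stay at \<open>y\<close> is summed to \<open>1 / (s - V y)\<close>.
\<close>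

primrec skeleton_green :: "(int ^ 'd \<Rightarrow> real) \<Rightarrow> (int ^ 'd) set \<Rightarrow> real \<Rightarrow> nat \<Rightarrow> int ^ 'd \<Rightarrow> real" where
  "skeleton_green V D s 0 y = of_bool (y = 0 \<and> y \<in> D) / (s - V y)"
| "skeleton_green V D s (Suc n) y = of_bool (y \<in> D) / (s - V y) * (\<Sum>x\<in>neighbours y. skeleton_green V D s n x)"

lemma skeleton_green_nonneg:
  assumes "\<And>y. y \<in> D \<Longrightarrow> V y < s" shows "0 \<le> skeleton_green V D s n y"
proof (induction n arbitrary: y)
  case 0 then show ?case using assms[of y] by auto
next
  case (Suc n)
  have "0 \<le> of_bool (y \<in> D) / (s - V y)" using assms[of y] by auto
  then show ?case
    unfolding skeleton_green.simps by (intro mult_nonneg_nonneg sum_nonneg Suc)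
qed

text \<open>On \<open>D\<close> both sides obey truncated forms of the resolvent equation at energy
  \<open>s\<close>. A walk of \<open>k\<close> steps has at most \<open>k\<close> jumps, so
  induction on \<open>k\<close> compares partial sums and no question of convergence arises.\<close>

lemma confined_weight_resolvent_le:
  fixes V :: "int ^ 'd \<Rightarrow> real"
  assumes V: "\<And>z. 0 \<le> V z" and D: "\<And>y. y \<in> D \<Longrightarrow> V y < s" and s: "s > 0"
  shows "(\<Sum>j\<le>k. confined_weight V D j y / s ^ j) \<le> s * (\<Sum>n\<le>k. skeleton_green V D s n y)"
proof (induction k arbitrary: y)
  case 0
  show ?case using D[of y] V[of y] s by (auto simp: confined_weight_0 field_simps)
next
  case (Suc k)
  define P where "P k y = (\<Sum>j\<le>k. confined_weight V D j y / s ^ j)" for k y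
  define H where "H k y = (\<Sum>n\<le>k. skeleton_green V D s n y)" for k y
  show ?case
  proof (cases "y \<in> D")
    case False
    then have "confined_weight V D j y = 0" for j
      by (cases j) (auto simp: confined_weight_0 confined_weight_Suc)
    moreover have "skeleton_green V D s j y = 0" for j
      using False by (cases j) auto
    ultimately show ?thesis by simp
  next
    case True
    have "P (Suc k) y = of_bool (y = 0) + (\<Sum>j\<le>k. confined_weight V D (Suc j) y / s ^ Suc j)"
      unfolding P_def by (subst sum.atMost_Suc_shift) (use True in \<open>simp add: confined_weight_0\<close>)
    also have "(\<Sum>j\<le>k. confined_weight V D (Suc j) y / s ^ Suc j) =
       (\<Sum>j\<le>k. (V y * (confined_weight V D j y / s ^ j) + (\<Sum>x\<in>neighbours y. confined_weight V D j x / s ^ j)) / s)"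
      using True by (intro sum.cong refl) (simp add: confined_weight_Suc sum_divide_distrib add_divide_distrib mult.commute)
    also have "\<dots> = (V y * P k y + (\<Sum>x\<in>neighbours y. P k x)) / s"
    proof -
      have "(\<Sum>x\<in>neighbours y. P k x) = (\<Sum>j\<le>k. \<Sum>x\<in>neighbours y. confined_weight V D j x / s ^ j)"
        unfolding P_def by (rule sum.swap)
      then show ?thesis
        unfolding sum_divide_distrib[symmetric] sum.distrib by (simp add: P_def sum_distrib_left)
    qed
    finally have P: "P (Suc k) y = of_bool (y = 0) + (V y * P k y + (\<Sum>x\<in>neighbours y. P k x)) / s" .
    have H: "H (Suc k) y = (of_bool (y = 0) + (\<Sum>x\<in>neighbours y. H k x)) / (s - V y)"
    proof -
      have "H (Suc k) y = of_bool (y = 0) / (s - V y) + (\<Sum>n\<le>k. \<Sum>x\<in>neighbours y. skeleton_green V D s n x) / (s - V y)"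
        unfolding H_def sum.atMost_Suc_shift using True by (simp add: sum_divide_distrib)
      also have "(\<Sum>n\<le>k. \<Sum>x\<in>neighbours y. skeleton_green V D s n x) = (\<Sum>x\<in>neighbours y. H k x)"
        unfolding H_def by (rule sum.swap)
      finally show ?thesis by (simp add: add_divide_distrib)
    qed
    have Hmono: "H k y \<le> H (Suc k) y"
      unfolding H_def using skeleton_green_nonneg[of D V s "Suc k" y] D by simp
    have IH: "P k x \<le> s * H k x" for x unfolding P_def H_def by (rule Suc)
    have "P (Suc k) y \<le> of_bool (y = 0) + (V y * (s * H k y) + (\<Sum>x\<in>neighbours y. s * H k x)) / s"
      unfolding P using s V by (intro add_left_mono divide_right_mono add_mono mult_left_mono sum_mono IH) auto
    also have "\<dots> = of_bool (y = 0) + V y * H k y + (\<Sum>x\<in>neighbours y. H k x)"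
      using s by (simp add: sum_distrib_left[symmetric] field_simps)
    also have "\<dots> \<le> of_bool (y = 0) + V y * H (Suc k) y + (\<Sum>x\<in>neighbours y. H k x)"
      using V Hmono by (intro add_mono mult_left_mono order_refl) auto
    also have "\<dots> = s * H (Suc k) y"
    proof -
      have "(s - V y) * H (Suc k) y = of_bool (y = 0) + (\<Sum>x\<in>neighbours y. H k x)"
        using D[OF True] unfolding H by simp
      then show ?thesis by (simp add: algebra_simps)
    qed
    finally show ?thesis unfolding P_def H_def .
  qed
qed

lemma power_div_fact_le_exp: "(x :: real) \<ge> 0 \<Longrightarrow> x ^ n / fact n \<le> exp x"
  using sum_le_suminf[OF summable_exp[of x], of "{n}"]
  by (simp add: exp_def scaleR_conv_of_real divide_inverse mult.commute)

text \<open>Dividing the recursion of \<open>visiting_mass_Suc_le\<close> by \<open>s ^ j\<close>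
  and summing gives \<open>X <= (m + deg) / s * X + P\<close> with a finite sum \<open>X\<close>.
  Since \<open>s\<close> exceeds \<open>m + deg\<close>, the term in \<open>X\<close> can be
  absorbed, and \<open>P\<close> is a truncated resolvent.\<close>

lemma visiting_mass_le:
  fixes V :: "int ^ 'd \<Rightarrow> real"
  assumes V: "\<And>z. 0 \<le> V z" and D: "\<And>y. y \<in> D \<Longrightarrow> V y \<le> m" and m: "0 \<le> m"
    and s: "s > m + deg TYPE('d)" and t: "t \<ge> 0"
  shows "(\<Sum>j\<le>k. t ^ j / fact j * walk_sum V j (\<lambda>p. of_bool (w \<in> set p \<and> set p \<subseteq> D)))
     \<le> exp (t * s) * (s\<^sup>2 / (s - m - deg TYPE('d)) * (\<Sum>n\<le>k. skeleton_green V D s n w))"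
proof -
  let ?d = "deg TYPE('d)"
  define v where "v j = walk_sum V j (\<lambda>p. of_bool (w \<in> set p \<and> set p \<subseteq> D))" for j
  define X where "X = (\<Sum>j\<le>k. v j / s ^ j)"
  define P where "P = (\<Sum>j\<le>k. confined_weight V D j w / s ^ j)"
  have d: "?d \<ge> 2" by (rule deg_ge_2)
  have s0: "s > 0" using s m d by linarith
  have v0: "0 \<le> v j" for j unfolding v_def by (intro walk_sum_nonneg V) auto
  have X0: "0 \<le> X" unfolding X_def using v0 s0 by (intro sum_nonneg) auto
  have p0: "0 \<le> confined_weight V D j w" for j
    unfolding confined_weight_def by (intro walk_sum_nonneg V) auto
  have v_0: "v 0 \<le> confined_weight V D 0 w"
    by (auto simp: v_def walk_sum_0 confined_weight_0)
  have v_Suc: "v (Suc j) \<le> (m + ?d) * v j + confined_weight V D (Suc j) w" for j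
    unfolding v_def by (rule visiting_mass_Suc_le[OF V D])
  have "X \<le> (m + ?d) / s * X + P"
  proof (cases k)
    case 0
    then have "X \<le> P" using v_0 by (simp add: X_def P_def)
    moreover have "0 \<le> (m + ?d) / s * X" using X0 m d s0 by auto
    ultimately show ?thesis by linarith
  next
    case (Suc k')
    have "X = v 0 + (\<Sum>j\<le>k'. v (Suc j) / s ^ Suc j)"
      unfolding X_def Suc by (subst sum.atMost_Suc_shift) simp
    also have "\<dots> \<le> confined_weight V D 0 w +
        (\<Sum>j\<le>k'. ((m + ?d) * v j + confined_weight V D (Suc j) w) / s ^ Suc j)"
      using s0 by (intro add_mono v_0 sum_mono divide_right_mono v_Suc) auto
    also have "\<dots> = (m + ?d) / s * (\<Sum>j\<le>k'. v j / s ^ j) + P"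
      unfolding P_def Suc sum.atMost_Suc_shift[of "\<lambda>j. confined_weight V D j w / s ^ j"]
    proof -
      have "((m + ?d) * v j + c) / s ^ Suc j = (m + ?d) / s * (v j / s ^ j) + c / s ^ Suc j" for j c
        by (simp add: add_divide_distrib[of "(m + ?d) * v j"])
      then show "confined_weight V D 0 w + (\<Sum>j\<le>k'. ((m + ?d) * v j + confined_weight V D (Suc j) w) / s ^ Suc j) =
          (m + ?d) / s * (\<Sum>j\<le>k'. v j / s ^ j) + (confined_weight V D 0 w / s ^ 0 + (\<Sum>j\<le>k'. confined_weight V D (Suc j) w / s ^ Suc j))"
        by (simp only: sum.distrib sum_distrib_left) simp
    qed
    also have "(m + ?d) / s * (\<Sum>j\<le>k'. v j / s ^ j) \<le> (m + ?d) / s * X"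
      unfolding X_def Suc using v0 s0 m d by (intro mult_left_mono sum_mono2) auto
    finally show ?thesis by simp
  qed
  then have "X * (s - m - ?d) \<le> P * s"
    using s0 by (simp add: field_simps)
  then have "X \<le> s / (s - m - ?d) * P"
    using s by (simp add: field_simps)
  also have "\<dots> \<le> s / (s - m - ?d) * (s * (\<Sum>n\<le>k. skeleton_green V D s n w))"
    unfolding P_def using s s0 D d
    by (intro mult_left_mono confined_weight_resolvent_le V) (fastforce intro: le_less_trans)+
  finally have X: "X \<le> s\<^sup>2 / (s - m - ?d) * (\<Sum>n\<le>k. skeleton_green V D s n w)"
    by (simp add: power2_eq_square)
  have "(\<Sum>j\<le>k. t ^ j / fact j * v j) \<le> (\<Sum>j\<le>k. exp (t * s) * (v j / s ^ j))"
  proof (rule sum_mono)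
    fix j
    have "t ^ j / fact j * v j = ((t * s) ^ j / fact j) * (v j / s ^ j)"
      using s0 by (simp add: power_mult_distrib)
    also have "\<dots> \<le> exp (t * s) * (v j / s ^ j)"
      using s0 t v0 by (intro mult_right_mono power_div_fact_le_exp) auto
    finally show "t ^ j / fact j * v j \<le> exp (t * s) * (v j / s ^ j)" .
  qed
  also have "\<dots> = exp (t * s) * X" by (simp add: X_def sum_distrib_left)
  also have "\<dots> \<le> exp (t * s) * (s\<^sup>2 / (s - m - ?d) * (\<Sum>n\<le>k. skeleton_green V D s n w))"
    by (intro mult_left_mono X) auto
  finally show ?thesis by (simp only: v_def)
qed

section \<open>Resolvent bounds\<close>

lemma sum_skip_init_le:
  fixes f :: "nat \<Rightarrow> real"
  assumes "\<And>n. n < a \<Longrightarrow> f n = 0" "\<And>n. f n \<le> c * x ^ n" "0 \<le> x" "x \<le> 1/2" "0 \<le> c"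
  shows "(\<Sum>n\<le>k. f n) \<le> 2 * c * x ^ a"
proof -
  have "(\<Sum>n\<le>k. f n) \<le> (\<Sum>n\<in>{a..<a + Suc k}. c * x ^ n)"
  proof -
    have "(\<Sum>n\<le>k. f n) = (\<Sum>n\<in>{a..k}. f n)"
      using assms(1) by (intro sum.mono_neutral_right) auto
    also have "\<dots> \<le> (\<Sum>n\<in>{a..k}. c * x ^ n)" by (intro sum_mono assms)
    also have "\<dots> \<le> (\<Sum>n\<in>{a..<a + Suc k}. c * x ^ n)"
      using assms by (intro sum_mono2) auto
    finally show ?thesis .
  qed
  also have "\<dots> = c * x ^ a * (\<Sum>n<Suc k. x ^ n)"
    by (subst sum.atLeastLessThan_shift_0)
       (simp only: sum_distrib_left power_add atLeast0LessThan mult.assoc diff_add_inverse comp_def)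
  also have "\<dots> \<le> c * x ^ a * 2"
  proof -
    have "(\<Sum>n<Suc k. x ^ n) \<le> (\<Sum>n. x ^ n)"
      using assms by (intro sum_le_suminf summable_geometric) auto
    also have "\<dots> = 1 / (1 - x)" using assms by (intro suminf_geometric) auto
    also have "\<dots> \<le> 2" using assms by (simp add: field_simps)
    finally show ?thesis using assms by (intro mult_left_mono) auto
  qed
  finally show ?thesis by simp
qed

lemma skeleton_green_eq_0: "n < norm1 y \<Longrightarrow> skeleton_green V D s n y = 0"
proof (induction n arbitrary: y)
  case (Suc n)
  have "n < norm1 x" if "x \<in> neighbours y" for x
    using norm1_neighbour_le[of y x] that Suc.prems by (simp add: neighbours_sym[of x])
  then show ?case using Suc.IH by simp
qed auto

text \<open>Crude bound for remote sites: a jump has \<open>deg\<close> choices and costs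
  \<open>1 / (s - m)\<close>, and at least \<open>norm1 y\<close> jumps are needed. Losing the
  geodesic count is harmless there, because the ratio can be made a small constant.\<close>

lemma skeleton_green_far_le:
  fixes V :: "int ^ 'd \<Rightarrow> real"
  assumes D: "\<And>y. y \<in> D \<Longrightarrow> V y \<le> m" and s: "2 * deg TYPE('d) \<le> s - m"
  shows "(\<Sum>n\<le>k. skeleton_green V D s n y) \<le> 2 / (s - m) * (deg TYPE('d) / (s - m)) ^ norm1 y"
proof -
  let ?d = "deg TYPE('d)"
  have d: "?d \<ge> 2" by (rule deg_ge_2)
  have sm: "s - m > 0" using s d by linarith
  have le: "skeleton_green V D s n y \<le> 1 / (s - m) * (?d / (s - m)) ^ n" for n y
  proof (induction n arbitrary: y)
    case 0
    show ?case using D[of y] sm by (auto intro!: divide_left_mono)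
  next
    case (Suc n)
    show ?case
    proof (cases "y \<in> D")
      case True
      have "skeleton_green V D s (Suc n) y = 1 / (s - V y) * (\<Sum>x\<in>neighbours y. skeleton_green V D s n x)"
        using True by simp
      also have "\<dots> \<le> 1 / (s - V y) * (\<Sum>x\<in>neighbours y. 1 / (s - m) * (?d / (s - m)) ^ n)"
        using D[OF True] sm by (intro mult_left_mono sum_mono Suc) auto
      also have "\<dots> = 1 / (s - V y) * (?d * (1 / (s - m) * (?d / (s - m)) ^ n))"
        by (simp only: sum_neighbours_const)
      also have "\<dots> \<le> 1 / (s - m) * (?d * (1 / (s - m) * (?d / (s - m)) ^ n))"
        using D[OF True] sm d by (intro mult_right_mono divide_left_mono) auto
      finally show ?thesis by (simp add: mult_ac)
    qed (use sm d in auto)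
  qed
  show ?thesis
    using sum_skip_init_le[of "norm1 y" "\<lambda>n. skeleton_green V D s n y" "1 / (s - m)" "?d / (s - m)" k]
      le skeleton_green_eq_0[of _ y V D s] sm d s by (simp add: field_simps)
qed

section \<open>Jump chains and their repeated visits\<close>

primrec skeletons :: "nat \<Rightarrow> (int ^ 'd) list set" where
  "skeletons 0 = {[0]}"
| "skeletons (Suc n) = (\<Union>p\<in>skeletons n. (\<lambda>y. y # p) ` neighbours (hd p))"

lemma finite_skeletons: "finite (skeletons n)"
  by (induction n) (auto simp: finite_neighbours)

lemma skeletons_length: "p \<in> skeletons n \<Longrightarrow> length p = Suc n"
  by (induction n arbitrary: p) auto

lemma sum_skeletons_Suc:
  "(\<Sum>p\<in>skeletons (Suc n). f p) = (\<Sum>q\<in>skeletons n. \<Sum>y\<in>neighbours (hd q). f (y # q))"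
proof -
  have "(\<Sum>p\<in>skeletons (Suc n). f p) = (\<Sum>q\<in>skeletons n. \<Sum>p\<in>(\<lambda>y. y # q) ` neighbours (hd q). f p)"
    unfolding skeletons.simps
    by (intro sum.UNION_disjoint finite_skeletons ballI impI) (auto simp: finite_neighbours)
  then show ?thesis by (simp add: sum.reindex inj_on_def)
qed

lemma skeleton_green_eq_sum:
  "skeleton_green V D s n y =
     (\<Sum>p\<in>skeletons n. of_bool (hd p = y \<and> set p \<subseteq> D) * (\<Prod>x\<leftarrow>p. 1 / (s - V x)))"
proof (induction n arbitrary: y)
  case 0 then show ?case by auto
next
  case (Suc n)
  have "skeleton_green V D s (Suc n) y = of_bool (y \<in> D) / (s - V y) *
      (\<Sum>x\<in>neighbours y. \<Sum>p\<in>skeletons n. of_bool (hd p = x \<and> set p \<subseteq> D) * (\<Prod>x\<leftarrow>p. 1 / (s - V x)))"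
    by (simp add: Suc)
  also have "(\<Sum>x\<in>neighbours y. \<Sum>p\<in>skeletons n. of_bool (hd p = x \<and> set p \<subseteq> D) * (\<Prod>x\<leftarrow>p. 1 / (s - V x))) =
      (\<Sum>p\<in>skeletons n. \<Sum>x\<in>neighbours y. of_bool (hd p = x \<and> set p \<subseteq> D) * (\<Prod>x\<leftarrow>p. 1 / (s - V x)))"
    by (rule sum.swap)
  also have "\<dots> = (\<Sum>p\<in>skeletons n. of_bool (hd p \<in> neighbours y \<and> set p \<subseteq> D) * (\<Prod>x\<leftarrow>p. 1 / (s - V x)))"
  proof (rule sum.cong[OF refl])
    fix p :: "(int ^ 'a) list"
    have "(\<Sum>x\<in>neighbours y. of_bool (hd p = x \<and> set p \<subseteq> D) * (\<Prod>x\<leftarrow>p. 1 / (s - V x))) =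
        (\<Sum>x\<in>neighbours y. if x = hd p then of_bool (set p \<subseteq> D) * (\<Prod>x\<leftarrow>p. 1 / (s - V x)) else 0)"
      by (intro sum.cong refl) auto
    then show "(\<Sum>x\<in>neighbours y. of_bool (hd p = x \<and> set p \<subseteq> D) * (\<Prod>x\<leftarrow>p. 1 / (s - V x))) =
        of_bool (hd p \<in> neighbours y \<and> set p \<subseteq> D) * (\<Prod>x\<leftarrow>p. 1 / (s - V x))"
      by (simp add: finite_neighbours)
  qed
  also have "of_bool (y \<in> D) / (s - V y) * \<dots> =
      (\<Sum>p\<in>skeletons n. of_bool (y \<in> D) / (s - V y) * (of_bool (hd p \<in> neighbours y \<and> set p \<subseteq> D) * (\<Prod>x\<leftarrow>p. 1 / (s - V x))))"
    by (rule sum_distrib_left)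
  also have "\<dots> = (\<Sum>p\<in>skeletons n. \<Sum>z\<in>neighbours (hd p).
      of_bool (hd (z # p) = y \<and> set (z # p) \<subseteq> D) * (\<Prod>x\<leftarrow>z # p. 1 / (s - V x)))"
  proof (rule sum.cong[OF refl])
    fix p :: "(int ^ 'a) list"
    have "(\<Sum>z\<in>neighbours (hd p). of_bool (hd (z # p) = y \<and> set (z # p) \<subseteq> D) * (\<Prod>x\<leftarrow>z # p. 1 / (s - V x))) =
        (\<Sum>z\<in>neighbours (hd p). if z = y then of_bool (set (y # p) \<subseteq> D) * (\<Prod>x\<leftarrow>y # p. 1 / (s - V x)) else 0)"
      by (intro sum.cong refl) auto
    then show "of_bool (y \<in> D) / (s - V y) * (of_bool (hd p \<in> neighbours y \<and> set p \<subseteq> D) * (\<Prod>x\<leftarrow>p. 1 / (s - V x))) =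
        (\<Sum>z\<in>neighbours (hd p). of_bool (hd (z # p) = y \<and> set (z # p) \<subseteq> D) * (\<Prod>x\<leftarrow>z # p. 1 / (s - V x)))"
      using neighbours_sym[of y "hd p"] by (simp add: finite_neighbours)
  qed
  finally show ?case by (simp only: sum_skeletons_Suc)
qed

lemma skeletons_norm1_attained:
  "p \<in> skeletons n \<Longrightarrow> j \<le> norm1 (hd p) \<Longrightarrow> \<exists>x\<in>set p. norm1 x = j"
proof (induction n arbitrary: p)
  case (Suc n)
  then obtain q y where q: "q \<in> skeletons n" "y \<in> neighbours (hd q)" "p = y # q" by auto
  show ?case
  proof (cases "j \<le> norm1 (hd q)")
    case True
    then show ?thesis using Suc.IH[OF q(1)] q by auto
  next
    case False
    then have "j = norm1 y" using norm1_neighbour_le[OF q(2)] Suc.prems q by simp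
    then show ?thesis using q by auto
  qed
qed auto

text \<open>One step changes \<open>norm1\<close> by at most one, so the path meets every level
  between the origin and its end.\<close>

lemma skeletons_card_ge:
  assumes "p \<in> skeletons n" shows "Suc (norm1 (hd p)) \<le> card (set p)"
proof -
  have "{..norm1 (hd p)} \<subseteq> norm1 ` set p"
    using skeletons_norm1_attained[OF assms] by force
  then have "card {..norm1 (hd p)} \<le> card (norm1 ` set p)" by (intro card_mono) auto
  also have "\<dots> \<le> card (set p)" by (intro card_image_le) auto
  finally show ?thesis by simp
qed

text \<open>The repeated visits to sites satisfying \<open>P\<close> are among all repeated visits,
  of which there are \<open>length p - card (set p)\<close>.\<close>

lemma length_filter_card_le:
  "length (filter P p) + card (set p) \<le> card {x \<in> set p. P x} + length p"
proof -
  have "card (set p) = card ({x \<in> set p. P x} \<union> {x \<in> set p. \<not> P x})"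
    by (rule arg_cong[where f = card]) auto
  also have "\<dots> = card {x \<in> set p. P x} + card {x \<in> set p. \<not> P x}"
    by (intro card_Un_disjoint) auto
  also have "card {x \<in> set p. \<not> P x} \<le> length (filter (\<lambda>x. \<not> P x) p)"
    using card_length[of "filter (\<lambda>x. \<not> P x) p"] by simp
  finally show ?thesis using sum_length_filter_compl[of P p] by linarith
qed

lemma skeletons_chain:
  "p \<in> skeletons n \<Longrightarrow> i < length p \<Longrightarrow> j \<le> i \<Longrightarrow> norm1 (p ! i - p ! j) \<le> i - j"
proof (induction n arbitrary: p i j)
  case (Suc n)
  then obtain q y where q: "q \<in> skeletons n" "y \<in> neighbours (hd q)" "p = y # q" by auto
  have qn: "q \<noteq> []" using skeletons_length[OF q(1)] by auto
  show ?case
  proof (cases j)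
    case (Suc j')
    then show ?thesis using Suc.IH[OF q(1), of "i - 1" j'] Suc.prems q by (cases i) auto
  next
    case 0
    show ?thesis
    proof (cases i)
      case (Suc i')
      have "norm1 (q ! i' - q ! 0) \<le> i'"
        using Suc.IH[OF q(1), of i' 0] Suc.prems q Suc by simp
      moreover have "norm1 (q ! 0 - y) = 1"
        using q(2) qn by (simp add: in_neighbours_iff norm1_commute[of y] hd_conv_nth)
      ultimately show ?thesis
        using norm1_triangle_diff[of "q ! i'" y "q ! 0"] 0 Suc q by simp
    qed (use 0 in simp)
  qed
qed auto

text \<open>
  Cutting the path into blocks of length \<open>L\<close> confines each block to a ball of radius \<open>L\<close>.
\<close>

lemma sparse_set_on_skeleton:
  fixes p :: "(int ^ 'd) list"
  assumes L: "L \<ge> 1" and sparse: "\<And>x. x \<in> B \<Longrightarrow> card (lball x L \<inter> H) \<le> m"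
    and chain: "\<And>i j. i < length p \<Longrightarrow> j \<le> i \<Longrightarrow> norm1 (p ! i - p ! j) \<le> i - j"
    and p: "set p \<subseteq> B"
  shows "card (set p \<inter> H) \<le> m * (length p div L + 1)"
  using chain p
proof (induction "length p" arbitrary: p rule: less_induct)
  case less
  show ?case
  proof (cases "p = []")
    case False
    have "set (take L p) \<inter> H \<subseteq> lball (hd p) L \<inter> H"
    proof safe
      fix x assume "x \<in> set (take L p)"
      then obtain i where i: "i < L" "i < length p" "x = p ! i"
        by (auto simp: in_set_conv_nth)
      then have "norm1 (x - p ! 0) \<le> i" using less.prems(1)[of i 0] by simp
      then show "x \<in> lball (hd p) L" using i False by (simp add: lball_def hd_conv_nth)
    qed
    then have "card (set (take L p) \<inter> H) \<le> card (lball (hd p) L \<inter> H)"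
      by (intro card_mono) auto
    also have "\<dots> \<le> m" using less.prems(2) False by (intro sparse) auto
    finally have 1: "card (set (take L p) \<inter> H) \<le> m" .
    show ?thesis
    proof (cases "length p \<le> L")
      case True
      then show ?thesis using 1 by (simp add: add_increasing2)
    next
      case False
      have "card (set (drop L p) \<inter> H) \<le> m * (length (drop L p) div L + 1)"
      proof (rule less.hyps)
        show "length (drop L p) < length p" using L False by simp
        show "norm1 (drop L p ! i - drop L p ! j) \<le> i - j" if "i < length (drop L p)" "j \<le> i" for i j
          using less.prems(1)[of "L + i" "L + j"] that by simp
        show "set (drop L p) \<subseteq> B" using less.prems(2) set_drop_subset[of L p] by blast
      qed
      moreover have "length (drop L p) div L + 1 = length p div L"
        using False L by (simp add: le_div_geq)
      ultimately have 2: "card (set (drop L p) \<inter> H) \<le> m * (length p div L)" by metis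
      have "set p \<inter> H = (set (take L p) \<inter> H) \<union> (set (drop L p) \<inter> H)"
        by (metis append_take_drop_id set_append Int_Un_distrib2)
      then have "card (set p \<inter> H) \<le> card (set (take L p) \<inter> H) + card (set (drop L p) \<inter> H)"
        by (metis card_Un_le)
      then show ?thesis using 1 2 by simp
    qed
  qed simp
qed

section \<open>Counting paths by exponential tilting\<close>

definition tilt :: "('d \<Rightarrow> real) \<Rightarrow> int ^ 'd \<Rightarrow> real" where
  "tilt l z = exp (\<Sum>i\<in>UNIV. l i * of_int (z $ i))"

lemma tilt_add: "tilt l (y + z) = tilt l y * tilt l z"
  by (simp add: tilt_def distrib_left sum.distrib exp_add)

lemma tilt_pos: "0 < tilt l z"
  by (simp add: tilt_def)

lemma sum_skeletons_tilt:
  "(\<Sum>p\<in>skeletons n. tilt l (hd p)) = (\<Sum>e\<in>neighbours 0. tilt l e) ^ n"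
proof (induction n)
  case 0 then show ?case by (simp add: tilt_def)
next
  case (Suc n)
  have "(\<Sum>y\<in>neighbours x. tilt l y) = tilt l x * (\<Sum>e\<in>neighbours 0. tilt l e)" for x
    unfolding neighbours_translate[of x]
    by (subst sum.reindex) (auto simp: inj_on_def tilt_add sum_distrib_left)
  then have "(\<Sum>p\<in>skeletons (Suc n). tilt l (hd p)) =
      (\<Sum>q\<in>skeletons n. tilt l (hd q) * (\<Sum>e\<in>neighbours 0. tilt l e))"
    unfolding sum_skeletons_Suc list.sel by (rule sum.cong[OF refl])
  also have "\<dots> = (\<Sum>e\<in>neighbours 0. tilt l e) ^ Suc n"
    by (simp only: sum_distrib_right[symmetric] Suc power_Suc mult.commute)
  finally show ?case .
qed

text \<open>Exponential Markov inequality: \<open>tilt\<close> is multiplicative, so the tilted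
  weight of all paths with \<open>n\<close> jumps is an \<open>n\<close>-th power, and each path
  ending at \<open>w\<close> carries weight \<open>tilt l w\<close>.\<close>

lemma card_skeletons_le:
  "real (card {p \<in> skeletons n. hd p = w}) \<le> (\<Sum>e\<in>neighbours 0. tilt l e) ^ n / tilt l w"
proof -
  have "real (card {p \<in> skeletons n. hd p = w}) * tilt l w = (\<Sum>p\<in>{p \<in> skeletons n. hd p = w}. tilt l (hd p))"
    by simp
  also have "\<dots> \<le> (\<Sum>p\<in>skeletons n. tilt l (hd p))"
    by (intro sum_mono2 finite_skeletons) (auto intro: less_imp_le tilt_pos)
  finally show ?thesis
    unfolding sum_skeletons_tilt using tilt_pos[of l w] by (simp add: field_simps)
qed

text \<open>The multinomial coefficient counting the orders in which the required unit steps can be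
  made, that is, the shortest paths from the origin.\<close>

definition geodesics :: "int ^ 'd \<Rightarrow> real" where
  "geodesics z = fact (norm1 z) / (\<Prod>i\<in>UNIV. fact (nat \<bar>z $ i\<bar>))"

lemma geodesics_pos: "geodesics z > 0"
  by (auto simp: geodesics_def intro!: divide_pos_pos prod_pos)

text \<open>Stirling-type bound. The induction step is
  \<open>(k / (k + 1)) ^ (k + 1) <= exp (- 1)\<close>; the factor \<open>k + 1\<close> instead of
  \<open>k\<close> admits \<open>k = 0\<close>.\<close>

lemma fact_exp_le: "fact k * exp (real k) \<le> exp 1 * (real k + 1) * real k ^ k"
proof (cases "k = 0")
  case False
  have "fact (Suc n) * exp (real (Suc n)) \<le> exp 1 * real (Suc n) * real (Suc n) ^ Suc n" for n
  proof (induction n)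
    case (Suc n)
    let ?k = "Suc n"
    have "exp 1 * real ?k ^ Suc ?k \<le> real (Suc ?k) ^ Suc ?k"
    proof -
      have "exp (- 1 / real (Suc ?k)) \<ge> 1 + (- 1 / real (Suc ?k))" by (rule exp_ge_add_one_self)
      then have "real ?k / real (Suc ?k) \<le> exp (- 1 / real (Suc ?k))" by (simp add: field_simps)
      then have "(real ?k / real (Suc ?k)) ^ Suc ?k \<le> exp (- 1 / real (Suc ?k)) ^ Suc ?k"
        by (intro power_mono) auto
      also have "\<dots> = exp (- 1)" by (simp add: exp_of_nat_mult[symmetric] del: power_Suc of_nat_Suc)
      finally show ?thesis by (simp add: power_divide exp_minus field_simps del: power_Suc of_nat_Suc)
    qed
    have "fact (Suc ?k) * exp (real (Suc ?k)) = real (Suc ?k) * exp 1 * (fact ?k * exp (real ?k))"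
    proof -
      have "exp (real (Suc ?k)) = exp 1 * exp (real ?k)" by (simp add: exp_add[symmetric])
      then show ?thesis by (simp only: fact_Suc mult_ac of_nat_id)
    qed
    also have "\<dots> \<le> real (Suc ?k) * exp 1 * (exp 1 * real ?k * real ?k ^ ?k)"
      by (rule mult_left_mono[OF Suc]) simp
    also have "\<dots> = exp 1 * real (Suc ?k) * (exp 1 * real ?k ^ Suc ?k)" by (simp only: mult_ac power_Suc)
    also have "\<dots> \<le> exp 1 * real (Suc ?k) * real (Suc ?k) ^ Suc ?k"
      by (rule mult_left_mono[OF \<open>exp 1 * real ?k ^ Suc ?k \<le> _\<close>]) simp
    finally show ?case .
  qed simp
  from this[of "k - 1"] False have "fact k * exp (real k) \<le> exp 1 * real k * real k ^ k" by simp
  also have "\<dots> \<le> exp 1 * (real k + 1) * real k ^ k" by (intro mult_right_mono) auto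
  finally show ?thesis .
qed simp

text \<open>For nonzero \<open>w\<close>, \<open>geodesics w\<close> times the product is the
  multinomial probability of an outcome that equals its own mean. By Stirling it is only
  polynomially small, so up to polynomial factors the geodesic count is the exponential of an
  entropy.\<close>

lemma prod_nat_power_ge:
  fixes w :: "int ^ 'd"
  shows "1 \<le> geodesics w * (exp 1 * (real (norm1 w) + 1)) ^ CARD('d) *
     (\<Prod>i\<in>UNIV. (real (nat \<bar>w $ i\<bar>) / real (norm1 w)) ^ nat \<bar>w $ i\<bar>)"
proof (cases "norm1 w = 0")
  case True
  then have "nat \<bar>w $ i\<bar> = 0" for i by (simp add: norm1_def)
  moreover have "(1::real) \<le> exp 1 ^ CARD('d)" by (intro one_le_power) simp
  ultimately show ?thesis using True by (simp add: geodesics_def)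
next
  case False
  let ?n = "norm1 w" and ?k = "\<lambda>i. nat \<bar>w $ i\<bar>"
  have n: "?n = (\<Sum>i\<in>UNIV. ?k i)" by (simp add: norm1_def)
  have "real ?n ^ ?n \<le> fact ?n * exp (real ?n)"
    using power_div_fact_le_exp[of "real ?n" ?n] by (simp add: field_simps)
  moreover have "(\<Prod>i\<in>UNIV. fact (?k i)) * exp (real ?n) \<le>
      (exp 1 * (real ?n + 1)) ^ CARD('d) * (\<Prod>i\<in>UNIV. real (?k i) ^ ?k i)"
  proof -
    have "(\<Prod>i\<in>UNIV. fact (?k i)) * exp (real ?n) = (\<Prod>i\<in>UNIV. fact (?k i) * exp (real (?k i)))"
      unfolding n by (simp add: exp_sum prod.distrib)
    also have "\<dots> \<le> (\<Prod>i\<in>UNIV. (exp 1 * (real ?n + 1)) * real (?k i) ^ ?k i)"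
    proof (intro prod_mono conjI)
      fix i
      have "fact (?k i) * exp (real (?k i)) \<le> exp 1 * (real (?k i) + 1) * real (?k i) ^ ?k i"
        by (rule fact_exp_le)
      also have "\<dots> \<le> (exp 1 * (real ?n + 1)) * real (?k i) ^ ?k i"
        using norm1_component_le[of w i] by (intro mult_right_mono mult_left_mono add_right_mono) auto
      finally show "fact (?k i) * exp (real (?k i)) \<le> (exp 1 * (real ?n + 1)) * real (?k i) ^ ?k i" .
    qed auto
    also have "\<dots> = (exp 1 * (real ?n + 1)) ^ CARD('d) * (\<Prod>i\<in>UNIV. real (?k i) ^ ?k i)"
      by (simp add: prod.distrib)
    finally show ?thesis .
  qed
  ultimately have "real ?n ^ ?n * ((\<Prod>i\<in>UNIV. fact (?k i)) * exp (real ?n)) \<le>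
     (fact ?n * exp (real ?n)) * ((exp 1 * (real ?n + 1)) ^ CARD('d) * (\<Prod>i\<in>UNIV. real (?k i) ^ ?k i))"
    by (rule mult_mono) (auto intro!: prod_nonneg mult_nonneg_nonneg)
  then have "(real ?n ^ ?n * (\<Prod>i\<in>UNIV. fact (?k i))) * exp (real ?n) \<le>
     (fact ?n * ((exp 1 * (real ?n + 1)) ^ CARD('d) * (\<Prod>i\<in>UNIV. real (?k i) ^ ?k i))) * exp (real ?n)"
    by (simp only: mult_ac)
  then have main: "real ?n ^ ?n * (\<Prod>i\<in>UNIV. fact (?k i)) \<le>
     fact ?n * ((exp 1 * (real ?n + 1)) ^ CARD('d) * (\<Prod>i\<in>UNIV. real (?k i) ^ ?k i))"
    by (rule mult_right_le_imp_le) simp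
  have eq: "(\<Prod>i\<in>UNIV. (real (?k i) / real ?n) ^ ?k i) = (\<Prod>i\<in>UNIV. real (?k i) ^ ?k i) / real ?n ^ ?n"
  proof -
    have "real ?n ^ ?n = (\<Prod>i\<in>UNIV. real ?n ^ ?k i)"
      using n by (metis power_sum)
    then show ?thesis by (simp add: power_divide prod_dividef)
  qed
  have "(\<Prod>i\<in>UNIV. fact (?k i)) > (0::real)" by (intro prod_pos) auto
  moreover have "real ?n ^ ?n > 0" using False by simp
  moreover have "1 \<le> f / p * e * (q / m)" if "m * p \<le> f * (e * q)" "p > 0" "m > 0" for f p e q m :: real
    using that by (simp add: field_simps)
  ultimately show ?thesis
    unfolding geodesics_def eq using main by blast
qed

lemma prod_list_le_power:
  fixes f :: "'b \<Rightarrow> real"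
  assumes "\<And>x. x \<in> set p \<Longrightarrow> 0 \<le> f x" "\<And>x. x \<in> set p \<Longrightarrow> f x \<le> (if P x then a else 1) * c" "0 \<le> a" "0 \<le> c"
  shows "(\<Prod>x\<leftarrow>p. f x) \<le> a ^ length (filter P p) * c ^ length p \<and> 0 \<le> (\<Prod>x\<leftarrow>p. f x)"
  using assms(1,2)
proof (induction p)
  case (Cons x p)
  have IH: "(\<Prod>x\<leftarrow>p. f x) \<le> a ^ length (filter P p) * c ^ length p" "0 \<le> (\<Prod>x\<leftarrow>p. f x)"
    using Cons by auto
  have "f x * (\<Prod>x\<leftarrow>p. f x) \<le> ((if P x then a else 1) * c) * (a ^ length (filter P p) * c ^ length p)"
    using Cons.prems IH assms(3,4) by (intro mult_mono) auto
  then show ?case using IH Cons.prems by (auto simp: mult_ac)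
qed simp

text \<open>
  The tilt that is optimal for the direction of \<open>w\<close> has \<open>exp (l i)\<close> proportional to \<open>\<bar>w $ i\<bar>\<close>; cutting it off
  at \<open>1\<close> keeps the contribution of the backward steps bounded.
\<close>

lemma exists_tilt:
  fixes w :: "int ^ 'd"
  assumes \<tau>: "\<tau> > 0"
  obtains l where "(\<Sum>e\<in>neighbours 0. tilt l e) \<le> \<tau> + deg TYPE('d)"
    and "1 / tilt l w \<le> geodesics w * (exp 1 * (real (norm1 w) + 1)) ^ CARD('d) * (1 / \<tau>) ^ norm1 w"
proof -
  let ?k = "\<lambda>i. nat \<bar>w $ i\<bar>"
  define p where "p i = real (?k i) / real (norm1 w)" for i
  define a where "a i = max 1 (\<tau> * p i)" for i
  define l where "l i = of_int (sgn (w $ i)) * ln (a i)" for i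
  have a1: "a i \<ge> 1" for i by (simp add: a_def)
  have p0: "0 \<le> p i" for i by (simp add: p_def)
  have psum: "(\<Sum>i\<in>UNIV. p i) \<le> 1"
    unfolding p_def sum_divide_distrib[symmetric] by (simp add: norm1_def del: of_nat_nat)
  have tilt_axis: "tilt l (axis i c) = exp (l i * of_int c)" for i c
  proof -
    have "(\<Sum>j\<in>UNIV. l j * of_int (axis i c $ j)) = (\<Sum>j\<in>UNIV. if j = i then l i * of_int c else 0)"
      by (intro sum.cong refl) (auto simp: axis_def)
    then show ?thesis by (simp add: tilt_def)
  qed
  have ax: "tilt l (axis i 1) + tilt l (axis i (-1)) \<le> \<tau> * p i + 2" for i
  proof -
    \<comment> \<open>The step towards \<open>w\<close> has weight \<open>a i\<close>, the opposite
      one \<open>1 / a i\<close>, which the cutoff keeps below \<open>1\<close>.\<close>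
    have "exp (l i) + exp (- l i) \<le> a i + 1"
    proof -
      have "exp (ln (a i)) = a i" "exp (- ln (a i)) = 1 / a i"
        using a1[of i] by (auto simp: exp_minus divide_inverse)
      moreover have "1 / a i \<le> 1" using a1[of i] by simp
      ultimately show ?thesis using a1[of i] by (auto simp: l_def sgn_if)
    qed
    also have "a i \<le> \<tau> * p i + 1" using p0[of i] \<tau> by (simp add: a_def)
    finally show ?thesis by (simp add: tilt_axis)
  qed
  have "(\<Sum>e\<in>neighbours 0. tilt l e) \<le> (\<Sum>i\<in>UNIV. \<tau> * p i + 2)"
    unfolding sum_neighbours_0 by (intro sum_mono ax)
  also have "\<dots> = \<tau> * (\<Sum>i\<in>UNIV. p i) + deg TYPE('d)"
    by (simp add: sum.distrib sum_distrib_left deg_eq)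
  also have "\<dots> \<le> \<tau> + deg TYPE('d)"
    using mult_left_mono[OF psum, of \<tau>] \<tau> by simp
  finally have 1: "(\<Sum>e\<in>neighbours 0. tilt l e) \<le> \<tau> + deg TYPE('d)" .
  have "tilt l w = (\<Prod>i\<in>UNIV. a i ^ ?k i)"
  proof -
    have "l i * of_int (w $ i) = real (?k i) * ln (a i)" for i
      by (auto simp: l_def sgn_if)
    moreover have "exp (real (?k i) * ln (a i)) = a i ^ ?k i" for i
      using a1[of i] by (simp add: exp_of_nat_mult del: of_nat_nat)
    ultimately show ?thesis by (simp only: tilt_def exp_sum[OF finite])
  qed
  also have "\<dots> \<ge> (\<Prod>i\<in>UNIV. (\<tau> * p i) ^ ?k i)"
    using \<tau> p0 by (intro prod_mono conjI power_mono zero_le_power mult_nonneg_nonneg) (auto simp: a_def)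
  also have "(\<Prod>i\<in>UNIV. (\<tau> * p i) ^ ?k i) = \<tau> ^ norm1 w * (\<Prod>i\<in>UNIV. p i ^ ?k i)"
    by (simp add: power_mult_distrib prod.distrib norm1_def power_sum)
  finally have ge: "\<tau> ^ norm1 w * (\<Prod>i\<in>UNIV. p i ^ ?k i) \<le> tilt l w" .
  let ?G = "geodesics w * (exp 1 * (real (norm1 w) + 1)) ^ CARD('d)"
  have G: "1 \<le> ?G * (\<Prod>i\<in>UNIV. p i ^ ?k i)"
    unfolding p_def by (rule prod_nat_power_ge)
  have G0: "0 < ?G" using geodesics_pos[of w] by (intro mult_pos_pos) auto
  have "\<tau> ^ norm1 w * 1 \<le> \<tau> ^ norm1 w * (?G * (\<Prod>i\<in>UNIV. p i ^ ?k i))"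
    using \<tau> by (intro mult_left_mono G) auto
  also have "\<dots> = ?G * (\<tau> ^ norm1 w * (\<Prod>i\<in>UNIV. p i ^ ?k i))" by (simp only: mult_ac)
  also have "\<dots> \<le> ?G * tilt l w" using G0 by (intro mult_left_mono ge) auto
  finally have "\<tau> ^ norm1 w \<le> ?G * tilt l w" by simp
  then have "1 / tilt l w \<le> ?G * (1 / \<tau>) ^ norm1 w"
    using \<tau> tilt_pos[of l w] by (simp add: power_one_over field_simps)
  with 1 show ?thesis by (rule that)
qed

text \<open>
  A path of \<open>n\<close> jumps from \<open>0\<close> to \<open>w\<close> revisits sites at most \<open>n - norm1 w\<close> times, so apart from the
  sparse set of distinct high sites each visit to a site with potential above \<open>\<psi>\<close> is paid for by an excess
  jump.
\<close>

lemma skeleton_green_near_le: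
  fixes V :: "int ^ 'd \<Rightarrow> real"
  assumes DB: "D \<subseteq> lball 0 R"
    and sparse: "\<And>x. x \<in> lball 0 R \<Longrightarrow> card (lball x L \<inter> {y. \<psi> < V y}) \<le> m"
    and L: "L \<ge> 1" and g: "g > 0" and Dg: "\<And>y. y \<in> D \<Longrightarrow> V y + g \<le> s"
    and q: "g \<le> s - \<psi>" and \<epsilon>: "0 < \<epsilon>" "\<epsilon> < 1"
    and K: "K = ln ((s - \<psi>) / g)"
    and \<sigma>: "2 * deg TYPE('d) \<le> \<epsilon> * (g * exp (- (K * m / L)))"
  shows "(\<Sum>n\<le>k. skeleton_green V D s n w) \<le>
    2 / (\<epsilon> * (s - \<psi>)) * exp (K * (2 * real m + real m * real (norm1 w) / real L)) * (1 / (1 - \<epsilon>)) ^ norm1 w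
      * (exp 1 * (real (norm1 w) + 1)) ^ CARD('d) * (geodesics w / (s - \<psi>) ^ norm1 w)"
proof -
  define q where "q = s - \<psi>"
  define a where "a = q / g"
  \<comment> \<open>The inverse of the amortised cost of a jump: \<open>1 / q\<close> for a low
    site, times \<open>a\<close> for an excess visit to a high one, times the share
    \<open>exp (K * m / L)\<close> of the distinct high sites in a block of length
    \<open>L\<close>.\<close>
  define sg where "sg = g * exp (- (K * m / L))"
  have q0: "q > 0" and qg: "g \<le> q" using g q by (auto simp: q_def)
  have a1: "a \<ge> 1" using g qg by (simp add: a_def)
  have K0: "K \<ge> 0" and expK: "exp K = a" using a1 K by (auto simp: a_def q_def ln_ge_zero)
  have sg0: "sg > 0" using g by (simp add: sg_def)
  have asg: "a * exp (K * m / L) / q = 1 / sg"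
    using g q0 by (simp add: a_def sg_def exp_minus field_simps)
  \<comment> \<open>Only \<open>n - norm1 w\<close> jumps can be excess jumps, but
    \<open>1 / sg\<close> charges \<open>a\<close> to all \<open>n\<close>; the factor
    \<open>(g / q) ^ norm1 w\<close> is the refund.\<close>
  define C where "C = 1 / q * exp (2 * m * K) * (g / q) ^ norm1 w"
  have C0: "C > 0" using g q0 by (simp add: C_def)
  have prod_le: "(\<Prod>x\<leftarrow>p. 1 / (s - V x)) \<le> C * (1 / sg) ^ n"
    if p: "p \<in> skeletons n" "hd p = w" "set p \<subseteq> D" for n p
  proof -
    have len: "length p = Suc n" using p by (simp add: skeletons_length)
    let ?h = "length (filter (\<lambda>x. \<psi> < V x) p)"
    have "?h + card (set p) \<le> card (set p \<inter> {y. \<psi> < V y}) + Suc n"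
    proof -
      have "{x \<in> set p. \<psi> < V x} = set p \<inter> {y. \<psi> < V y}" by auto
      then show ?thesis using length_filter_card_le[of "\<lambda>x. \<psi> < V x" p] len by simp
    qed
    moreover have "card (set p \<inter> {y. \<psi> < V y}) \<le> m * (Suc n div L + 1)"
      using sparse_set_on_skeleton[OF L sparse, of "lball 0 R" p] skeletons_chain[OF p(1)] p(3) DB len by auto
    moreover have cge: "Suc (norm1 w) \<le> card (set p)" using skeletons_card_ge[OF p(1)] p by simp
    moreover have cle: "card (set p) \<le> Suc n" using card_length[of p] len by simp
    ultimately have h: "?h \<le> m * (Suc n div L + 1) + (n - norm1 w)" and nw: "norm1 w \<le> n"
      by linarith+
    have "(\<Prod>x\<leftarrow>p. 1 / (s - V x)) \<le> a ^ ?h * (1 / q) ^ length p"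
    proof (rule prod_list_le_power[THEN conjunct1])
      fix x assume x: "x \<in> set p"
      then have sV: "g \<le> s - V x" using Dg[of x] p(3) by auto
      then show "0 \<le> 1 / (s - V x)" using g by auto
      show "1 / (s - V x) \<le> (if \<psi> < V x then a else 1) * (1 / q)"
      proof (cases "\<psi> < V x")
        case True
        then show ?thesis using sV g q0 by (auto simp: a_def intro!: divide_left_mono)
      next
        case False
        then have "q \<le> s - V x" by (simp add: q_def)
        then show ?thesis using False q0 by (auto intro!: divide_left_mono)
      qed
    qed (use a1 q0 in auto)
    also have "a ^ ?h \<le> a ^ (m * (Suc n div L + 1) + (n - norm1 w))"
      using h a1 by (rule power_increasing)
    also have "\<dots> = exp (K * real (m * (Suc n div L + 1) + (n - norm1 w)))"
      by (simp only: exp_of_nat2_mult expK)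
    also have "\<dots> \<le> exp (K * (2 * m + m * n / L + n - norm1 w))"
    proof -
      have "real (Suc n div L) \<le> real (Suc n) / real L" by (rule of_nat_div_le_of_nat)
      also have "\<dots> \<le> real n / real L + 1" using L by (simp add: field_simps)
      finally have "real m * (real (Suc n div L) + 1) \<le> real m * (real n / real L + 1 + 1)"
        by (intro mult_left_mono) auto
      then have "real (m * (Suc n div L + 1) + (n - norm1 w)) \<le> 2 * m + m * n / L + n - norm1 w"
        using nw by (simp add: of_nat_diff algebra_simps)
      from mult_left_mono[OF this K0] show ?thesis by simp
    qed
    also have "\<dots> = exp (2 * m * K) * (g / q) ^ norm1 w * (a * exp (K * m / L)) ^ n"
    proof -
      have "(g / q) ^ norm1 w = exp (- (norm1 w * K))"
        using expK g q0 by (simp add: exp_minus exp_of_nat_mult a_def power_divide)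
      moreover have "(a * exp (K * m / L)) ^ n = exp (n * (K + K * m / L))"
        by (simp add: exp_of_nat_mult exp_add expK)
      ultimately show ?thesis by (simp add: exp_add[symmetric] algebra_simps)
    qed
    finally have "(\<Prod>x\<leftarrow>p. 1 / (s - V x)) \<le> exp (2 * m * K) * (g / q) ^ norm1 w * (a * exp (K * m / L)) ^ n * (1 / q) ^ length p"
      using q0 by simp
    also have "\<dots> = C * (a * exp (K * m / L) / q) ^ n"
      by (simp add: len C_def power_divide)
    finally show ?thesis by (simp add: asg)
  qed
  have H_le: "skeleton_green V D s n w \<le> real (card {p \<in> skeletons n. hd p = w}) * (C * (1 / sg) ^ n)" for n
  proof -
    have "skeleton_green V D s n w \<le> (\<Sum>p\<in>skeletons n. of_bool (hd p = w) * (C * (1 / sg) ^ n))"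
      unfolding skeleton_green_eq_sum
    proof (rule sum_mono)
      fix p :: "(int ^ 'd) list" assume p: "p \<in> skeletons n"
      show "of_bool (hd p = w \<and> set p \<subseteq> D) * (\<Prod>x\<leftarrow>p. 1 / (s - V x)) \<le> of_bool (hd p = w) * (C * (1 / sg) ^ n)"
        using prod_le[OF p] C0 sg0 by (cases "hd p = w \<and> set p \<subseteq> D") auto
    qed
    also have "\<dots> = real (card {p \<in> skeletons n. hd p = w}) * (C * (1 / sg) ^ n)"
      by (simp add: sum_distrib_right[symmetric] of_bool_def sum.If_cases finite_skeletons Int_def)
    finally show ?thesis .
  qed
  \<comment> \<open>The slack \<open>\<epsilon>\<close> makes room for the term \<open>deg\<close>
    in the tilt: the ratio of the geometric series becomes at most
    \<open>1 - \<epsilon> / 2\<close>, at the price of \<open>1 / (1 - \<epsilon>)\<close> per unit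
    of distance.\<close>
  define \<tau> where "\<tau> = (1 - \<epsilon>) * sg"
  have \<tau>0: "\<tau> > 0" using \<epsilon> sg0 by (simp add: \<tau>_def)
  obtain l where l: "(\<Sum>e\<in>neighbours 0. tilt l e) \<le> \<tau> + deg TYPE('d)"
    "1 / tilt l w \<le> geodesics w * (exp 1 * (real (norm1 w) + 1)) ^ CARD('d) * (1 / \<tau>) ^ norm1 w"
    using exists_tilt[OF \<tau>0] by blast
  define c where "c = (\<Sum>e\<in>neighbours 0. tilt l e)"
  have c0: "0 \<le> c" unfolding c_def by (intro sum_nonneg) (auto intro: less_imp_le tilt_pos)
  have "c / sg \<le> (\<tau> + deg TYPE('d)) / sg"
    unfolding c_def using l(1) sg0 by (intro divide_right_mono) auto
  also have "\<dots> = 1 - \<epsilon> + deg TYPE('d) / sg" using sg0 by (simp add: \<tau>_def add_divide_distrib)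
  also have "deg TYPE('d) / sg \<le> \<epsilon> / 2" using \<sigma> sg0 by (simp add: sg_def[symmetric] field_simps)
  finally have x: "c / sg \<le> 1 - \<epsilon> / 2" by simp
  have "(\<Sum>n\<le>k. skeleton_green V D s n w) \<le> (\<Sum>n\<le>k. (c ^ n / tilt l w) * (C * (1 / sg) ^ n))"
  proof (rule sum_mono)
    fix n
    have "skeleton_green V D s n w \<le> real (card {p \<in> skeletons n. hd p = w}) * (C * (1 / sg) ^ n)" by (rule H_le)
    also have "\<dots> \<le> (c ^ n / tilt l w) * (C * (1 / sg) ^ n)"
      unfolding c_def using C0 sg0 by (intro mult_right_mono card_skeletons_le) auto
    finally show "skeleton_green V D s n w \<le> (c ^ n / tilt l w) * (C * (1 / sg) ^ n)" .
  qed
  also have "\<dots> = C * (1 / tilt l w) * (\<Sum>n\<le>k. (c / sg) ^ n)"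
    by (simp add: sum_distrib_left power_divide mult_ac)
  also have "\<dots> \<le> C * (1 / tilt l w) * (2 / \<epsilon>)"
  proof -
    have x0: "0 \<le> c / sg" "c / sg < 1" using c0 sg0 x \<epsilon> by (simp, linarith)
    have "(\<Sum>n\<le>k. (c / sg) ^ n) = (\<Sum>n<Suc k. (c / sg) ^ n)" by (simp add: lessThan_Suc_atMost)
    also have "\<dots> \<le> (\<Sum>n. (c / sg) ^ n)"
      using x0 by (intro sum_le_suminf summable_geometric) auto
    also have "\<dots> = 1 / (1 - c / sg)" using x0 by (intro suminf_geometric) auto
    also have "\<dots> \<le> 1 / (\<epsilon> / 2)" using x \<epsilon> by (intro divide_left_mono) auto
    finally show ?thesis using C0 tilt_pos[of l w] by (intro mult_left_mono) auto
  qed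
  also have "\<dots> \<le> C * (geodesics w * (exp 1 * (real (norm1 w) + 1)) ^ CARD('d) * (1 / \<tau>) ^ norm1 w) * (2 / \<epsilon>)"
    using l(2) C0 \<epsilon> by (intro mult_right_mono mult_left_mono) auto
  also have "\<dots> = 2 / (\<epsilon> * q) * (exp (2 * m * K) * (g / q * (1 / \<tau>)) ^ norm1 w)
      * (exp 1 * (real (norm1 w) + 1)) ^ CARD('d) * geodesics w"
  proof -
    have "2 / (\<epsilon> * q) = 1 / q * (2 / \<epsilon>)" by simp
    then show ?thesis unfolding C_def power_mult_distrib by (simp only: mult_ac)
  qed
  \<comment> \<open>The refund turns the cost of order \<open>1 / g\<close> per unit of distance
    into \<open>1 / q\<close>, up to factors close to \<open>1\<close>. This is what matches the
    lower bound.\<close>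
  also have "g / q * (1 / \<tau>) = exp (K * m / L) * (1 / (1 - \<epsilon>)) * (1 / q)"
    using g q0 \<epsilon> by (simp add: \<tau>_def sg_def exp_minus field_simps)
  also have "exp (2 * m * K) * (exp (K * m / L) * (1 / (1 - \<epsilon>)) * (1 / q)) ^ norm1 w =
      exp (K * (2 * real m + real m * real (norm1 w) / real L)) * (1 / (1 - \<epsilon>)) ^ norm1 w * (1 / q) ^ norm1 w"
  proof -
    have "exp (K * (2 * real m + real m * real (norm1 w) / real L)) = exp (2 * m * K) * exp (K * m / L) ^ norm1 w"
      by (simp add: exp_of_nat2_mult[symmetric] exp_add[symmetric] algebra_simps)
    then show ?thesis unfolding power_mult_distrib by (simp only: mult_ac)
  qed
  finally show ?thesis by (simp add: q_def power_one_over mult_ac divide_inverse power_inverse)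
qed

section \<open>Concentration of the mass near high peaks\<close>

text \<open>Pascal's rule for multinomial coefficients: the last step of a geodesic shortens one
  nonzero coordinate, and the predecessors \<open>y i\<close> are distinct neighbours of
  \<open>z\<close>.\<close>

lemma geodesics_le_path_weight:
  fixes V :: "int ^ 'd \<Rightarrow> real"
  assumes V: "\<And>z. 0 \<le> V z"
  shows "geodesics z \<le> path_weight V (norm1 z) z"
proof (induction "norm1 z" arbitrary: z)
  case 0
  then have "nat \<bar>z $ i\<bar> = 0" for i by (simp add: norm1_def)
  then have "z = 0" by (auto simp: vec_eq_iff)
  then show ?case by (simp add: geodesics_def path_weight_0)
next
  case (Suc n)
  define I where "I = {i. z $ i \<noteq> 0}"
  define y where "y i = z - axis i (sgn (z $ i))" for i
  let ?P = "\<Prod>j\<in>UNIV. fact (nat \<bar>z $ j\<bar>) :: real"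
  have P0: "?P > 0" by (intro prod_pos) auto
  have comp: "y i $ j = (if j = i then z $ i - sgn (z $ i) else z $ j)" for i j
    by (auto simp: y_def axis_def)
  have comp_nat: "nat \<bar>y i $ i\<bar> = nat \<bar>z $ i\<bar> - 1" for i
    by (auto simp: comp sgn_if)
  have norm_y: "norm1 (y i) = n" if "i \<in> I" for i
  proof -
    have "norm1 z = nat \<bar>z $ i\<bar> + (\<Sum>j\<in>UNIV - {i}. nat \<bar>z $ j\<bar>)"
      unfolding norm1_def by (rule sum.remove) auto
    moreover have "norm1 (y i) = nat \<bar>y i $ i\<bar> + (\<Sum>j\<in>UNIV - {i}. nat \<bar>y i $ j\<bar>)"
      unfolding norm1_def by (rule sum.remove) auto
    moreover have "(\<Sum>j\<in>UNIV - {i}. nat \<bar>y i $ j\<bar>) = (\<Sum>j\<in>UNIV - {i}. nat \<bar>z $ j\<bar>)"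
      by (intro sum.cong) (auto simp: comp)
    moreover have "nat \<bar>z $ i\<bar> > 0" using that by (simp add: I_def)
    ultimately show ?thesis using Suc.hyps(2) comp_nat[of i] by linarith
  qed
  have geo_y: "geodesics (y i) = fact n * real (nat \<bar>z $ i\<bar>) / ?P" if "i \<in> I" for i
  proof -
    have k: "nat \<bar>z $ i\<bar> > 0" using that by (simp add: I_def)
    have "?P = fact (nat \<bar>z $ i\<bar>) * (\<Prod>j\<in>UNIV - {i}. fact (nat \<bar>z $ j\<bar>))"
      by (rule prod.remove) auto
    also have "fact (nat \<bar>z $ i\<bar>) = real (nat \<bar>z $ i\<bar>) * fact (nat \<bar>y i $ i\<bar>)"
      unfolding comp_nat using k by (simp add: fact_reduce)
    also have "(\<Prod>j\<in>UNIV - {i}. fact (nat \<bar>z $ j\<bar>)) = (\<Prod>j\<in>UNIV - {i}. fact (nat \<bar>y i $ j\<bar>))"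
      by (intro prod.cong) (auto simp: comp)
    also have "real (nat \<bar>z $ i\<bar>) * fact (nat \<bar>y i $ i\<bar>) * (\<Prod>j\<in>UNIV - {i}. fact (nat \<bar>y i $ j\<bar>)) =
        real (nat \<bar>z $ i\<bar>) * (\<Prod>j\<in>UNIV. fact (nat \<bar>y i $ j\<bar>))"
      by (subst prod.remove[of UNIV i "\<lambda>j. fact (nat \<bar>y i $ j\<bar>)"]) auto
    finally have "?P = real (nat \<bar>z $ i\<bar>) * (\<Prod>j\<in>UNIV. fact (nat \<bar>y i $ j\<bar>))" .
    moreover have "(\<Prod>j\<in>UNIV. fact (nat \<bar>y i $ j\<bar>)) > (0 :: real)" by (intro prod_pos) auto
    ultimately show ?thesis
      unfolding geodesics_def norm_y[OF that] using k by (simp add: field_simps)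
  qed
  have inj: "inj_on y I"
  proof (rule inj_onI)
    fix i j assume "i \<in> I" "j \<in> I" "y i = y j"
    then have "axis i (sgn (z $ i)) = axis j (sgn (z $ j))" by (simp add: y_def)
    then show "i = j" using \<open>i \<in> I\<close> by (auto simp: axis_eq_axis I_def sgn_eq_0_iff)
  qed
  have sub: "y ` I \<subseteq> neighbours z"
    by (auto simp: in_neighbours_iff y_def I_def sgn_if)
  have "geodesics z = fact n * real (Suc n) / ?P"
    by (simp add: geodesics_def Suc.hyps(2)[symmetric] mult.commute)
  also have "real (Suc n) = (\<Sum>i\<in>UNIV. real (nat \<bar>z $ i\<bar>))"
    using Suc.hyps(2) by (simp only: norm1_def of_nat_sum)
  also have "\<dots> = (\<Sum>i\<in>I. real (nat \<bar>z $ i\<bar>))"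
    by (intro sum.mono_neutral_right) (auto simp: I_def)
  also have "fact n * (\<Sum>i\<in>I. real (nat \<bar>z $ i\<bar>)) / ?P = (\<Sum>i\<in>I. geodesics (y i))"
    by (simp add: geo_y sum_distrib_left sum_divide_distrib)
  also have "\<dots> \<le> (\<Sum>i\<in>I. path_weight V n (y i))"
    using Suc.hyps(1) norm_y by (intro sum_mono) metis
  also have "\<dots> = (\<Sum>x\<in>y ` I. path_weight V n x)"
    using inj by (simp add: sum.reindex)
  also have "\<dots> \<le> (\<Sum>x\<in>neighbours z. path_weight V n x)"
    using sub finite_neighbours by (intro sum_mono2) (auto intro: path_weight_nonneg V)
  also have "\<dots> \<le> path_weight V (Suc n) z"
    using V path_weight_nonneg[of V n z] by (simp add: path_weight_Suc)
  finally show ?case using Suc.hyps(2) by simp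
qed

text \<open>For \<open>k < n\<close>, \<open>x ^ k <= 2 ^ n * (x / 2) ^ k\<close>, so the head of
  the series is at most \<open>2 ^ n * exp (x / 2)\<close>; the hypothesis gives
  \<open>2 ^ (n + 1) <= exp (x / 2)\<close>.\<close>

lemma exp_tail_ge:
  fixes x :: real
  assumes "2 * (real n + 1) \<le> x"
  shows "(\<Sum>k<n. x ^ k / fact k) \<le> exp x / 2"
proof -
  have x: "x \<ge> 0" by (rule order_trans[OF _ assms]) simp
  have "(\<Sum>k<n. x ^ k / fact k) \<le> (\<Sum>k<n. 2 ^ n * ((x / 2) ^ k / fact k))"
  proof (rule sum_mono)
    fix k assume "k \<in> {..<n}"
    then have "(2::real) ^ k \<le> 2 ^ n" by (intro power_increasing) auto
    then have "2 ^ k * ((x / 2) ^ k / fact k) \<le> 2 ^ n * ((x / 2) ^ k / fact k)"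
      using x by (intro mult_right_mono) auto
    then show "x ^ k / fact k \<le> 2 ^ n * ((x / 2) ^ k / fact k)"
      by (simp add: power_divide)
  qed
  also have "\<dots> = 2 ^ n * (\<Sum>k<n. (x / 2) ^ k / fact k)" by (simp add: sum_distrib_left)
  also have "\<dots> \<le> 2 ^ n * exp (x / 2)"
  proof -
    have es: "(\<lambda>k. (x / 2) ^ k / fact k) sums exp (x / 2)"
      using exp_converges[of "x / 2"] by (simp only: scaleR_conv_of_real divide_inverse mult.commute of_real_eq_id id_apply)
    have "(\<Sum>k<n. (x / 2) ^ k / fact k) \<le> (\<Sum>k. (x / 2) ^ k / fact k)"
      using x by (intro sum_le_suminf sums_summable[OF es]) auto
    also have "\<dots> = exp (x / 2)" using sums_unique[OF es] by simp
    finally show ?thesis by (rule mult_left_mono) simp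
  qed
  also have "\<dots> \<le> exp x / 2"
  proof -
    have "(2::real) ^ Suc n \<le> exp 1 ^ Suc n"
      using exp_ge_add_one_self[of 1] by (intro power_mono) auto
    also have "\<dots> = exp (real (Suc n))" by (metis exp_of_nat_mult mult.right_neutral)
    also have "\<dots> \<le> exp (x / 2)" using assms by simp
    finally have "2 ^ Suc n * exp (x / 2) \<le> exp (x / 2) * exp (x / 2)"
      by (intro mult_right_mono) auto
    also have "\<dots> = exp x" by (simp add: exp_add[symmetric])
    finally show ?thesis by simp
  qed
  finally show ?thesis .
qed

text \<open>Only walks that follow a geodesic to \<open>z\<close> and then stay are kept. Their
  series is \<open>geodesics z / V z ^ norm1 z\<close> times a tail of the exponential series, which
  is at least half of the whole.\<close>

lemma solution_lower_bound:
  fixes V :: "int ^ 'd \<Rightarrow> real"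
  assumes V: "\<And>z. 0 \<le> V z" and Vz: "V z > 0" and t: "t \<ge> 0"
    and W: "(\<lambda>k. t ^ k / fact k * path_weight V k z) sums W"
    and n: "2 * (real (norm1 z) + 1) \<le> t * V z"
  shows "geodesics z * exp (t * V z) / (2 * V z ^ norm1 z) \<le> W"
proof -
  let ?n = "norm1 z" and ?x = "t * V z"
  have pw: "geodesics z * V z ^ j \<le> path_weight V (?n + j) z" for j
  proof (induction j)
    case 0 then show ?case using geodesics_le_path_weight[OF V] by simp
  next
    case (Suc j)
    have "geodesics z * V z ^ Suc j = V z * (geodesics z * V z ^ j)" by simp
    also have "\<dots> \<le> V z * path_weight V (?n + j) z" by (intro mult_left_mono Suc V)
    also have "\<dots> \<le> path_weight V (Suc (?n + j)) z" by (rule path_weight_Suc_ge[OF V])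
    finally show ?case by simp
  qed
  have es: "(\<lambda>k. ?x ^ k / fact k) sums exp ?x"
    using exp_converges[of ?x] by (simp add: divide_inverse mult.commute)
  have tail: "(\<lambda>j. ?x ^ (j + ?n) / fact (j + ?n)) sums (exp ?x - (\<Sum>k<?n. ?x ^ k / fact k))"
    using sums_split_initial_segment[OF es, of ?n] by simp
  have Wtail: "(\<lambda>j. t ^ (j + ?n) / fact (j + ?n) * path_weight V (j + ?n) z) sums
      (W - (\<Sum>k<?n. t ^ k / fact k * path_weight V k z))"
    using sums_split_initial_segment[OF W, of ?n] by simp
  have "geodesics z / V z ^ ?n * (exp ?x - (\<Sum>k<?n. ?x ^ k / fact k)) \<le>
      W - (\<Sum>k<?n. t ^ k / fact k * path_weight V k z)"
  proof (rule sums_le[OF _ sums_mult[OF tail] Wtail])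
    fix j
    have "geodesics z / V z ^ ?n * (?x ^ (j + ?n) / fact (j + ?n)) = t ^ (j + ?n) / fact (j + ?n) * (geodesics z * V z ^ j)"
      using Vz by (simp add: power_mult_distrib power_add)
    also have "\<dots> \<le> t ^ (j + ?n) / fact (j + ?n) * path_weight V (j + ?n) z"
      using pw[of j] t by (intro mult_left_mono) (auto simp: add.commute)
    finally show "geodesics z / V z ^ ?n * (?x ^ (j + ?n) / fact (j + ?n)) \<le>
        t ^ (j + ?n) / fact (j + ?n) * path_weight V (j + ?n) z" .
  qed
  also have "\<dots> \<le> W"
    using t by (simp add: sum_nonneg path_weight_nonneg V)
  finally have le: "geodesics z / V z ^ ?n * (exp ?x - (\<Sum>k<?n. ?x ^ k / fact k)) \<le> W" .
  have "geodesics z / V z ^ ?n * (exp ?x / 2) \<le> geodesics z / V z ^ ?n * (exp ?x - (\<Sum>k<?n. ?x ^ k / fact k))"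
    using exp_tail_ge[OF n] Vz geodesics_pos[of z] by (intro mult_left_mono) auto
  then show ?thesis using le by simp
qed

section \<open>Classification of walks by their highest site\<close>

lemma lazy_walks_norm1_le: "p \<in> lazy_walks k \<Longrightarrow> x \<in> set p \<Longrightarrow> norm1 x \<le> k"
proof (induction k arbitrary: p x)
  case (Suc k)
  then obtain q y where q: "q \<in> lazy_walks k" "y \<in> insert (hd q) (neighbours (hd q))" "p = y # q" by auto
  have h: "norm1 (hd q) \<le> k"
    using lazy_walks_nonempty[OF q(1)] by (intro Suc.IH[OF q(1)]) auto
  show ?case
  proof (cases "x \<in> set q")
    case True then show ?thesis using Suc.IH[OF q(1)] by (simp add: le_SucI)
  next
    case False
    then have "x = y" using q Suc.prems by auto
    then show ?thesis using q(2) h norm1_neighbour_le[of y "hd q"] by auto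
  qed
qed auto

text \<open>
  Compare the potential along a walk with its maximum. Either it is attained in \<open>S\<close> and all sites outside
  some \<open>T \<subseteq> S\<close> stay well below the sites of \<open>T\<close>, or some visited site \<open>w\<close> outside \<open>S\<close> comes within \<open>g\<close> of the
  maximum, or the walk leaves the ball of radius \<open>R\<close>.
\<close>

lemma walk_cover:
  fixes V :: "int ^ 'd \<Rightarrow> real"
  assumes p: "p \<in> lazy_walks k" and hd: "hd p \<notin> S" and S: "finite S" "card S \<le> 2" and g: "g > 0"
  shows "(1::real) \<le>
     (\<Sum>T\<in>Pow S. of_bool (hd p \<notin> T \<and> set p \<subseteq> T \<union> {y. y \<notin> T \<and> (\<forall>z\<in>T. V y \<le> V z - g / 2)} \<and> set p \<inter> T \<noteq> {}))
   + (\<Sum>w\<in>lball 0 R - S. of_bool (w \<in> set p \<and> set p \<subseteq> {y \<in> lball 0 R. V y \<le> V w + g}))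
   + (\<Sum>n\<in>{R<..k}. \<Sum>w\<in>{w. norm1 w = n}. of_bool (w \<in> set p \<and> set p \<subseteq> lball 0 n))"
  (is "_ \<le> sum ?A _ + sum ?B _ + sum ?C _")
proof -
  have pn: "p \<noteq> []" using p by (rule lazy_walks_nonempty)
  have A0: "0 \<le> sum ?A (Pow S)" and B0: "0 \<le> sum ?B (lball 0 R - S)" and C0: "0 \<le> sum ?C {R<..k}"
    by (intro sum_nonneg; simp)+
  show ?thesis
  proof (cases "\<exists>x\<in>set p. norm1 x > R")
    case True
    define n where "n = Max (norm1 ` set p)"
    have "n \<in> norm1 ` set p" unfolding n_def using pn by (intro Max_in) auto
    then obtain w where w: "w \<in> set p" "norm1 w = n" by auto
    have le: "norm1 x \<le> n" if "x \<in> set p" for x using that by (simp add: n_def)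
    have nk: "n \<in> {R<..k}" using True le lazy_walks_norm1_le[OF p w(1)] w by force
    have "{w :: int ^ 'd. norm1 w = n} \<subseteq> lball 0 n" by (auto simp: lball_def)
    then have fin: "finite {w :: int ^ 'd. norm1 w = n}" by (rule finite_subset) simp
    have "1 = of_bool (w \<in> set p \<and> set p \<subseteq> lball 0 n)" using w le by (auto simp: lball_def)
    also have "\<dots> \<le> ?C n" using w by (intro member_le_sum[OF _ _ fin]) auto
    also have "\<dots> \<le> sum ?C {R<..k}" using nk by (intro member_le_sum sum_nonneg) auto
    finally show ?thesis using A0 B0 by linarith
  next
    case False
    then have ball: "set p \<subseteq> lball 0 R" by (auto simp: lball_def not_less)
    define M where "M = Max (V ` set p)"
    have "M \<in> V ` set p" unfolding M_def using pn by (intro Max_in) auto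
    then obtain y where y: "y \<in> set p" "V y = M" by auto
    have le: "V x \<le> V y" if "x \<in> set p" for x using that y by (simp add: M_def)
    show ?thesis
    proof (cases "\<exists>w\<in>set p - S. V y \<le> V w + g")
      case True
      then obtain w where w: "w \<in> set p" "w \<notin> S" "V y \<le> V w + g" by auto
      have "1 = ?B w" using w ball le by force
      also have "\<dots> \<le> sum ?B (lball 0 R - S)" using w ball by (intro member_le_sum) auto
      finally show ?thesis using A0 C0 by linarith
    next
      case False
      then have yS: "y \<in> S" using y g by force
      \<comment> \<open>Sites outside \<open>S\<close> lie more than \<open>g\<close> below the
        maximum \<open>V y\<close>, hence at least \<open>g / 2\<close> below each member of
        \<open>T\<close>. If a visited site of \<open>S\<close> misses \<open>T\<close>, then
        \<open>card S <= 2\<close> forces \<open>T = {y}\<close>.\<close>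
      define T where "T = {z \<in> S \<inter> set p. V y - g / 2 \<le> V z}"
      have yT: "y \<in> T" using yS y g by (simp add: T_def)
      have below: "V x \<le> V z - g / 2" if x: "x \<in> set p" "x \<notin> T" and z: "z \<in> T" for x z
      proof (cases "x \<in> S")
        case True
        have "x \<noteq> y" using x yT by auto
        have "z = y"
        proof (rule ccontr)
          assume "z \<noteq> y"
          moreover have "x \<noteq> z" using x z by auto
          ultimately have "card {x, y, z} = 3" using \<open>x \<noteq> y\<close> by auto
          moreover have "{x, y, z} \<subseteq> S" using True yS z by (auto simp: T_def)
          ultimately show False using S card_mono[of S "{x, y, z}"] by simp
        qed
        then show ?thesis using x True by (simp add: T_def)
      next
        case False
        then have "V x + g < V y" using x \<open>\<not> (\<exists>w\<in>set p - S. V y \<le> V w + g)\<close> by force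
        then show ?thesis using z by (simp add: T_def)
      qed
      have "1 = ?A T" using hd yT y below by (auto simp: T_def)
      also have "\<dots> \<le> sum ?A (Pow S)" using S by (intro member_le_sum) (auto simp: T_def)
      finally show ?thesis using B0 C0 by linarith
    qed
  qed
qed

text \<open>
  The logarithm of the contribution to the solution of the walks that go straight to \<open>z\<close> and stay there; in
  the notation of the paper this is \<open>t * \<Psi>\<^sub>t(z)\<close>. The cutoff \<open>b\<close> is needed because the formula is
  spuriously large at remote sites with potential near \<open>1\<close>.
\<close>

definition peak_value :: "(int ^ 'd \<Rightarrow> real) \<Rightarrow> real \<Rightarrow> real \<Rightarrow> int ^ 'd \<Rightarrow> real" where
  "peak_value V b t z = t * V z + ln (geodesics z) - norm1 z * ln (max (V z) b)"

lemma exp_peak_value: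
  assumes "b > 0"
  shows "exp (peak_value V b t z) = exp (t * V z) * geodesics z / max (V z) b ^ norm1 z"
proof -
  have "exp (norm1 z * ln (max (V z) b)) = max (V z) b ^ norm1 z"
    using assms by (simp add: exp_of_nat_mult)
  then show ?thesis using geodesics_pos[of z] by (simp add: peak_value_def exp_add exp_diff)
qed

text \<open>All factors, except \<open>exp (2 * g * t)\<close>, by which the upper bound exceeds
  \<open>exp (peak_value V b t w)\<close>: resolvent prefactors, visits to high sites, slack of the
  tilt and Stirling polynomials. They are evaluated at the largest distance \<open>R\<close> and
  potential \<open>v\<close>, so that one value serves every \<open>w\<close>.\<close>

definition path_error :: "nat \<Rightarrow> real \<Rightarrow> nat \<Rightarrow> nat \<Rightarrow> nat \<Rightarrow> real \<Rightarrow> real \<Rightarrow> real" where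
  "path_error d g m L R \<epsilon> v =
     4 * (v + 2 * g)\<^sup>2 / (\<epsilon> * g\<^sup>2) * exp (ln ((v + 2 * g) / g) * (2 * real m + real m * real R / real L))
       * (1 / (1 - \<epsilon>)) ^ R * (exp 1 * (real R + 1)) ^ d"

lemma near_visiting_mass_le:
  fixes V :: "int ^ 'd \<Rightarrow> real"
  assumes V: "\<And>z. 0 \<le> V z" and Vm: "\<And>z. z \<in> lball 0 R \<Longrightarrow> V z \<le> v"
    and sparse: "\<And>x. x \<in> lball 0 R \<Longrightarrow> card (lball x L \<inter> {y. \<psi> < V y}) \<le> m"
    and L: "L \<ge> 1" and g: "2 * deg TYPE('d) \<le> g" and \<psi>: "0 \<le> \<psi>" "\<psi> \<le> g" and b: "0 < b" "b \<le> g"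
    and \<epsilon>: "0 < \<epsilon>" "\<epsilon> < 1" and t: "t \<ge> 0"
    and cond: "2 * deg TYPE('d) \<le> \<epsilon> * (g * exp (- (ln ((v + 2 * g) / g) * m / L)))"
    and w: "w \<in> lball 0 R"
  shows "(\<Sum>j\<le>k. t ^ j / fact j *
      walk_sum V j (\<lambda>p. of_bool (w \<in> set p \<and> set p \<subseteq> {y \<in> lball 0 R. V y \<le> V w + g})))
    \<le> path_error CARD('d) g m L R \<epsilon> v * exp (2 * g * t) * exp (peak_value V b t w)"
proof -
  let ?D = "{y \<in> lball 0 R. V y \<le> V w + g}" and ?d = "deg TYPE('d)"
  \<comment> \<open>One \<open>g\<close> covers the sites of \<open>?D\<close> above
    \<open>V w\<close>, the other keeps the energy away from the spectrum. The cost is the factor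
    \<open>exp (2 * g * t)\<close>.\<close>
  define s where "s = V w + 2 * g"
  define K where "K = ln ((v + 2 * g) / g)"
  have d: "?d \<ge> 2" by (rule deg_ge_2)
  have g0: "g > 0" using g d by linarith
  have vw: "V w \<le> v" by (rule Vm[OF w])
  have v0: "v \<ge> 0" using vw V[of w] by linarith
  have q: "g \<le> s - \<psi>" "max (V w) b \<le> s - \<psi>" "s - \<psi> \<le> v + 2 * g" "s \<le> v + 2 * g"
    using V[of w] \<psi> b vw by (auto simp: s_def)
  have q0: "s - \<psi> > 0" using q g0 by linarith
  have K': "ln ((s - \<psi>) / g) \<le> K" unfolding K_def using q g0 q0
    by (intro ln_mono divide_right_mono) auto
  have K'0: "0 \<le> ln ((s - \<psi>) / g)" using q g0 by (intro ln_ge_zero) simp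
  have nw: "norm1 w \<le> R" using w by (simp add: lball_def)
  have G: "(\<Sum>n\<le>k. skeleton_green V ?D s n w) \<le>
    2 / (\<epsilon> * (s - \<psi>)) * exp (ln ((s - \<psi>) / g) * (2 * real m + real m * real (norm1 w) / real L)) * (1 / (1 - \<epsilon>)) ^ norm1 w
      * (exp 1 * (real (norm1 w) + 1)) ^ CARD('d) * (geodesics w / (s - \<psi>) ^ norm1 w)"
  proof (rule skeleton_green_near_le[OF _ sparse L g0 _ q(1) \<epsilon> refl])
    have "exp (- (K * m / L)) \<le> exp (- (ln ((s - \<psi>) / g) * m / L))"
      using K' by (auto intro!: divide_right_mono mult_right_mono)
    then have "\<epsilon> * (g * exp (- (K * m / L))) \<le> \<epsilon> * (g * exp (- (ln ((s - \<psi>) / g) * m / L)))"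
      using \<epsilon> g0 by (intro mult_left_mono) auto
    then show "2 * ?d \<le> \<epsilon> * (g * exp (- (ln ((s - \<psi>) / g) * m / L)))"
      using cond unfolding K_def by linarith
  qed (auto simp: s_def)
  also have "\<dots> \<le> 2 / (\<epsilon> * g) * exp (K * (2 * real m + real m * real R / real L)) * (1 / (1 - \<epsilon>)) ^ R
      * (exp 1 * (real R + 1)) ^ CARD('d) * (geodesics w / max (V w) b ^ norm1 w)"
  proof (intro mult_mono)
    show "2 / (\<epsilon> * (s - \<psi>)) \<le> 2 / (\<epsilon> * g)"
      using q \<epsilon> g0 by (intro divide_left_mono mult_left_mono mult_pos_pos) auto
    have "ln ((s - \<psi>) / g) * (2 * real m + real m * real (norm1 w) / real L) \<le> K * (2 * real m + real m * real R / real L)"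
      using K' K'0 nw by (intro mult_mono add_left_mono divide_right_mono mult_left_mono) auto
    then show "exp (ln ((s - \<psi>) / g) * (2 * real m + real m * real (norm1 w) / real L)) \<le> exp (K * (2 * real m + real m * real R / real L))" by simp
    show "(1 / (1 - \<epsilon>)) ^ norm1 w \<le> (1 / (1 - \<epsilon>)) ^ R"
      using \<epsilon> nw by (intro power_increasing) auto
    show "(exp 1 * (real (norm1 w) + 1)) ^ CARD('d) \<le> (exp 1 * (real R + 1)) ^ CARD('d)"
      using nw by (intro power_mono mult_left_mono) auto
    show "geodesics w / (s - \<psi>) ^ norm1 w \<le> geodesics w / max (V w) b ^ norm1 w"
      using q q0 b geodesics_pos[of w] by (intro divide_left_mono power_mono mult_pos_pos zero_less_power) auto
    show "0 \<le> geodesics w / (s - \<psi>) ^ norm1 w"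
      using q0 geodesics_pos[of w] by (simp add: less_imp_le)
  qed (use \<epsilon> g0 q0 in \<open>auto intro!: mult_nonneg_nonneg\<close>)
  finally have G': "(\<Sum>n\<le>k. skeleton_green V ?D s n w) \<le>
    2 / (\<epsilon> * g) * exp (K * (2 * real m + real m * real R / real L)) * (1 / (1 - \<epsilon>)) ^ R
      * (exp 1 * (real R + 1)) ^ CARD('d) * (geodesics w / max (V w) b ^ norm1 w)" (is "_ \<le> ?G") .
  have G0: "0 \<le> ?G" using \<epsilon> g0 b geodesics_pos[of w] by (auto intro!: mult_nonneg_nonneg divide_nonneg_nonneg)
  have "(\<Sum>j\<le>k. t ^ j / fact j * walk_sum V j (\<lambda>p. of_bool (w \<in> set p \<and> set p \<subseteq> ?D)))
     \<le> exp (t * s) * (s\<^sup>2 / (s - (V w + g) - ?d) * (\<Sum>n\<le>k. skeleton_green V ?D s n w))"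
    by (rule visiting_mass_le) (use V V[of w] g d t in \<open>auto simp: s_def\<close>)
  also have "\<dots> \<le> exp (t * s) * ((v + 2 * g)\<^sup>2 / (g / 2) * ?G)"
  proof (intro mult_left_mono mult_mono G')
    have "s \<ge> 0" using V[of w] g0 by (simp add: s_def)
    then show "s\<^sup>2 / (s - (V w + g) - ?d) \<le> (v + 2 * g)\<^sup>2 / (g / 2)"
      using q g g0 d by (intro frac_le power_mono) (auto simp: s_def)
    show "0 \<le> (\<Sum>n\<le>k. skeleton_green V ?D s n w)"
      by (intro sum_nonneg skeleton_green_nonneg) (use g0 in \<open>auto simp: s_def\<close>)
  qed (use g0 in auto)
  also have "\<dots> = path_error CARD('d) g m L R \<epsilon> v * exp (2 * g * t) * (exp (t * V w) * geodesics w / max (V w) b ^ norm1 w)"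
  proof -
    have "exp (t * s) = exp (t * V w) * exp (2 * g * t)"
      by (simp add: s_def exp_add[symmetric] algebra_simps)
    moreover have "(x0 * y) * ((v + 2 * g)\<^sup>2 / (g / 2) * (2 / (\<epsilon> * g) * x1 * x2 * x3 * r)) =
        (4 * (v + 2 * g)\<^sup>2 / (\<epsilon> * g\<^sup>2) * x1 * x2 * x3) * y * (x0 * r)" for x0 y x1 x2 x3 r
      using g0 \<epsilon> by (simp add: power2_eq_square mult_ac)
    ultimately show ?thesis
      unfolding path_error_def K_def[symmetric] by (simp only: times_divide_eq_right[symmetric])
  qed
  finally show ?thesis using exp_peak_value[OF b(1), of V t w] by simp
qed

text \<open>At energy \<open>3 * M\<close> the exponential is at most \<open>exp 1 ^ n\<close>,
  against \<open>(1/12) ^ n\<close> from the jumps. Since \<open>exp 1 / 12 <= 1/4\<close>, half of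
  the decay rate is left to beat the number of sites.\<close>

lemma far_visiting_mass_le:
  fixes V :: "int ^ 'd \<Rightarrow> real"
  assumes V: "\<And>z. 0 \<le> V z" and M: "\<And>z. z \<in> lball 0 n \<Longrightarrow> V z \<le> M" "6 * deg TYPE('d) \<le> M" "3 * t * M \<le> n"
    and t: "t \<ge> 0" and n: "9 * (2 * real n + 1) ^ CARD('d) \<le> 2 ^ n"
  shows "(\<Sum>w\<in>{w. norm1 w = n}. \<Sum>j\<le>k. t ^ j / fact j *
      walk_sum V j (\<lambda>p. of_bool (w \<in> set p \<and> set p \<subseteq> lball 0 n))) \<le> (1/2) ^ n"
proof -
  let ?d = "deg TYPE('d)"
  have d: "?d \<ge> 2" by (rule deg_ge_2)
  have M0: "M > 0" using M(2) d by linarith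
  have each: "(\<Sum>j\<le>k. t ^ j / fact j * walk_sum V j (\<lambda>p. of_bool (w \<in> set p \<and> set p \<subseteq> lball 0 n))) \<le> 9 * (1/4) ^ n"
    if w: "norm1 w = n" for w :: "int ^ 'd"
  proof -
    have "(\<Sum>j\<le>k. t ^ j / fact j * walk_sum V j (\<lambda>p. of_bool (w \<in> set p \<and> set p \<subseteq> lball 0 n)))
       \<le> exp (t * (3 * M)) * ((3 * M)\<^sup>2 / (3 * M - M - ?d) * (\<Sum>n'\<le>k. skeleton_green V (lball 0 n) (3 * M) n' w))"
      by (rule visiting_mass_le) (use V M M0 d t in auto)
    also have "\<dots> \<le> exp (t * (3 * M)) * ((3 * M)\<^sup>2 / (3 * M - M - ?d) * (2 / (3 * M - M) * (?d / (3 * M - M)) ^ n))"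
      using skeleton_green_far_le[where D = "lball 0 n" and V = V and m = M and s = "3 * M" and k = k and y = w] M d w
      by (intro mult_left_mono) auto
    also have "\<dots> \<le> exp 1 ^ n * ((3 * M)\<^sup>2 / M * (1 / M * (1/12) ^ n))"
    proof (intro mult_mono)
      have "t * (3 * M) \<le> n" using M(3) by (simp add: mult_ac)
      then have "exp (t * (3 * M)) \<le> exp (real n)" by simp
      then show "exp (t * (3 * M)) \<le> exp 1 ^ n" by (metis exp_of_nat_mult mult.right_neutral)
      show "(3 * M)\<^sup>2 / (3 * M - M - ?d) \<le> (3 * M)\<^sup>2 / M"
        using M d M0 by (intro divide_left_mono mult_pos_pos) auto
      show "(?d / (3 * M - M)) ^ n \<le> (1/12) ^ n"
        using M d M0 by (intro power_mono) (auto simp: field_simps)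
    qed (use M M0 d in auto)
    also have "\<dots> = 9 * (exp 1 / 12) ^ n"
      using M0 by (simp add: power2_eq_square power_mult_distrib power_divide field_simps)
    also have "\<dots> \<le> 9 * (1/4) ^ n"
      using exp_le by (intro mult_left_mono power_mono) auto
    finally show ?thesis .
  qed
  have sub: "{w :: int ^ 'd. norm1 w = n} \<subseteq> lball 0 n" by (auto simp: lball_def)
  have "(\<Sum>w\<in>{w. norm1 w = n}. \<Sum>j\<le>k. t ^ j / fact j *
      walk_sum V j (\<lambda>p. of_bool (w \<in> set p \<and> set p \<subseteq> lball 0 n))) \<le> (\<Sum>w\<in>{w :: int ^ 'd. norm1 w = n}. 9 * (1/4) ^ n)"
    by (intro sum_mono each) simp
  also have "\<dots> = real (card {w :: int ^ 'd. norm1 w = n}) * (9 * (1/4) ^ n)" by simp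
  also have "\<dots> \<le> (2 * real n + 1) ^ CARD('d) * (9 * (1/4) ^ n)"
  proof (intro mult_right_mono)
    have "real (card {w :: int ^ 'd. norm1 w = n}) \<le> real (card (lball (0 :: int ^ 'd) n))"
      by (intro of_nat_mono card_mono sub) simp
    also have "\<dots> \<le> (2 * real n + 1) ^ CARD('d)" by (rule real_card_lball_le)
    finally show "real (card {w :: int ^ 'd. norm1 w = n}) \<le> (2 * real n + 1) ^ CARD('d)" .
  qed auto
  also have "\<dots> = (9 * (2 * real n + 1) ^ CARD('d)) * (1/4) ^ n" by simp
  also have "\<dots> \<le> 2 ^ n * (1/4) ^ n" by (intro mult_right_mono n) auto
  also have "\<dots> = (1/2) ^ n" by (simp add: power_mult_distrib[symmetric])
  finally show ?thesis .
qed

lemma sum_geometric_tail_le: "(\<Sum>n\<in>{R<..k}. (1/2 :: real) ^ n) \<le> 1"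
proof -
  have "(\<Sum>n\<in>{R<..k}. (1/2 :: real) ^ n) \<le> (\<Sum>n\<in>{0<..k}. (1/2) ^ n)"
    by (intro sum_mono2) auto
  also have "\<dots> = 1 - (1/2) ^ k"
  proof (induction k)
    case (Suc k)
    have "{0<..Suc k} = insert (Suc k) {0<..k}" by auto
    then show ?case using Suc by simp
  qed simp
  also have "\<dots> \<le> 1" by simp
  finally show ?thesis .
qed

text \<open>The three error terms belong to the three classes in \<open>walk_cover\<close>. The
  factor \<open>16\<close> is at most four subsets \<open>T\<close> times
  \<open>4 * deg / g\<close>. Far walks have total mass at most \<open>1\<close>, which is compared
  with \<open>S\<close> through
  \<open>exp (peak_value V b t z1) <= 2 * (\<Sum>z\<in>S. W z)\<close>. Finite sets \<open>F\<close>
  are used because summability of \<open>W\<close> is not yet known.\<close>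

lemma mass_concentration:
  fixes V :: "int ^ 'd \<Rightarrow> real"
  assumes V: "\<And>z. 0 \<le> V z" and Vm: "\<And>z. z \<in> lball 0 R \<Longrightarrow> V z \<le> v"
    and sparse: "\<And>x. x \<in> lball 0 R \<Longrightarrow> card (lball x L \<inter> {y. \<psi> < V y}) \<le> m"
    and L: "L \<ge> 1" and g: "4 * deg TYPE('d) \<le> g" and \<psi>: "0 \<le> \<psi>" "\<psi> \<le> g" and b: "0 < b" "b \<le> g"
    and \<epsilon>: "0 < \<epsilon>" "\<epsilon> < 1" and t: "t \<ge> 0"
    and cond: "2 * deg TYPE('d) \<le> \<epsilon> * (g * exp (- (ln ((v + 2 * g) / g) * m / L)))"
    and far: "\<And>n. n > R \<Longrightarrow> \<exists>M\<ge>6 * deg TYPE('d). (\<forall>z\<in>lball 0 n. V z \<le> M) \<and> 3 * t * M \<le> n"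
    and large: "\<And>n. n > R \<Longrightarrow> 9 * (2 * real n + 1) ^ CARD('d) \<le> 2 ^ n"
    and W: "\<And>z. (\<lambda>k. t ^ k / fact k * path_weight V k z) sums W z"
    and S: "finite S" "card S \<le> 2" "z1 \<in> S"
    and gap: "\<And>w. w \<in> lball 0 R \<Longrightarrow> w \<notin> S \<Longrightarrow> peak_value V b t w + \<Gamma> \<le> peak_value V b t z1"
    and z1: "b \<le> V z1" "2 * (real (norm1 z1) + 1) \<le> t * V z1"
    and F: "finite F" "F \<inter> S = {}"
  shows "(\<Sum>y\<in>F. W y) \<le> (16 * deg TYPE('d) / g
      + 2 * (2 * real R + 1) ^ CARD('d) * path_error CARD('d) g m L R \<epsilon> v * exp (2 * g * t - \<Gamma>)
      + 2 * exp (- peak_value V b t z1)) * (\<Sum>z\<in>S. W z)"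
proof -
  let ?d = "deg TYPE('d)"
  define E where "E = path_error CARD('d) g m L R \<epsilon> v * exp (2 * g * t)"
  define P1 where "P1 = peak_value V b t z1"
  define A where "A T p = (of_bool (hd p \<notin> T \<and> set p \<subseteq> T \<union> {y. y \<notin> T \<and> (\<forall>z\<in>T. V y \<le> V z - g / 2)} \<and> set p \<inter> T \<noteq> {}) :: real)" for T p
  define B where "B w p = (of_bool (w \<in> set p \<and> set p \<subseteq> {y \<in> lball 0 R. V y \<le> V w + g}) :: real)" for w p
  define C where "C n w p = (of_bool (w \<in> set p \<and> set p \<subseteq> lball (0 :: int ^ 'd) n) :: real)" for n w p
  have d: "?d \<ge> 2" by (rule deg_ge_2)
  have g0: "g > 0" using g d by linarith
  have pw0: "0 \<le> path_weight V j z" for j z by (rule path_weight_nonneg[OF V])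
  have W0: "0 \<le> W z" for z
    using sums_le[OF _ sums_zero W[of z]] t pw0 by auto
  have v0: "0 \<le> v" using Vm[of 0] V[of 0] by (simp add: lball_def)
  have E0: "E \<ge> 0" unfolding E_def path_error_def using \<epsilon> v0 g0
    by (intro mult_nonneg_nonneg divide_nonneg_nonneg) auto
  have partial_le: "(\<Sum>j\<le>k. t ^ j / fact j * path_weight V j z) \<le> W z" for k z
    using sum_le_suminf[OF sums_summable[OF W[of z]], of "{..k}"] sums_unique[OF W[of z]] t pw0 by auto
  have W1: "exp P1 \<le> 2 * (\<Sum>z\<in>S. W z)"
  proof -
    have "geodesics z1 * exp (t * V z1) / (2 * V z1 ^ norm1 z1) \<le> W z1"
      using z1 b by (intro solution_lower_bound[OF V _ t W]) auto
    moreover have "exp P1 = exp (t * V z1) * geodesics z1 / V z1 ^ norm1 z1"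
      unfolding P1_def exp_peak_value[OF b(1)] using z1 by (simp add: max_def)
    ultimately have "exp P1 \<le> 2 * W z1" by (simp add: mult.commute)
    also have "W z1 \<le> (\<Sum>z\<in>S. W z)" using S W0 by (intro member_le_sum) auto
    finally show ?thesis by simp
  qed
  have A_le: "(\<Sum>j\<le>k. t ^ j / fact j * walk_sum V j (A T)) \<le> 4 * ?d / g * (\<Sum>z\<in>S. W z)"
    if T: "T \<in> Pow S" for T k
  \<comment> \<open>In the degenerate cases no walk is counted. Otherwise some site lies below the
    threshold \<open>\<mu>\<close>, which is therefore nonnegative, as
    \<open>mass_near_peaks_le\<close> requires.\<close>
  proof (cases "T = {} \<or> {y. y \<notin> T \<and> (\<forall>z\<in>T. V y \<le> V z - g / 2)} = {}")
    case True
    have "walk_sum V j (A T) = 0" for j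
    proof -
      have "walk_sum V j (A T) = walk_sum V j (\<lambda>p. 0)"
      proof (rule walk_sum_cong)
        fix p :: "(int ^ 'd) list" assume "p \<in> lazy_walks j"
        then have "hd p \<in> set p" using lazy_walks_nonempty[of p j] by simp
        then show "A T p = 0" using True by (auto simp: A_def)
      qed
      then show ?thesis by (simp add: walk_sum_def)
    qed
    moreover have "0 \<le> 4 * ?d / g * (\<Sum>z\<in>S. W z)"
      using g0 d by (intro mult_nonneg_nonneg sum_nonneg W0) auto
    ultimately show ?thesis by simp
  next
    case False
    have fT: "finite T" using T S finite_subset by auto
    define \<mu> where "\<mu> = Min (V ` T) - g / 2"
    have \<mu>: "(\<forall>z\<in>T. V y \<le> V z - g / 2) \<longleftrightarrow> V y \<le> \<mu>" for y
    proof -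
      have "V y \<le> \<mu> \<longleftrightarrow> V y + g / 2 \<le> Min (V ` T)" by (auto simp: \<mu>_def)
      also have "\<dots> \<longleftrightarrow> (\<forall>z\<in>T. V y + g / 2 \<le> V z)" using fT False by (subst Min_ge_iff) auto
      finally show ?thesis by (auto simp: le_diff_eq)
    qed
    then obtain y where "V y \<le> \<mu>" using False by blast
    then have \<mu>0: "\<mu> \<ge> 0" using V[of y] by linarith
    have each: "walk_sum V j (A T) \<le> 4 * ?d / g * (\<Sum>z\<in>T. path_weight V j z)" for j
    proof -
      have "walk_sum V j (A T) \<le> ?d / (g / 2 - ?d) * (\<Sum>z\<in>T. path_weight V j z)"
        unfolding A_def \<mu>
      proof (rule mass_near_peaks_le[OF V fT])
        fix z assume "z \<in> T"
        then have "Min (V ` T) \<le> V z" using fT by (intro Min_le) auto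
        then show "\<mu> + g / 2 \<le> V z" by (simp add: \<mu>_def)
      qed (use g d \<mu>0 in auto)
      also have "\<dots> \<le> 4 * ?d / g * (\<Sum>z\<in>T. path_weight V j z)"
      proof (intro mult_right_mono sum_nonneg pw0)
        have "?d / (g / 2 - ?d) \<le> ?d / (g / 4)" using g g0 d by (intro divide_left_mono) auto
        then show "?d / (g / 2 - ?d) \<le> 4 * ?d / g" by (simp add: mult.commute)
      qed
      finally show ?thesis .
    qed
    have "(\<Sum>j\<le>k. t ^ j / fact j * walk_sum V j (A T)) \<le>
        (\<Sum>j\<le>k. t ^ j / fact j * (4 * ?d / g * (\<Sum>z\<in>T. path_weight V j z)))"
      using t by (intro sum_mono mult_left_mono each) auto
    also have "\<dots> = 4 * ?d / g * (\<Sum>j\<le>k. \<Sum>z\<in>T. t ^ j / fact j * path_weight V j z)"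
      unfolding sum_distrib_left by (simp only: mult.left_commute)
    also have "\<dots> \<le> 4 * ?d / g * (\<Sum>z\<in>S. W z)"
    proof (rule mult_left_mono)
      have "(\<Sum>j\<le>k. \<Sum>z\<in>T. t ^ j / fact j * path_weight V j z) = (\<Sum>z\<in>T. \<Sum>j\<le>k. t ^ j / fact j * path_weight V j z)"
        by (rule sum.swap)
      also have "\<dots> \<le> (\<Sum>z\<in>T. W z)" by (intro sum_mono partial_le)
      also have "\<dots> \<le> (\<Sum>z\<in>S. W z)" using T S W0 by (intro sum_mono2) auto
      finally show "(\<Sum>j\<le>k. \<Sum>z\<in>T. t ^ j / fact j * path_weight V j z) \<le> (\<Sum>z\<in>S. W z)" .
    qed (use g0 d in auto)
    finally show ?thesis .
  qed
  have B_le: "(\<Sum>w\<in>lball 0 R - S. \<Sum>j\<le>k. t ^ j / fact j * walk_sum V j (B w)) \<le>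
      (2 * real R + 1) ^ CARD('d) * (E * exp (P1 - \<Gamma>))" for k
  proof -
    have "(\<Sum>w\<in>lball 0 R - S. \<Sum>j\<le>k. t ^ j / fact j * walk_sum V j (B w)) \<le>
        (\<Sum>w\<in>lball (0 :: int ^ 'd) R - S. E * exp (P1 - \<Gamma>))"
    proof (rule sum_mono)
      fix w assume w: "w \<in> lball 0 R - S"
      have "(\<Sum>j\<le>k. t ^ j / fact j * walk_sum V j (B w)) \<le> E * exp (peak_value V b t w)"
        unfolding B_def E_def
        by (rule near_visiting_mass_le[OF V Vm sparse L _ \<psi> b \<epsilon> t cond]) (use g d w in auto)
      also have "\<dots> \<le> E * exp (P1 - \<Gamma>)"
        using gap[of w] w E0 by (intro mult_left_mono) (auto simp: P1_def)
      finally show "(\<Sum>j\<le>k. t ^ j / fact j * walk_sum V j (B w)) \<le> E * exp (P1 - \<Gamma>)" .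
    qed
    also have "\<dots> = real (card (lball (0 :: int ^ 'd) R - S)) * (E * exp (P1 - \<Gamma>))" by simp
    also have "\<dots> \<le> (2 * real R + 1) ^ CARD('d) * (E * exp (P1 - \<Gamma>))"
    proof (intro mult_right_mono)
      have "real (card (lball (0 :: int ^ 'd) R - S)) \<le> real (card (lball (0 :: int ^ 'd) R))"
        by (intro of_nat_mono card_mono) auto
      also have "\<dots> \<le> (2 * real R + 1) ^ CARD('d)" by (rule real_card_lball_le)
      finally show "real (card (lball (0 :: int ^ 'd) R - S)) \<le> (2 * real R + 1) ^ CARD('d)" .
    qed (use E0 in auto)
    finally show ?thesis .
  qed
  have C_le: "(\<Sum>n\<in>{R<..k}. \<Sum>w\<in>{w. norm1 w = n}. \<Sum>j\<le>k. t ^ j / fact j * walk_sum V j (C n w)) \<le> 1" for k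
  proof -
    have "(\<Sum>n\<in>{R<..k}. \<Sum>w\<in>{w. norm1 w = n}. \<Sum>j\<le>k. t ^ j / fact j * walk_sum V j (C n w)) \<le> (\<Sum>n\<in>{R<..k}. (1/2) ^ n)"
    proof (rule sum_mono)
      fix n assume n: "n \<in> {R<..k}"
      then obtain M where "6 * ?d \<le> M" "\<forall>z\<in>lball 0 n. V z \<le> M" "3 * t * M \<le> n" using far[of n] by auto
      then show "(\<Sum>w\<in>{w. norm1 w = n}. \<Sum>j\<le>k. t ^ j / fact j * walk_sum V j (C n w)) \<le> (1/2) ^ n"
        unfolding C_def using n large[of n] by (intro far_visiting_mass_le[OF V _ _ _ t]) auto
    qed
    then show ?thesis using sum_geometric_tail_le[of R k] by linarith
  qed
  define \<Delta> where "\<Delta> = 16 * ?d / g + 2 * (2 * real R + 1) ^ CARD('d) * path_error CARD('d) g m L R \<epsilon> v * exp (2 * g * t - \<Gamma>)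
      + 2 * exp (- P1)"
  have step: "(\<Sum>y\<in>F. path_weight V j y) \<le> (\<Sum>T\<in>Pow S. walk_sum V j (A T)) + (\<Sum>w\<in>lball 0 R - S. walk_sum V j (B w))
      + (\<Sum>n\<in>{R<..k}. \<Sum>w\<in>{w. norm1 w = n}. walk_sum V j (C n w))" if "j \<le> k" for j k
  proof -
    have C_nonneg: "0 \<le> C n w p" for n w p by (simp add: C_def)
    have "(\<Sum>y\<in>F. path_weight V j y) = walk_sum V j (\<lambda>p. \<Sum>y\<in>F. of_bool (hd p = y))"
      by (simp only: path_weight_eq_walk_sum walk_sum_sum)
    also have "\<dots> \<le> walk_sum V j (\<lambda>p. (\<Sum>T\<in>Pow S. A T p) + (\<Sum>w\<in>lball 0 R - S. B w p) + (\<Sum>n\<in>{R<..k}. \<Sum>w\<in>{w. norm1 w = n}. C n w p))"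
    proof (rule walk_sum_mono[OF V])
      fix p :: "(int ^ 'd) list" assume p: "p \<in> lazy_walks j"
      show "(\<Sum>y\<in>F. of_bool (hd p = y)) \<le> (\<Sum>T\<in>Pow S. A T p) + (\<Sum>w\<in>lball 0 R - S. B w p) + (\<Sum>n\<in>{R<..k}. \<Sum>w\<in>{w. norm1 w = n}. C n w p)"
      proof (cases "hd p \<in> F")
        case True
        then have "(\<Sum>y\<in>F. of_bool (hd p = y)) = (1 :: real)" using F by (simp add: of_bool_def)
        also have "\<dots> \<le> (\<Sum>T\<in>Pow S. A T p) + (\<Sum>w\<in>lball 0 R - S. B w p) + (\<Sum>n\<in>{R<..j}. \<Sum>w\<in>{w. norm1 w = n}. C n w p)"
          unfolding A_def B_def C_def using True F by (intro walk_cover[OF p _ S(1,2) g0]) auto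
        also have "(\<Sum>n\<in>{R<..j}. \<Sum>w\<in>{w. norm1 w = n}. C n w p) \<le> (\<Sum>n\<in>{R<..k}. \<Sum>w\<in>{w. norm1 w = n}. C n w p)"
          using that C_nonneg by (intro sum_mono2) (auto intro!: sum_nonneg)
        finally show ?thesis by simp
      next
        case False
        then have "(\<Sum>y\<in>F. of_bool (hd p = y)) = (0 :: real)" by (intro sum.neutral) auto
        also have "0 \<le> (\<Sum>T\<in>Pow S. A T p) + (\<Sum>w\<in>lball 0 R - S. B w p) + (\<Sum>n\<in>{R<..k}. \<Sum>w\<in>{w. norm1 w = n}. C n w p)"
          by (intro add_nonneg_nonneg sum_nonneg) (auto simp: A_def B_def C_def)
        finally show ?thesis .
      qed
    qed
    also have "\<dots> = (\<Sum>T\<in>Pow S. walk_sum V j (A T)) + (\<Sum>w\<in>lball 0 R - S. walk_sum V j (B w))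
      + (\<Sum>n\<in>{R<..k}. \<Sum>w\<in>{w. norm1 w = n}. walk_sum V j (C n w))"
      by (simp only: walk_sum_add walk_sum_sum)
    finally show ?thesis .
  qed
  have partial: "(\<Sum>j\<le>k. t ^ j / fact j * (\<Sum>y\<in>F. path_weight V j y)) \<le> \<Delta> * (\<Sum>z\<in>S. W z)" for k
  proof -
    have "(\<Sum>j\<le>k. t ^ j / fact j * (\<Sum>y\<in>F. path_weight V j y)) \<le>
      (\<Sum>j\<le>k. t ^ j / fact j * ((\<Sum>T\<in>Pow S. walk_sum V j (A T)) + (\<Sum>w\<in>lball 0 R - S. walk_sum V j (B w))
      + (\<Sum>n\<in>{R<..k}. \<Sum>w\<in>{w. norm1 w = n}. walk_sum V j (C n w))))"
      using t by (intro sum_mono mult_left_mono step) auto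
    also have "\<dots> = (\<Sum>T\<in>Pow S. \<Sum>j\<le>k. t ^ j / fact j * walk_sum V j (A T)) + (\<Sum>w\<in>lball 0 R - S. \<Sum>j\<le>k. t ^ j / fact j * walk_sum V j (B w))
      + (\<Sum>n\<in>{R<..k}. \<Sum>w\<in>{w. norm1 w = n}. \<Sum>j\<le>k. t ^ j / fact j * walk_sum V j (C n w))"
    proof -
      have 1: "(\<Sum>j\<le>k. t ^ j / fact j * (\<Sum>i\<in>I. f j i)) = (\<Sum>i\<in>I. \<Sum>j\<le>k. t ^ j / fact j * f j i)"
        for I :: "'z set" and f :: "nat \<Rightarrow> 'z \<Rightarrow> real"
        unfolding sum_distrib_left by (rule sum.swap)
      show ?thesis unfolding distrib_left sum.distrib
        by (intro arg_cong2[where f = "(+)"]) (simp_all only: sum_distrib_left, (rule sum.swap)+, simp only: sum.swap[of _ "{..k}"])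
    qed
    also have "\<dots> \<le> (\<Sum>T\<in>Pow S. 4 * ?d / g * (\<Sum>z\<in>S. W z)) + (2 * real R + 1) ^ CARD('d) * (E * exp (P1 - \<Gamma>)) + 1"
      by (intro add_mono sum_mono A_le B_le C_le)
    also have "\<dots> \<le> \<Delta> * (\<Sum>z\<in>S. W z)"
    proof -
      have SW0: "0 \<le> (\<Sum>z\<in>S. W z)" by (intro sum_nonneg W0)
      have "real (card (Pow S)) \<le> 4"
        using S power_increasing[of "card S" 2 "2::real"] by (simp add: card_Pow)
      then have "(\<Sum>T\<in>Pow S. 4 * ?d / g * (\<Sum>z\<in>S. W z)) \<le> 4 * (4 * ?d / g * (\<Sum>z\<in>S. W z))"
        using SW0 g0 d by (simp only: sum_constant) (intro mult_right_mono, auto)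
      then have 1: "(\<Sum>T\<in>Pow S. 4 * ?d / g * (\<Sum>z\<in>S. W z)) \<le> 16 * ?d / g * (\<Sum>z\<in>S. W z)"
        by simp
      have "(2 * real R + 1) ^ CARD('d) * (E * exp (P1 - \<Gamma>)) = (2 * real R + 1) ^ CARD('d) * (E * exp (- \<Gamma>)) * exp P1"
        by (simp add: exp_diff exp_minus field_simps)
      also have "\<dots> \<le> (2 * real R + 1) ^ CARD('d) * (E * exp (- \<Gamma>)) * (2 * (\<Sum>z\<in>S. W z))"
        using E0 by (intro mult_left_mono W1) auto
      also have "\<dots> = 2 * (2 * real R + 1) ^ CARD('d) * path_error CARD('d) g m L R \<epsilon> v * exp (2 * g * t - \<Gamma>) * (\<Sum>z\<in>S. W z)"
        by (simp add: E_def exp_diff exp_minus field_simps)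
      finally have 2: "(2 * real R + 1) ^ CARD('d) * (E * exp (P1 - \<Gamma>)) \<le>
          2 * (2 * real R + 1) ^ CARD('d) * path_error CARD('d) g m L R \<epsilon> v * exp (2 * g * t - \<Gamma>) * (\<Sum>z\<in>S. W z)" .
      have "exp (- P1) * exp P1 \<le> exp (- P1) * (2 * (\<Sum>z\<in>S. W z))"
        by (intro mult_left_mono W1) auto
      then have 3: "1 \<le> 2 * exp (- P1) * (\<Sum>z\<in>S. W z)" by (simp add: exp_add[symmetric])
      show ?thesis unfolding \<Delta>_def distrib_right using 1 2 3 by linarith
    qed
    finally show ?thesis .
  qed
  have "(\<lambda>k. \<Sum>y\<in>F. t ^ k / fact k * path_weight V k y) sums (\<Sum>y\<in>F. W y)"
    by (intro sums_sum W)
  then have "(\<lambda>k. t ^ k / fact k * (\<Sum>y\<in>F. path_weight V k y)) sums (\<Sum>y\<in>F. W y)"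
    by (simp add: sum_distrib_left)
  then have "(\<lambda>k. \<Sum>j\<le>k. t ^ j / fact j * (\<Sum>y\<in>F. path_weight V j y)) \<longlonglongrightarrow> (\<Sum>y\<in>F. W y)"
    by (simp only: sums_def_le)
  then have "(\<Sum>y\<in>F. W y) \<le> \<Delta> * (\<Sum>z\<in>S. W z)"
    by (rule LIMSEQ_le_const2) (use partial in blast)
  then show ?thesis by (simp only: \<Delta>_def P1_def)
qed

section \<open>Pareto potentials\<close>

locale pareto_potential = prob_space M for M :: "'a measure" +
  fixes \<alpha> :: real and \<xi> :: "int ^ 'd \<Rightarrow> 'a \<Rightarrow> real"
  assumes alpha: "\<alpha> > real CARD('d)"
    and indep: "indep_vars (\<lambda>_. borel) \<xi> UNIV"
    and distr: "\<And>z x. x \<ge> 1 \<Longrightarrow> prob {\<omega> \<in> space M. \<xi> z \<omega> < x} = 1 - x powr (-\<alpha>)"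
begin

lemma rv [measurable]: "\<xi> z \<in> borel_measurable M"
  using indep by (auto simp: indep_vars_def)

lemma alpha_gt_1: "\<alpha> > 1"
  using alpha by (metis less_le_trans of_nat_1 of_nat_le_iff Suc_leI zero_less_card_finite One_nat_def le_less_trans not_less)

lemma AE_ge_1: "AE \<omega> in M. \<forall>z. 1 \<le> \<xi> z \<omega>"
  unfolding AE_all_countable
proof
  fix z
  have "prob {\<omega> \<in> space M. \<xi> z \<omega> < 1} = 0" using distr[of 1 z] by simp
  then have "AE \<omega> in M. \<not> \<xi> z \<omega> < 1" by (subst AE_iff_measurable[OF _ refl]) (auto simp: emeasure_eq_measure)
  then show "AE \<omega> in M. 1 \<le> \<xi> z \<omega>" by eventually_elim simp
qed

lemma prob_ge: "x \<ge> 1 \<Longrightarrow> prob {\<omega> \<in> space M. x \<le> \<xi> z \<omega>} = x powr (-\<alpha>)"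
proof -
  assume x: "x \<ge> 1"
  have "{\<omega> \<in> space M. x \<le> \<xi> z \<omega>} = space M - {\<omega> \<in> space M. \<xi> z \<omega> < x}" by auto
  then show ?thesis using distr[OF x, of z] by (simp add: prob_compl)
qed

lemma prob_interval_le:
  assumes "1 \<le> a" "a \<le> c"
  shows "prob {\<omega> \<in> space M. a \<le> \<xi> z \<omega> \<and> \<xi> z \<omega> < c} \<le> \<alpha> * (c - a) * a powr (-\<alpha> - 1)"
proof -
  have "{\<omega> \<in> space M. a \<le> \<xi> z \<omega> \<and> \<xi> z \<omega> < c} = {\<omega> \<in> space M. \<xi> z \<omega> < c} - {\<omega> \<in> space M. \<xi> z \<omega> < a}" by auto
  also have "prob \<dots> = prob {\<omega> \<in> space M. \<xi> z \<omega> < c} - prob {\<omega> \<in> space M. \<xi> z \<omega> < a}"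
    using assms by (intro finite_measure_Diff) auto
  also have "\<dots> = a powr (-\<alpha>) - c powr (-\<alpha>)" using assms by (simp add: distr)
  also have "\<dots> = a powr (-\<alpha>) * (1 - (c / a) powr (-\<alpha>))"
    using assms by (simp add: powr_divide algebra_simps)
  also have "\<dots> \<le> a powr (-\<alpha>) * (\<alpha> * ((c - a) / a))"
  proof (intro mult_left_mono)
    have "1 - (c / a) powr (-\<alpha>) = 1 - exp (- (\<alpha> * ln (c / a)))" using assms by (simp add: powr_def)
    also have "\<dots> \<le> \<alpha> * ln (c / a)" using exp_ge_add_one_self[of "- (\<alpha> * ln (c / a))"] by linarith
    also have "\<dots> \<le> \<alpha> * (c / a - 1)"
      using assms alpha_gt_1 by (intro mult_left_mono ln_le_minus_one) auto
    also have "c / a - 1 = (c - a) / a" using assms by (simp add: field_simps)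
    finally show "1 - (c / a) powr (-\<alpha>) \<le> \<alpha> * ((c - a) / a)" .
  qed simp
  also have "\<dots> = \<alpha> * (c - a) * a powr (-\<alpha> - 1)"
    using assms by (simp add: powr_diff)
  finally show ?thesis .
qed

text \<open>A subset of exactly \<open>k\<close> sites expresses that at least \<open>k\<close>
  sites hit. The windows depend on the site, since equal peak values at different sites mean
  different potentials.\<close>

definition hits :: "nat \<Rightarrow> (int ^ 'd) set \<Rightarrow> (int ^ 'd \<Rightarrow> real set) \<Rightarrow> 'a set" where
  "hits k C B = {\<omega> \<in> space M. \<exists>A\<subseteq>C. card A = k \<and> (\<forall>z\<in>A. \<xi> z \<omega> \<in> B z)}"

lemma hits_eq:
  "hits k C B = (\<Union>A\<in>{A. A \<subseteq> C \<and> card A = k}. {\<omega> \<in> space M. \<forall>z\<in>A. \<xi> z \<omega> \<in> B z})"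
  by (auto simp: hits_def)

lemma sets_hits:
  assumes "finite C" "\<And>z. z \<in> C \<Longrightarrow> B z \<in> sets borel"
  shows "hits k C B \<in> events"
  unfolding hits_eq
proof (intro sets.finite_UN)
  show "finite {A. A \<subseteq> C \<and> card A = k}" using assms(1) by simp
  fix A assume A: "A \<in> {A. A \<subseteq> C \<and> card A = k}"
  then have "finite A" using assms(1) finite_subset by auto
  then show "{\<omega> \<in> space M. \<forall>z\<in>A. \<xi> z \<omega> \<in> B z} \<in> events"
  proof (rule sets.sets_Collect_finite_All[rotated])
    fix z assume "z \<in> A"
    then have "B z \<in> sets borel" using A assms(2) by auto
    then show "{\<omega> \<in> space M. \<xi> z \<omega> \<in> B z} \<in> events" by measurable
  qed
qed

text \<open>Union bound over the subsets of size \<open>k\<close>, with independence inside each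
  subset.\<close>

lemma prob_hits_le:
  assumes C: "finite C" and B: "\<And>z. z \<in> C \<Longrightarrow> B z \<in> sets borel"
    and q: "\<And>z. z \<in> C \<Longrightarrow> prob {\<omega> \<in> space M. \<xi> z \<omega> \<in> B z} \<le> q" "0 \<le> q"
  shows "prob (hits k C B) \<le> (real (card C) * q) ^ k"
proof -
  let ?S = "{A. A \<subseteq> C \<and> card A = k}"
  have fS: "finite ?S" using C by simp
  have meas: "{\<omega> \<in> space M. \<forall>z\<in>A. \<xi> z \<omega> \<in> B z} \<in> events" if "A \<in> ?S" for A
  proof -
    have "{\<omega> \<in> space M. \<forall>z\<in>A. \<xi> z \<omega> \<in> B z} = hits (card A) A B"
    proof -
      have "A' = A" if "A' \<subseteq> A" "card A' = card A" for A'
        using that \<open>A \<in> ?S\<close> C by (metis (mono_tags, lifting) card_subset_eq finite_subset mem_Collect_eq)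
      then show ?thesis by (auto simp: hits_def)
    qed
    also have "\<dots> \<in> events" using that C B by (intro sets_hits) (auto intro: finite_subset)
    finally show ?thesis .
  qed
  have each: "prob {\<omega> \<in> space M. \<forall>z\<in>A. \<xi> z \<omega> \<in> B z} \<le> q ^ k" if A: "A \<in> ?S" for A
  proof (cases "A = {}")
    case True
    then show ?thesis using A by auto
  next
    case False
    have fA: "finite A" using A C finite_subset by auto
    have "{\<omega> \<in> space M. \<forall>z\<in>A. \<xi> z \<omega> \<in> B z} = (\<Inter>z\<in>A. \<xi> z -` B z \<inter> space M)" using False by auto
    moreover have "prob (\<Inter>z\<in>A. \<xi> z -` B z \<inter> space M) = (\<Prod>z\<in>A. prob (\<xi> z -` B z \<inter> space M))"
    proof (rule indep_varsD[OF indep False fA subset_UNIV])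
      show "B z \<in> sets borel" if "z \<in> A" for z using A B that by auto
    qed
    ultimately have "prob {\<omega> \<in> space M. \<forall>z\<in>A. \<xi> z \<omega> \<in> B z} = (\<Prod>z\<in>A. prob (\<xi> z -` B z \<inter> space M))"
      by (rule arg_cong[where f = prob, THEN trans])
    also have "\<dots> \<le> (\<Prod>z\<in>A. q)"
    proof (intro prod_mono conjI)
      fix z assume "z \<in> A"
      moreover have "\<xi> z -` B z \<inter> space M = {\<omega> \<in> space M. \<xi> z \<omega> \<in> B z}" by auto
      ultimately show "prob (\<xi> z -` B z \<inter> space M) \<le> q" using q A by auto
    qed simp
    finally show ?thesis using A by simp
  qed
  have "prob (hits k C B) \<le> (\<Sum>A\<in>?S. prob {\<omega> \<in> space M. \<forall>z\<in>A. \<xi> z \<omega> \<in> B z})"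
    unfolding hits_eq using meas by (intro finite_measure_subadditive_finite fS) auto
  also have "\<dots> \<le> (\<Sum>A\<in>?S. q ^ k)" by (intro sum_mono each)
  also have "\<dots> = real (card C choose k) * q ^ k" using n_subsets[OF C] by simp
  also have "\<dots> \<le> real (card C) ^ k * q ^ k"
  proof (intro mult_right_mono)
    have "card C choose k \<le> card C ^ k"
      using binomial_le_pow[of k "card C"] by (cases "k \<le> card C") (auto simp: binomial_eq_0)
    then show "real (card C choose k) \<le> real (card C) ^ k" by (metis of_nat_le_iff of_nat_power)
  qed (use q in auto)
  finally show ?thesis by (simp add: power_mult_distrib)
qed

lemma prob_all_less_le:
  assumes C: "finite C" "C \<noteq> {}" and x: "x \<ge> 1"
  shows "{\<omega> \<in> space M. \<forall>z\<in>C. \<xi> z \<omega> < x} \<in> events"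
    and "prob {\<omega> \<in> space M. \<forall>z\<in>C. \<xi> z \<omega> < x} \<le> exp (- (real (card C) * x powr (-\<alpha>)))"
proof -
  show "{\<omega> \<in> space M. \<forall>z\<in>C. \<xi> z \<omega> < x} \<in> events"
    using C by (intro sets.sets_Collect_finite_All) auto
  have "{\<omega> \<in> space M. \<forall>z\<in>C. \<xi> z \<omega> < x} = (\<Inter>z\<in>C. \<xi> z -` {..<x} \<inter> space M)" using C by auto
  then have "prob {\<omega> \<in> space M. \<forall>z\<in>C. \<xi> z \<omega> < x} = (\<Prod>z\<in>C. prob (\<xi> z -` {..<x} \<inter> space M))"
    using indep_varsD[OF indep C(2,1), of "\<lambda>_. {..<x}"] by auto
  also have "\<dots> \<le> (\<Prod>z\<in>C. exp (- (x powr (-\<alpha>))))"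
  proof (intro prod_mono conjI)
    fix z
    have "\<xi> z -` {..<x} \<inter> space M = {\<omega> \<in> space M. \<xi> z \<omega> < x}" by auto
    then show "prob (\<xi> z -` {..<x} \<inter> space M) \<le> exp (- (x powr (-\<alpha>)))"
      using distr[OF x, of z] exp_ge_add_one_self[of "- (x powr (-\<alpha>))"] by simp
  qed simp
  also have "\<dots> = exp (- (real (card C) * x powr (-\<alpha>)))"
    by (simp add: exp_of_nat_mult[symmetric])
  finally show "prob {\<omega> \<in> space M. \<forall>z\<in>C. \<xi> z \<omega> < x} \<le> exp (- (real (card C) * x powr (-\<alpha>)))" .
qed

end

section \<open>Peak values as functions of the potential at their own site\<close>

definition peak_fun :: "real \<Rightarrow> real \<Rightarrow> int ^ 'd \<Rightarrow> real \<Rightarrow> real" where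
  "peak_fun b t z x = t * x + ln (geodesics z) - norm1 z * ln (max x b)"

lemma peak_value_eq: "peak_value V b t z = peak_fun b t z (V z)"
  by (simp add: peak_value_def peak_fun_def)

lemma geodesics_le: "geodesics (z :: int ^ 'd) \<le> deg TYPE('d) ^ norm1 z"
proof -
  have "geodesics z \<le> path_weight (\<lambda>_. 0) (norm1 z) z" by (rule geodesics_le_path_weight) simp
  also have "path_weight (\<lambda>_. 0) k z \<le> deg TYPE('d) ^ k" for k and z :: "int ^ 'd"
  proof (induction k arbitrary: z)
    case (Suc k)
    have "path_weight (\<lambda>_. 0) (Suc k) z \<le> (\<Sum>y\<in>neighbours z. deg TYPE('d) ^ k)"
      unfolding path_weight_Suc by (simp add: sum_mono Suc del: sum_constant)
    then show ?case by (simp only: sum_neighbours_const power_Suc)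
  qed (auto simp: path_weight_0)
  finally show ?thesis .
qed

lemma geodesics_ge_1: "1 \<le> geodesics (z :: int ^ 'd)"
proof -
  have "(\<Prod>i\<in>A. fact (f i)) \<le> (fact (\<Sum>i\<in>A. f i) :: real)" if "finite A" for A and f :: "'d \<Rightarrow> nat"
    using that
  proof (induction A rule: finite_induct)
    case (insert a A)
    have "(\<Prod>i\<in>insert a A. fact (f i)) \<le> (fact (f a) * fact (\<Sum>i\<in>A. f i) :: real)"
      using insert by (simp add: mult_left_mono)
    also have "\<dots> \<le> fact (f a + (\<Sum>i\<in>A. f i))"
    proof -
      have "fact (f a) * fact (sum f A) \<le> (fact (f a + sum f A) :: nat)"
        by (rule dvd_imp_le[OF fact_fact_dvd_fact]) simp
      then show ?thesis by (metis of_nat_fact of_nat_le_iff of_nat_mult)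
    qed
    finally show ?case using insert by simp
  qed simp
  from this[of UNIV "\<lambda>i. nat \<bar>z $ i\<bar>"] show ?thesis
    by (simp add: geodesics_def norm1_def prod_pos)
qed

lemma ln_geodesics_bounds:
  "0 \<le> ln (geodesics (z :: int ^ 'd))" "ln (geodesics z) \<le> norm1 z * ln (deg TYPE('d))"
proof -
  show "0 \<le> ln (geodesics z)" using geodesics_ge_1[of z] by simp
  have "ln (geodesics z) \<le> ln (deg TYPE('d) ^ norm1 z)"
    using geodesics_le[of z] geodesics_pos[of z] by simp
  also have "\<dots> = norm1 z * ln (deg TYPE('d))" by (rule ln_realpow)
  finally show "ln (geodesics z) \<le> norm1 z * ln (deg TYPE('d))" .
qed

text \<open>Each unit of distance costs at least \<open>ln b\<close>, which pays for the factor
  \<open>deg\<close> in the geodesic count and leaves \<open>4\<close>. Hence a nonnegative peak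
  value forces \<open>norm1 z <= t * x / 4\<close>.\<close>

lemma peak_fun_le:
  fixes z :: "int ^ 'd"
  assumes b: "ln (deg TYPE('d)) + 4 \<le> ln b" "b > 0"
  shows "peak_fun b t z x + 4 * norm1 z \<le> t * x"
proof -
  have "ln b \<le> ln (max x b)" using b by (intro ln_mono) auto
  then have "norm1 z * (ln (deg TYPE('d)) + 4) \<le> norm1 z * ln (max x b)"
    using b by (intro mult_left_mono, linarith) simp
  then show ?thesis using ln_geodesics_bounds(2)[of z] by (simp add: peak_fun_def algebra_simps)
qed

text \<open>At such levels \<open>x\<close> exceeds the cutoff and
  \<open>norm1 z <= t * x / 2\<close>, so the derivative \<open>t - norm1 z / x\<close> is at least
  \<open>t / 2\<close> from \<open>x\<close> onwards. Windows of peak values thus pull back to short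
  windows of the potential.\<close>

lemma peak_fun_slope:
  fixes z :: "int ^ 'd"
  assumes b: "ln (deg TYPE('d)) + 4 \<le> ln b" "b > 0" and t: "t > 0"
    and x: "t * b \<le> peak_fun b t z x" "x \<le> x'"
  shows "t / 2 * (x' - x) \<le> peak_fun b t z x' - peak_fun b t z x"
proof -
  have "t * b \<le> t * x" using peak_fun_le[OF b, of t z x] x by linarith
  then have xb: "b \<le> x" using t by simp
  have x0: "x > 0" using xb b by linarith
  have "4 * real (norm1 z) \<le> t * x" using peak_fun_le[OF b, of t z x] x(1) mult_nonneg_nonneg[of t b] t b(2) by linarith
  then have n: "real (norm1 z) \<le> t * x / 2" using x0 t by simp
  have "ln x' - ln x = ln (x' / x)" using x0 x by (simp add: ln_div)
  also have "\<dots> \<le> x' / x - 1" using x0 x by (intro ln_le_minus_one) auto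
  finally have l: "ln x' - ln x \<le> (x' - x) / x" using x0 by (simp add: diff_divide_distrib)
  have "norm1 z * (ln x' - ln x) \<le> norm1 z * ((x' - x) / x)" by (intro mult_left_mono l) auto
  also have "\<dots> \<le> t * x / 2 * ((x' - x) / x)" using n x x0 by (intro mult_right_mono) auto
  also have "\<dots> = t / 2 * (x' - x)" using x0 by simp
  finally have "norm1 z * (ln x' - ln x) \<le> t / 2 * (x' - x)" .
  moreover have "t / 2 * (x' - x) = (t * x' - t * x) / 2" by (simp add: field_simps)
  moreover have mx: "max x b = x" "max x' b = x'" using xb x by auto
  ultimately show ?thesis unfolding peak_fun_def mx right_diff_distrib by linarith
qed

lemma peak_fun_measurable [measurable]: "peak_fun b t z \<in> borel_measurable borel"
  unfolding peak_fun_def by measurable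

context pareto_potential begin

lemma prob_peak_window_le:
  assumes b: "ln (deg TYPE('d)) + 4 \<le> ln b" "b > 0" and t: "t > 0"
    and y: "t * b \<le> y" "1 \<le> y / t" "0 < w"
  shows "prob {\<omega> \<in> space M. \<xi> z \<omega> \<in> peak_fun b t z -` {y..<y + w}} \<le> 6 * \<alpha> * (w / t) * (y / t) powr (-\<alpha> - 1)"
proof (cases "peak_fun b t z -` {y..<y + w} = {}")
  case True
  then show ?thesis using alpha_gt_1 y t by auto
next
  case False
  then obtain x1 where x1: "y \<le> peak_fun b t z x1" "peak_fun b t z x1 < y + w" by auto
  \<comment> \<open>By the slope bound any two potentials in the window differ by less than
    \<open>h\<close>, so one of them, \<open>x1\<close>, locates the rest. Cutting at
    \<open>y / t\<close> fixes where the Pareto density is evaluated.\<close>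
  define h where "h = 2 * w / t"
  define a where "a = max (x1 - h) (y / t)"
  have h0: "h > 0" using y t by (simp add: h_def)
  have low: "y / t \<le> x" if "y \<le> peak_fun b t z x" for x
    using peak_fun_le[OF b, of t z x] that t by (simp add: field_simps)
  have close: "x' - x < h" if "y \<le> peak_fun b t z x" "peak_fun b t z x' < y + w" for x x'
  proof (cases "x \<le> x'")
    case True
    have "t / 2 * (x' - x) < w"
      using peak_fun_slope[OF b t _ True, of z] that y by linarith
    then show ?thesis using t by (simp add: h_def field_simps)
  qed (use h0 in auto)
  have "{\<omega> \<in> space M. \<xi> z \<omega> \<in> peak_fun b t z -` {y..<y + w}} \<subseteq> {\<omega> \<in> space M. a \<le> \<xi> z \<omega> \<and> \<xi> z \<omega> < x1 + h}"
  proof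
    fix \<omega> assume "\<omega> \<in> {\<omega> \<in> space M. \<xi> z \<omega> \<in> peak_fun b t z -` {y..<y + w}}"
    then have \<omega>: "\<omega> \<in> space M" "y \<le> peak_fun b t z (\<xi> z \<omega>)" "peak_fun b t z (\<xi> z \<omega>) < y + w" by auto
    have "\<xi> z \<omega> < x1 + h" "x1 - h \<le> \<xi> z \<omega>" "y / t \<le> \<xi> z \<omega>"
      using close[OF x1(1) \<omega>(3)] close[OF \<omega>(2) x1(2)] low[OF \<omega>(2)] by linarith+
    then show "\<omega> \<in> {\<omega> \<in> space M. a \<le> \<xi> z \<omega> \<and> \<xi> z \<omega> < x1 + h}" using \<omega>(1) by (simp add: a_def)
  qed
  then have "prob {\<omega> \<in> space M. \<xi> z \<omega> \<in> peak_fun b t z -` {y..<y + w}} \<le> prob {\<omega> \<in> space M. a \<le> \<xi> z \<omega> \<and> \<xi> z \<omega> < x1 + h}"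
    by (intro finite_measure_mono) auto
  also have "\<dots> \<le> \<alpha> * (x1 + h - a) * a powr (-\<alpha> - 1)"
    using low[OF x1(1)] h0 y by (intro prob_interval_le) (auto simp: a_def)
  also have "\<dots> \<le> \<alpha> * (3 * h) * (y / t) powr (-\<alpha> - 1)"
  proof (intro mult_mono mult_left_mono)
    show "a powr (-\<alpha> - 1) \<le> (y / t) powr (-\<alpha> - 1)"
      using y alpha_gt_1 by (intro powr_mono2') (auto simp: a_def)
  qed (use alpha_gt_1 h0 low[OF x1(1)] in \<open>auto simp: a_def\<close>)
  also have "\<dots> = 6 * \<alpha> * (w / t) * (y / t) powr (-\<alpha> - 1)" by (simp add: h_def)
  finally show ?thesis .
qed

text \<open>
  Consecutive bins have offset \<open>w\<close> and width \<open>2 * w\<close>, so that peak values within distance \<open>w\<close> of each other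
  share a bin. This replaces conditioning on one of the values.
\<close>

definition ties :: "nat \<Rightarrow> nat \<Rightarrow> real \<Rightarrow> real \<Rightarrow> real \<Rightarrow> real \<Rightarrow> nat \<Rightarrow> 'a set" where
  "ties k R b t y w N = (\<Union>i<N. hits k (lball 0 R) (\<lambda>z. peak_fun b t z -` {y + real i * w..<y + real i * w + 2 * w}))"

lemma peak_window_borel: "peak_fun b t z -` {y..<y'} \<in> sets borel"
  using measurable_sets[OF peak_fun_measurable, of "{y..<y'}" b t z] by simp

lemma sets_ties: "ties k R b t y w N \<in> events"
  unfolding ties_def by (intro sets.finite_UN finite_lessThan sets_hits peak_window_borel) auto

lemma prob_ties_le:
  assumes b: "ln (deg TYPE('d)) + 4 \<le> ln b" "b > 0" and t: "t > 0"
    and y: "t * b \<le> y" "1 \<le> y / t" "0 < w"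
  shows "prob (ties k R b t y w N) \<le> N * ((2 * real R + 1) ^ CARD('d) * (12 * \<alpha> * (w / t) * (y / t) powr (-\<alpha> - 1))) ^ k"
proof -
  let ?q = "12 * \<alpha> * (w / t) * (y / t) powr (-\<alpha> - 1)"
  have q0: "0 \<le> ?q" using alpha_gt_1 y t by auto
  have "prob (ties k R b t y w N) \<le> (\<Sum>i<N. prob (hits k (lball 0 R) (\<lambda>z. peak_fun b t z -` {y + real i * w..<y + real i * w + 2 * w})))"
    unfolding ties_def by (intro finite_measure_subadditive_finite) (auto intro!: sets_hits peak_window_borel)
  also have "\<dots> \<le> (\<Sum>i<N. ((2 * real R + 1) ^ CARD('d) * ?q) ^ k)"
  proof (rule sum_mono)
    fix i
    let ?y = "y + real i * w"
    have yy: "y \<le> ?y" using y by simp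
    have "prob (hits k (lball 0 R) (\<lambda>z. peak_fun b t z -` {?y..<?y + 2 * w})) \<le> (real (card (lball (0 :: int ^ 'd) R)) * ?q) ^ k"
    proof (intro prob_hits_le peak_window_borel)
      fix z :: "int ^ 'd"
      have "prob {\<omega> \<in> space M. \<xi> z \<omega> \<in> peak_fun b t z -` {?y..<?y + 2 * w}} \<le> 6 * \<alpha> * (2 * w / t) * (?y / t) powr (-\<alpha> - 1)"
      proof (rule prob_peak_window_le[OF b t])
        show "t * b \<le> ?y" using y yy by linarith
        have "y / t \<le> ?y / t" using yy t by (intro divide_right_mono) auto
        then show "1 \<le> ?y / t" using y by linarith
      qed (use y in auto)
      also have "\<dots> \<le> 6 * \<alpha> * (2 * w / t) * (y / t) powr (-\<alpha> - 1)"
      proof (intro mult_left_mono powr_mono2')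
        show "y / t \<le> ?y / t" using yy t by (intro divide_right_mono) auto
      qed (use alpha_gt_1 y t in auto)
      finally show "prob {\<omega> \<in> space M. \<xi> z \<omega> \<in> peak_fun b t z -` {?y..<?y + 2 * w}} \<le> ?q" by simp
    qed (use q0 in auto)
    also have "\<dots> \<le> ((2 * real R + 1) ^ CARD('d) * ?q) ^ k"
    proof (intro power_mono mult_right_mono)
      show "real (card (lball (0 :: int ^ 'd) R)) \<le> (2 * real R + 1) ^ CARD('d)" by (rule real_card_lball_le)
      show "0 \<le> real (card (lball (0 :: int ^ 'd) R)) * ?q" by (rule mult_nonneg_nonneg[OF _ q0]) simp
    qed (rule q0)
    finally show "prob (hits k (lball 0 R) (\<lambda>z. peak_fun b t z -` {?y..<?y + 2 * w})) \<le> ((2 * real R + 1) ^ CARD('d) * ?q) ^ k" .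
  qed
  finally show ?thesis by simp
qed

lemma not_tiesD:
  assumes \<omega>: "\<omega> \<in> space M" "\<omega> \<notin> ties k R b t y w N" and w: "w > 0"
    and A: "A \<subseteq> lball 0 R" "card A = k"
    and x: "y \<le> x" "x < y + N * w" "\<And>z. z \<in> A \<Longrightarrow> x \<le> peak_value (\<lambda>z. \<xi> z \<omega>) b t z"
  obtains z where "z \<in> A" "x + w < peak_value (\<lambda>z. \<xi> z \<omega>) b t z"
proof (rule ccontr)
  assume no: "\<not> thesis"
  note hit = that
  define i where "i = nat \<lfloor>(x - y) / w\<rfloor>"
  have nn: "0 \<le> (x - y) / w" using x w by simp
  have i: "real i \<le> (x - y) / w" "(x - y) / w < real i + 1"
  proof -
    have "real i = of_int \<lfloor>(x - y) / w\<rfloor>" using nn by (simp add: i_def)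
    then show "real i \<le> (x - y) / w" "(x - y) / w < real i + 1"
      using of_int_floor_le[of "(x - y) / w"] real_of_int_floor_add_one_gt[of "(x - y) / w"] by linarith+
  qed
  have i': "y + real i * w \<le> x" "x < y + real i * w + w" using i w by (simp_all add: field_simps)
  have "i < N"
  proof -
    have "real i * w < real N * w" using i' x by linarith
    then show ?thesis using w by simp
  qed
  moreover have "\<xi> z \<omega> \<in> peak_fun b t z -` {y + real i * w..<y + real i * w + 2 * w}" if "z \<in> A" for z
  proof -
    have "peak_value (\<lambda>z. \<xi> z \<omega>) b t z \<le> x + w" using no hit[OF that] by (meson not_less)
    then show ?thesis using x(3)[OF that] i' by (simp add: peak_value_eq)
  qed
  ultimately have "\<omega> \<in> ties k R b t y w N" using \<omega>(1) A unfolding ties_def hits_def by auto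
  then show False using \<omega> by simp
qed

end

section \<open>Scales\<close>

lemma eventually_powr_le:
  fixes a b c :: real
  assumes "a < b" shows "\<forall>\<^sub>F T in at_top. c * T powr a \<le> T powr b"
proof -
  have "((\<lambda>T::real. c * T powr (a - b)) \<longlongrightarrow> c * 0) at_top"
    using assms by (intro tendsto_mult tendsto_const tendsto_neg_powr filterlim_ident) auto
  then have "\<forall>\<^sub>F T::real in at_top. c * T powr (a - b) < 1"
    by (intro order_tendstoD) auto
  then show ?thesis using eventually_gt_at_top[of 0]
  proof eventually_elim
    case (elim T)
    then have "c * T powr (a - b) * T powr b \<le> 1 * T powr b" by (intro mult_right_mono) auto
    then show ?case using elim(2) by (simp add: powr_diff)
  qed
qed

lemma eventually_ln_powr_le:
  fixes a b c :: real
  assumes "a < b" shows "\<forall>\<^sub>F T in at_top. c * (ln T * T powr a) \<le> T powr b"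
proof -
  define \<delta> where "\<delta> = (b - a) / 2"
  have \<delta>: "\<delta> > 0" using assms by (simp add: \<delta>_def)
  have "\<forall>\<^sub>F T in at_top. (\<bar>c\<bar> / \<delta>) * T powr (a + \<delta>) \<le> T powr b"
    by (rule eventually_powr_le) (use assms in \<open>simp add: \<delta>_def field_simps\<close>)
  then show ?thesis using eventually_ge_at_top[of 1]
  proof eventually_elim
    case (elim T)
    have "ln T \<le> T powr \<delta> / \<delta>"
    proof -
      have "\<delta> * ln T = ln (T powr \<delta>)" using elim by (simp add: ln_powr)
      also have "\<dots> \<le> T powr \<delta>" using elim ln_le_minus_one[of "T powr \<delta>"] by simp
      finally show ?thesis using \<delta> by (simp add: field_simps)
    qed
    then have "\<bar>c\<bar> * (ln T * T powr a) \<le> \<bar>c\<bar> * (T powr \<delta> / \<delta> * T powr a)"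
      by (intro mult_left_mono mult_right_mono) auto
    also have "\<dots> = (\<bar>c\<bar> / \<delta>) * T powr (a + \<delta>)" by (simp add: powr_add)
    also have "\<dots> \<le> T powr b" by (rule elim)
    finally have "\<bar>c\<bar> * (ln T * T powr a) \<le> T powr b" .
    moreover have "c * (ln T * T powr a) \<le> \<bar>c\<bar> * (ln T * T powr a)"
      using elim by (intro mult_right_mono) auto
    ultimately show ?case by linarith
  qed
qed

lemma eventually_const_le_powr:
  fixes b c :: real
  assumes "0 < b" shows "\<forall>\<^sub>F T in at_top. c \<le> T powr b"
  using eventually_powr_le[OF assms, of c] eventually_gt_at_top[of 0] by eventually_elim simp

lemma inverse_one_minus_le_exp:
  fixes x :: real
  assumes "0 \<le> x" "x \<le> 1/2" shows "1 / (1 - x) \<le> exp (2 * x)"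
proof -
  have "exp (- (2 * x)) \<le> 1 - x"
  proof -
    have "- x - 2 * x\<^sup>2 \<le> ln (1 - x)" using assms by (intro ln_one_minus_pos_lower_bound)
    moreover have "2 * x\<^sup>2 \<le> x" using assms using mult_left_mono[of "2 * x" 1 x] by (simp add: power2_eq_square)
    ultimately have "- (2 * x) \<le> ln (1 - x)" by linarith
    then have "exp (- (2 * x)) \<le> exp (ln (1 - x))" by simp
    also have "\<dots> = 1 - x" using assms by simp
    finally show ?thesis .
  qed
  then show ?thesis using assms by (simp add: exp_minus field_simps)
qed

lemma eventually_poly_le_power2: "\<forall>\<^sub>F n in sequentially. c * (2 * real n + 1) ^ d \<le> 2 ^ n"
proof -
  have "((\<lambda>x::real. x ^ d / exp x) \<longlongrightarrow> 0) at_top" by (rule tendsto_power_div_exp_0)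
  have "filterlim (\<lambda>n. ln 2 * real n) at_top sequentially"
    by (rule filterlim_tendsto_pos_mult_at_top[OF tendsto_const _ filterlim_real_sequentially]) simp
  from filterlim_compose[OF \<open>((\<lambda>x::real. x ^ d / exp x) \<longlongrightarrow> 0) at_top\<close> this]
  have "(\<lambda>n. (ln 2 * real n) ^ d / exp (ln 2 * real n)) \<longlonglongrightarrow> 0" .
  then have "(\<lambda>n. (\<bar>c\<bar> * (3 / ln 2) ^ d) * ((ln 2 * real n) ^ d / exp (ln 2 * real n))) \<longlonglongrightarrow> (\<bar>c\<bar> * (3 / ln 2) ^ d) * 0"
    by (intro tendsto_mult tendsto_const)
  then have "\<forall>\<^sub>F n in sequentially. (\<bar>c\<bar> * (3 / ln 2) ^ d) * ((ln 2 * real n) ^ d / exp (ln 2 * real n)) < 1"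
    by (intro order_tendstoD) auto
  then show ?thesis using eventually_ge_at_top[of 1]
  proof eventually_elim
    case (elim n)
    have e: "exp (ln 2 * real n) = 2 ^ n" by (simp add: exp_of_nat2_mult)
    have "(\<bar>c\<bar> * (3 / ln 2) ^ d) * ((ln 2 * real n) ^ d / exp (ln 2 * real n)) = \<bar>c\<bar> * (3 * real n) ^ d / 2 ^ n"
      unfolding e by (simp add: power_mult_distrib power_divide)
    then have "\<bar>c\<bar> * (3 * real n) ^ d / 2 ^ n < 1" using elim(1) by simp
    then have "\<bar>c\<bar> * (3 * real n) ^ d \<le> 2 ^ n" by (simp add: divide_less_eq)
    moreover have "c * (2 * real n + 1) ^ d \<le> \<bar>c\<bar> * (3 * real n) ^ d"
      using elim(2) by (intro mult_mono power_mono) auto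
    ultimately show ?case by linarith
  qed
qed

text \<open>
  At time \<open>T\<close> the relevant distances are of order \<open>T powr (1 + \<rho>)\<close> and the relevant potential values of order
  \<open>T powr \<rho>\<close>, up to logarithms. All error terms are afforded small powers of \<open>T\<close> instead: \<open>\<kappa>\<close> is the exponent
  lost in the gap between peak values, and the much smaller \<open>\<nu>\<close> is lost in the size of the box and of the top
  peak. The value of \<open>\<beta>\<close> lies in the window where on the grid \<open>j powr \<beta>\<close> triple ties are summable while peak
  values change by less than the gap from one grid point to the next.
\<close>

locale scales =
  fixes d :: nat and \<alpha> :: real
  assumes d_ge_1: "d \<ge> 1" and alpha_gt: "\<alpha> > real d"
begin

text \<open>The maximum of the potential over a ball of radius \<open>r\<close> is about
  \<open>r powr (d / \<alpha>)\<close>. Balancing \<open>t\<close> times this maximum against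
  \<open>r\<close> gives \<open>r = t powr (1 + \<rho>)\<close>.\<close>

definition "\<rho> = real d / (\<alpha> - real d)"
text \<open>The divisor keeps exponents such as \<open>\<rho> - 4 * \<kappa>\<close> positive; the
  minimum with \<open>1\<close> gives \<open>\<beta> > 1\<close>.\<close>

definition "\<kappa> = min \<rho> 1 / 10"
text \<open>Tie probabilities lose powers of \<open>T\<close> with exponents of order
  \<open>\<alpha> * \<nu>\<close>; these must stay below \<open>\<kappa>\<close>.\<close>

definition "\<nu> = \<kappa> / (40 * \<alpha>)"
text \<open>The midpoint of \<open>d / \<alpha>\<close> and \<open>1\<close>. Above
  \<open>d / \<alpha>\<close>, the bound \<open>Vmax\<close> holds almost surely in the enlarged
  box; below \<open>1\<close>, \<open>T * Vmax T\<close> is negligible against the radius of the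
  box.\<close>

definition "\<eta> = (1 + real d / \<alpha>) / 2"
text \<open>Near \<open>T\<close> the grid spacing is about \<open>T powr (1 - 1 / \<beta>)\<close>.
  Summing triple ties needs \<open>1 / \<beta> < 2 * \<kappa>\<close>, and keeping the drift of peak
  values below the gap needs \<open>1 / \<beta> > \<kappa>\<close>, up to multiples of
  \<open>\<nu>\<close>; the choice is the midpoint.\<close>

definition "\<beta> = 2 / (3 * \<kappa>)"
text \<open>Chosen so that \<open>Rad T powr \<theta>\<close> and \<open>Vmax T\<close> agree up to
  a constant.\<close>

definition "\<theta> = (\<rho> + \<eta> * \<nu>) / (1 + \<rho> + \<nu>)"

definition Rad :: "real \<Rightarrow> nat" where "Rad T = nat \<lceil>T powr (1 + \<rho> + \<nu>)\<rceil>"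
text \<open>\<open>Rad T / Loc T\<close> and \<open>Eps T * Rad T\<close> both have order
  \<open>T powr (1 + \<rho> + \<nu> - 3 * \<kappa>)\<close>, below the gap even after a
  logarithm.\<close>

definition Loc :: "real \<Rightarrow> nat" where "Loc T = nat \<lceil>T powr (3 * \<kappa>)\<rceil>"
definition Base :: "real \<Rightarrow> real" where "Base T = T powr (\<rho> - 2 * \<kappa>)"
definition Gap :: "real \<Rightarrow> real" where "Gap T = T powr (1 + \<rho> - \<kappa>)"
text \<open>The divisor makes \<open>2 * Sep T * t\<close>, with \<open>t\<close> up to
  \<open>2 * T\<close>, at most a quarter of \<open>Gap T\<close>.\<close>

definition Sep :: "real \<Rightarrow> real" where "Sep T = T powr (\<rho> - \<kappa>) / 16"
definition Eps :: "real \<Rightarrow> real" where "Eps T = T powr (- 3 * \<kappa>)"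
definition Vmax :: "real \<Rightarrow> real" where "Vmax T = 2 * T powr (\<rho> + \<eta> * \<nu>)"
definition Top :: "real \<Rightarrow> real" where "Top T = T powr (1 + \<rho> - \<nu>)"

lemma alpha_pos: "\<alpha> > 1" using d_ge_1 alpha_gt by linarith

lemma rho_pos: "\<rho> > 0" using d_ge_1 alpha_gt by (simp add: \<rho>_def)

lemma kappa_bounds: "0 < \<kappa>" "10 * \<kappa> \<le> \<rho>" "10 * \<kappa> \<le> 1"
  using rho_pos by (auto simp: \<kappa>_def)

lemma nu_bounds: "0 < \<nu>" "40 * \<nu> < \<kappa>" "40 * (\<alpha> * \<nu>) = \<kappa>"
proof -
  show "0 < \<nu>" using kappa_bounds alpha_pos by (simp add: \<nu>_def)
  show a: "40 * (\<alpha> * \<nu>) = \<kappa>" using alpha_pos by (simp add: \<nu>_def)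
  have "1 * \<nu> < \<alpha> * \<nu>" using alpha_pos \<open>0 < \<nu>\<close> by (intro mult_strict_right_mono)
  then show "40 * \<nu> < \<kappa>" using a by linarith
qed

lemma eta_bounds: "real d / \<alpha> < \<eta>" "\<eta> < 1" "0 < \<eta>"
proof -
  have "real d / \<alpha> < 1" "0 < real d / \<alpha>" using alpha_gt alpha_pos d_ge_1 by auto
  moreover have "x < (1 + x) / 2 \<and> (1 + x) / 2 < 1 \<and> 0 < (1 + x) / 2" if "x < 1" "0 < x" for x :: real
    using that by auto
  ultimately have "real d / \<alpha> < \<eta> \<and> \<eta> < 1 \<and> 0 < \<eta>"
    unfolding \<eta>_def by blast
  then show "real d / \<alpha> < \<eta>" "\<eta> < 1" "0 < \<eta>" by auto
qed

lemma eta_nu: "0 < \<eta> * \<nu>" "\<eta> * \<nu> < \<nu>"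
  using eta_bounds nu_bounds by (auto simp: mult_less_cancel_right)

lemma theta_eq: "\<theta> * (1 + \<rho> + \<nu>) = \<rho> + \<eta> * \<nu>"
  using rho_pos nu_bounds by (simp add: \<theta>_def)

lemma theta_bounds: "0 < \<theta>" "\<theta> < 1"
  using rho_pos nu_bounds eta_nu by (auto simp: \<theta>_def divide_less_eq)

text \<open>The tail probability at \<open>T powr \<rho>\<close> is the reciprocal, in order, of the
  number of sites within \<open>T powr (1 + \<rho>)\<close>.\<close>

lemma rho_alpha: "\<alpha> * \<rho> = real d * (1 + \<rho>)"
  using alpha_gt by (simp add: \<rho>_def field_simps)

text \<open>This makes \<open>n ^ d\<close> sites harmless against the tail
  \<open>n powr (- \<theta> * \<alpha>)\<close> along dyadic radii; it comes down to
  \<open>\<eta> > d / \<alpha>\<close>.\<close>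

lemma theta_alpha: "real d < \<theta> * \<alpha>"
proof -
  have "real d * \<nu> < (\<alpha> * \<eta>) * \<nu>"
    using eta_bounds(1) alpha_pos nu_bounds by (intro mult_strict_right_mono) (auto simp: field_simps)
  then have "real d * (1 + \<rho> + \<nu>) < \<alpha> * \<rho> + \<alpha> * (\<eta> * \<nu>)" using rho_alpha by (simp add: algebra_simps)
  also have "\<dots> = \<theta> * \<alpha> * (1 + \<rho> + \<nu>)" using theta_eq by (metis distrib_left mult.assoc mult.commute)
  finally show ?thesis using rho_pos nu_bounds by (simp add: mult_less_cancel_right)
qed

lemma Rad_bounds: "T \<ge> 1 \<Longrightarrow> T powr (1 + \<rho> + \<nu>) \<le> Rad T" "T \<ge> 1 \<Longrightarrow> Rad T \<le> 2 * T powr (1 + \<rho> + \<nu>)"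
  and Loc_bounds: "T \<ge> 1 \<Longrightarrow> T powr (3 * \<kappa>) \<le> Loc T" "T \<ge> 1 \<Longrightarrow> Loc T \<le> 2 * T powr (3 * \<kappa>)"
proof -
  have *: "x \<le> real (nat \<lceil>x\<rceil>)" "real (nat \<lceil>x\<rceil>) \<le> 2 * x" if "x \<ge> 1" for x :: real
    using that by linarith+
  show "T powr (1 + \<rho> + \<nu>) \<le> Rad T" "Rad T \<le> 2 * T powr (1 + \<rho> + \<nu>)" if "T \<ge> 1"
    unfolding Rad_def using *[of "T powr (1 + \<rho> + \<nu>)"] ge_one_powr_ge_zero[OF that, of "1 + \<rho> + \<nu>"] rho_pos nu_bounds by auto
  show "T powr (3 * \<kappa>) \<le> Loc T" "Loc T \<le> 2 * T powr (3 * \<kappa>)" if "T \<ge> 1"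
    unfolding Loc_def using *[of "T powr (3 * \<kappa>)"] ge_one_powr_ge_zero[OF that, of "3 * \<kappa>"] kappa_bounds by auto
qed

lemma Vmax_Sep_ratio:
  assumes T: "T \<ge> 1" and le: "34 * T powr (\<eta> * \<nu> + \<kappa>) \<le> T powr (3 * \<kappa>)"
  shows "1 \<le> (Vmax T + 2 * Sep T) / Sep T" "(Vmax T + 2 * Sep T) / Sep T \<le> T powr (3 * \<kappa>)"
    "0 \<le> ln ((Vmax T + 2 * Sep T) / Sep T)" "ln ((Vmax T + 2 * Sep T) / Sep T) \<le> 3 * \<kappa> * ln T"
proof -
  have T0: "T > 0" using T by linarith
  have g0: "Sep T > 0" using T0 by (simp add: Sep_def)
  have "0 \<le> Vmax T" by (simp add: Vmax_def)
  then show ge1: "1 \<le> (Vmax T + 2 * Sep T) / Sep T" using g0 by (simp add: field_simps)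
  then show "0 \<le> ln ((Vmax T + 2 * Sep T) / Sep T)" by (rule ln_ge_zero)
  have "Vmax T / Sep T = 32 * T powr (\<eta> * \<nu> + \<kappa>)"
    using T0 by (simp add: Vmax_def Sep_def powr_diff powr_add)
  moreover have "1 \<le> T powr (\<eta> * \<nu> + \<kappa>)"
    using T eta_nu kappa_bounds by (intro ge_one_powr_ge_zero) auto
  ultimately have "Vmax T / Sep T + 2 \<le> T powr (3 * \<kappa>)" using le by linarith
  then show le': "(Vmax T + 2 * Sep T) / Sep T \<le> T powr (3 * \<kappa>)" using g0 by (simp add: add_divide_distrib)
  have "ln ((Vmax T + 2 * Sep T) / Sep T) \<le> ln (T powr (3 * \<kappa>))" using ge1 le' by (intro ln_mono) auto
  then show "ln ((Vmax T + 2 * Sep T) / Sep T) \<le> 3 * \<kappa> * ln T" using T0 by (simp add: ln_powr)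
qed

text \<open>Each factor has logarithm of order at most \<open>ln T * T powr q\<close>, and
  \<open>q\<close> is smaller than the exponent of the gap by
  \<open>2 * \<kappa> - \<nu>\<close>.\<close>

lemma eventually_path_error_le:
  "\<forall>\<^sub>F T in at_top. 2 * (2 * real (Rad T) + 1) ^ d * path_error d (Sep T) m (Loc T) (Rad T) (Eps T) (Vmax T) \<le> exp (Gap T / 8)"
proof -
  define q where "q = 1 + \<rho> + \<nu> - 3 * \<kappa>"
  define C where "C = ln 4 + 9 * \<kappa> + 12 * \<kappa> * m + 4 + ln 2 + 2 * real d * (ln 15 + 1 + \<rho> + \<nu>)"
  have q: "0 < q" "q < 1 + \<rho> - \<kappa>" using rho_pos nu_bounds kappa_bounds by (auto simp: q_def)
  have "\<forall>\<^sub>F T in at_top. (8 * C) * (ln T * T powr q) \<le> T powr (1 + \<rho> - \<kappa>)"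
    by (rule eventually_ln_powr_le[OF q(2)])
  moreover have "\<forall>\<^sub>F T in at_top. 34 * T powr (\<eta> * \<nu> + \<kappa>) \<le> T powr (3 * \<kappa>)"
    using eta_nu nu_bounds kappa_bounds by (intro eventually_powr_le) linarith
  moreover have "\<forall>\<^sub>F T in at_top. 2 \<le> T powr (3 * \<kappa>)"
    using kappa_bounds by (intro eventually_const_le_powr) auto
  moreover have "\<forall>\<^sub>F T::real in at_top. T \<ge> exp 1" by (rule eventually_ge_at_top)
  ultimately show ?thesis
  proof eventually_elim
    case (elim T)
    have T1: "T \<ge> 1" using elim(4) exp_ge_add_one_self[of 1] by linarith
    have T0: "T > 0" using T1 by linarith
    define l where "l = ln T"
    have l1: "l \<ge> 1" using elim(4) T0 by (simp add: l_def ln_ge_iff)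
    have pw: "T powr x = exp (x * l)" for x using T0 by (simp add: powr_def l_def)
    have pq1: "1 \<le> T powr q" using T1 q by (intro ge_one_powr_ge_zero) auto
    note R = Rad_bounds[OF T1] and L = Loc_bounds[OF T1]
    have g0: "Sep T > 0" using T0 by (simp add: Sep_def)
    have e: "0 < Eps T" "Eps T \<le> 1/2"
      using elim(3) T0 by (auto simp: Eps_def powr_minus field_simps)
    note ratio = Vmax_Sep_ratio[OF T1 elim(2)]
    have F1: "4 * (Vmax T + 2 * Sep T)\<^sup>2 / (Eps T * (Sep T)\<^sup>2) \<le> exp (ln 4 + 9 * \<kappa> * l)"
    proof -
      have "4 * (Vmax T + 2 * Sep T)\<^sup>2 / (Eps T * (Sep T)\<^sup>2) = 4 * ((Vmax T + 2 * Sep T) / Sep T)\<^sup>2 * (1 / Eps T)"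
        using g0 by (simp add: power_divide)
      also have "\<dots> \<le> 4 * (T powr (3 * \<kappa>))\<^sup>2 * (1 / Eps T)"
        using ratio e by (intro mult_right_mono mult_left_mono power_mono) auto
      also have "\<dots> = exp (ln 4 + 9 * \<kappa> * l)"
      proof -
        have "(T powr (3 * \<kappa>))\<^sup>2 = exp (6 * \<kappa> * l)"
          by (simp add: pw power2_eq_square exp_add[symmetric])
        moreover have "1 / Eps T = exp (3 * \<kappa> * l)"
          by (simp add: Eps_def pw exp_minus divide_inverse)
        moreover have "exp (9 * \<kappa> * l) = exp (6 * \<kappa> * l) * exp (3 * \<kappa> * l)"
          by (simp add: exp_add[symmetric] algebra_simps)
        ultimately show ?thesis by (simp add: exp_add)
      qed
      finally show ?thesis .
    qed
    have RL: "real (Rad T) / real (Loc T) \<le> 2 * T powr q"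
    proof -
      have "real (Rad T) / real (Loc T) \<le> (2 * T powr (1 + \<rho> + \<nu>)) / T powr (3 * \<kappa>)"
        using R L T0 by (intro frac_le) auto
      then show ?thesis using T0 by (simp add: q_def powr_diff)
    qed
    have F2: "exp (ln ((Vmax T + 2 * Sep T) / Sep T) * (2 * real m + real m * real (Rad T) / real (Loc T)))
        \<le> exp (3 * \<kappa> * l * (2 * m + m * (2 * T powr q)))"
    proof -
      have "ln ((Vmax T + 2 * Sep T) / Sep T) \<le> 3 * \<kappa> * l" "0 \<le> ln ((Vmax T + 2 * Sep T) / Sep T)"
        using ratio by (auto simp: l_def)
      moreover have "real m * real (Rad T) / real (Loc T) \<le> m * (2 * T powr q)"
        using mult_left_mono[OF RL, of "real m"] by simp
      moreover have "0 \<le> 3 * \<kappa> * l" using kappa_bounds l1 by simp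
      ultimately show ?thesis by (subst exp_le_cancel_iff, intro mult_mono add_left_mono) auto
    qed
    have F3: "(1 / (1 - Eps T)) ^ Rad T \<le> exp (4 * T powr q)"
    proof -
      have "(1 / (1 - Eps T)) ^ Rad T \<le> exp (2 * Eps T) ^ Rad T"
        using e by (intro power_mono inverse_one_minus_le_exp) auto
      also have "\<dots> = exp (2 * Eps T * Rad T)" by (simp add: exp_of_nat2_mult)
      also have "Eps T * Rad T \<le> Eps T * (2 * T powr (1 + \<rho> + \<nu>))" using e R by (intro mult_left_mono) auto
      then have "exp (2 * Eps T * Rad T) \<le> exp (4 * (Eps T * T powr (1 + \<rho> + \<nu>)))" by simp
      also have "Eps T * T powr (1 + \<rho> + \<nu>) = T powr q" by (simp add: Eps_def q_def powr_add[symmetric])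
      finally show ?thesis .
    qed
    have F4: "2 * (2 * real (Rad T) + 1) ^ d * (exp 1 * (real (Rad T) + 1)) ^ d \<le> exp (ln 2 + 2 * real d * (ln 15 + (1 + \<rho> + \<nu>) * l))"
    proof -
      let ?P = "T powr (1 + \<rho> + \<nu>)"
      have P1: "1 \<le> ?P" using T1 rho_pos nu_bounds by (intro ge_one_powr_ge_zero) auto
      have h1: "2 * real (Rad T) + 1 \<le> 15 * ?P" using R P1 by linarith
      have h2: "exp 1 * (real (Rad T) + 1) \<le> 15 * ?P"
      proof -
        have "exp 1 * (real (Rad T) + 1) \<le> 3 * (real (Rad T) + 1)" using exp_le by (intro mult_right_mono) auto
        also have "real (Rad T) + 1 \<le> 5 * ?P" using R P1 by linarith
        then have "3 * (real (Rad T) + 1) \<le> 3 * (5 * ?P)" by (rule mult_left_mono) simp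
        finally show ?thesis by simp
      qed
      have "(2 * real (Rad T) + 1) ^ d * (exp 1 * (real (Rad T) + 1)) ^ d \<le> (15 * ?P) ^ d * (15 * ?P) ^ d"
        by (rule mult_mono[OF power_mono[OF h1] power_mono[OF h2]]) simp_all
      then have "2 * (2 * real (Rad T) + 1) ^ d * (exp 1 * (real (Rad T) + 1)) ^ d \<le> 2 * (15 * ?P) ^ d * (15 * ?P) ^ d"
        by (simp only: mult.assoc mult_left_mono zero_le_numeral)
      also have "\<dots> = 2 * (15 * ?P) ^ (2 * d)"       proof -
        have "x ^ d * x ^ d = x ^ (2 * d)" for x :: real by (simp only: mult_2 power_add)
        then show ?thesis by (simp only: mult.assoc)
      qed
      also have "\<dots> = 2 * exp (ln 15 + (1 + \<rho> + \<nu>) * l) ^ (2 * d)"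
      proof -
        have "15 * ?P = exp (ln 15) * exp ((1 + \<rho> + \<nu>) * l)" unfolding pw by simp
        then show ?thesis by (simp only: exp_add)
      qed
      also have "\<dots> = exp (ln 2 + 2 * real d * (ln 15 + (1 + \<rho> + \<nu>) * l))"
      proof -
        have "2 * exp a ^ (2 * d) = exp (ln 2 + real (2 * d) * a)" for a :: real
          by (simp only: exp_add exp_of_nat_mult exp_ln zero_less_numeral)
        then show ?thesis by simp
      qed
      finally show ?thesis .
    qed
    have "2 * (2 * real (Rad T) + 1) ^ d * path_error d (Sep T) m (Loc T) (Rad T) (Eps T) (Vmax T) =
       (4 * (Vmax T + 2 * Sep T)\<^sup>2 / (Eps T * (Sep T)\<^sup>2))
       * exp (ln ((Vmax T + 2 * Sep T) / Sep T) * (2 * real m + real m * real (Rad T) / real (Loc T)))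
       * (1 / (1 - Eps T)) ^ Rad T * (2 * (2 * real (Rad T) + 1) ^ d * (exp 1 * (real (Rad T) + 1)) ^ d)"
      unfolding path_error_def by (simp only: mult_ac)
    also have "\<dots> \<le> exp (ln 4 + 9 * \<kappa> * l) * exp (3 * \<kappa> * l * (2 * m + m * (2 * T powr q))) * exp (4 * T powr q)
       * exp (ln 2 + 2 * real d * (ln 15 + (1 + \<rho> + \<nu>) * l))"
      using e g0 by (intro mult_mono F1 F2 F3 F4) (auto intro!: mult_nonneg_nonneg divide_nonneg_nonneg)
    also have "\<dots> = exp (ln 4 + 9 * \<kappa> * l + 3 * \<kappa> * l * (2 * m + m * (2 * T powr q)) + 4 * T powr q
       + (ln 2 + 2 * real d * (ln 15 + (1 + \<rho> + \<nu>) * l)))" by (simp only: exp_add)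
    also have "\<dots> \<le> exp (C * (l * T powr q))"
    proof -
      let ?x = "l * T powr q"
      have x: "1 \<le> ?x" "l \<le> ?x" "T powr q \<le> ?x"
        using l1 pq1 mult_mono[of 1 l 1 "T powr q"] mult_left_mono[of 1 "T powr q" l] mult_right_mono[of 1 l "T powr q"] by auto
      have "ln 4 * 1 \<le> ln 4 * ?x" "ln 2 * 1 \<le> ln 2 * ?x" "2 * real d * ln 15 * 1 \<le> 2 * real d * ln 15 * ?x"
        "9 * \<kappa> * l \<le> 9 * \<kappa> * ?x" "6 * \<kappa> * m * l \<le> 6 * \<kappa> * m * ?x" "2 * real d * (1 + \<rho> + \<nu>) * l \<le> 2 * real d * (1 + \<rho> + \<nu>) * ?x"
        using x kappa_bounds rho_pos nu_bounds by (intro mult_left_mono; simp)+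
      moreover have "ln 4 + 9 * \<kappa> * l + 3 * \<kappa> * l * (2 * m + m * (2 * T powr q)) + 4 * T powr q
          + (ln 2 + 2 * real d * (ln 15 + (1 + \<rho> + \<nu>) * l)) =
          ln 4 * 1 + 9 * \<kappa> * l + 6 * \<kappa> * m * l + 6 * \<kappa> * m * ?x + 4 * T powr q + ln 2 * 1
          + 2 * real d * ln 15 * 1 + 2 * real d * (1 + \<rho> + \<nu>) * l"
        by (simp add: algebra_simps)
      moreover have "C * ?x = ln 4 * ?x + 9 * \<kappa> * ?x + 6 * \<kappa> * m * ?x + 6 * \<kappa> * m * ?x + 4 * ?x + ln 2 * ?x
          + 2 * real d * ln 15 * ?x + 2 * real d * (1 + \<rho> + \<nu>) * ?x"
        by (simp add: C_def algebra_simps)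
      ultimately show ?thesis using x(3) unfolding exp_le_cancel_iff by linarith
    qed
    also have "\<dots> \<le> exp (Gap T / 8)" using elim(1) by (simp add: Gap_def l_def)
    finally show ?case .
  qed
qed

lemma eventually_scale_conditions:
  fixes D \<epsilon>0 :: real and m :: nat
  assumes "\<epsilon>0 > 0"
  shows "\<forall>\<^sub>F T in at_top. T \<ge> 1 \<and> 4 * D \<le> Sep T \<and> Base T \<le> Sep T \<and> Eps T < 1 \<and>
    2 * D \<le> Eps T * (Sep T * exp (- (ln ((Vmax T + 2 * Sep T) / Sep T) * m / Loc T))) \<and>
    D \<le> ln (Base T) \<and> T * Base T \<le> Top T / 2 \<and> 4 \<le> Top T \<and> 2 * Gap T \<le> Top T \<and>
    16 * D / Sep T + exp (Gap T / 8) * exp (- Gap T / 4) + 2 * exp (- Top T) \<le> \<epsilon>0 \<and> 0 \<le> Gap T"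
proof -
  have ev1: "\<forall>\<^sub>F T in at_top. max (64 * D) (16 * (48 * D / \<epsilon>0 + 1)) \<le> T powr (\<rho> - \<kappa>)"
    using rho_pos kappa_bounds by (intro eventually_const_le_powr) auto
  have ev2: "\<forall>\<^sub>F T in at_top. 16 * T powr (\<rho> - 2 * \<kappa>) \<le> T powr (\<rho> - \<kappa>)"
    using kappa_bounds by (intro eventually_powr_le) auto
  have ev3: "\<forall>\<^sub>F T in at_top. 2 \<le> T powr (3 * \<kappa>)"
    using kappa_bounds by (intro eventually_const_le_powr) auto
  have ev4: "\<forall>\<^sub>F T in at_top. max 1 (exp D) \<le> T powr (\<rho> - 2 * \<kappa>)"
    using kappa_bounds rho_pos by (intro eventually_const_le_powr) auto
  have ev5: "\<forall>\<^sub>F T in at_top. 2 * T powr (1 + \<rho> - 2 * \<kappa>) \<le> T powr (1 + \<rho> - \<nu>)"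
    using kappa_bounds nu_bounds by (intro eventually_powr_le) auto
  have ev6: "\<forall>\<^sub>F T in at_top. max 4 (6 / \<epsilon>0) \<le> T powr (1 + \<rho> - \<nu>)"
    using kappa_bounds nu_bounds rho_pos by (intro eventually_const_le_powr) auto
  have ev7: "\<forall>\<^sub>F T in at_top. 2 * T powr (1 + \<rho> - \<kappa>) \<le> T powr (1 + \<rho> - \<nu>)"
    using kappa_bounds nu_bounds by (intro eventually_powr_le) auto
  have ev8: "\<forall>\<^sub>F T in at_top. 34 * T powr (\<eta> * \<nu> + \<kappa>) \<le> T powr (3 * \<kappa>)"
    using eta_nu nu_bounds kappa_bounds by (intro eventually_powr_le) linarith
  have ev9: "\<forall>\<^sub>F T in at_top. (3 * \<kappa> * m) * (ln T * T powr 0) \<le> T powr (3 * \<kappa>)"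
    using kappa_bounds by (intro eventually_ln_powr_le) auto
  have ev10: "\<forall>\<^sub>F T in at_top. 96 * D \<le> T powr (\<rho> - 4 * \<kappa>)"
    using kappa_bounds rho_pos by (intro eventually_const_le_powr) auto
  have ev11: "\<forall>\<^sub>F T in at_top. 24 / \<epsilon>0 \<le> T powr (1 + \<rho> - \<kappa>)"
    using kappa_bounds rho_pos by (intro eventually_const_le_powr) auto
  show ?thesis
    using ev1 ev2 ev3 ev4 ev5 ev6 ev7 ev8 ev9 ev10 ev11 eventually_ge_at_top[of "1 :: real"]
  proof eventually_elim
    case (elim T)
    note T1 = elim(12)
    have T0: "T > 0" using T1 by linarith
    have small: "exp (- x) \<le> e" if "1 / e \<le> x" "e > 0" for x e :: real
    proof -
      have "1 / e \<le> exp x" using that exp_ge_add_one_self[of x] by linarith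
      then show ?thesis using that by (simp add: exp_minus field_simps)
    qed
    have S1: "4 * D \<le> Sep T" and S2: "16 * D / Sep T \<le> \<epsilon>0 / 3"
    proof -
      show "4 * D \<le> Sep T" using elim(1) by (simp add: Sep_def)
      have s: "48 * D / \<epsilon>0 + 1 \<le> Sep T" "Sep T > 0" using elim(1) T0 by (auto simp: Sep_def)
      then have "48 * D \<le> Sep T * \<epsilon>0" using assms by (simp add: field_simps)
      then show "16 * D / Sep T \<le> \<epsilon>0 / 3" using s by (simp add: field_simps)
    qed
    have S3: "Base T \<le> Sep T" using elim(2) by (simp add: Base_def Sep_def)
    have S4: "Eps T < 1" using elim(3) T0 by (simp add: Eps_def powr_minus field_simps)
    have S5: "D \<le> ln (Base T)"
    proof -
      have "exp D \<le> Base T" using elim(4) by (simp add: Base_def)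
      then show ?thesis using T0 by (subst ln_ge_iff) (auto simp: Base_def)
    qed
    have S6: "T * Base T \<le> Top T / 2"
      using elim(5) T0 by (simp add: Base_def Top_def powr_mult_base add_diff_eq mult.commute)
    have S7: "4 \<le> Top T" "2 * Gap T \<le> Top T" using elim(6,7) by (auto simp: Top_def Gap_def)
    have S8: "2 * exp (- Top T) \<le> \<epsilon>0 / 3"
      using small[of "\<epsilon>0 / 6" "Top T"] elim(6) assms by (simp add: Top_def)
    have S9: "exp (Gap T / 8) * exp (- Gap T / 4) \<le> \<epsilon>0 / 3"
    proof -
      have "exp (Gap T / 8) * exp (- Gap T / 4) = exp (- (Gap T / 8))" by (simp add: exp_add[symmetric])
      also have "\<dots> \<le> \<epsilon>0 / 3" using small[of "\<epsilon>0 / 3" "Gap T / 8"] elim(11) assms by (simp add: Gap_def)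
      finally show ?thesis .
    qed
    have S10: "2 * D \<le> Eps T * (Sep T * exp (- (ln ((Vmax T + 2 * Sep T) / Sep T) * m / Loc T)))"
    proof -
      have g0: "Sep T > 0" using T0 by (simp add: Sep_def)
      have "ln ((Vmax T + 2 * Sep T) / Sep T) \<le> 3 * \<kappa> * ln T" by (rule Vmax_Sep_ratio[OF T1 elim(8)])
      then have "ln ((Vmax T + 2 * Sep T) / Sep T) * m / Loc T \<le> (3 * \<kappa> * ln T) * m / Loc T"
        by (intro divide_right_mono mult_right_mono) auto
      also have "\<dots> \<le> (3 * \<kappa> * ln T) * m / T powr (3 * \<kappa>)"
        using Loc_bounds(1)[OF T1] T1 kappa_bounds T0 less_le_trans[OF _ Loc_bounds(1)[OF T1], of 0]
          by (intro divide_left_mono mult_nonneg_nonneg mult_pos_pos) auto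
      also have "\<dots> \<le> 1" using elim(9) T0 by (simp add: mult_ac)
      finally have "exp (- 1) \<le> exp (- (ln ((Vmax T + 2 * Sep T) / Sep T) * m / Loc T))" by simp
      moreover have "1 / 3 \<le> exp (- 1 :: real)" using exp_le by (simp add: exp_minus field_simps)
      ultimately have ex: "1 / 3 \<le> exp (- (ln ((Vmax T + 2 * Sep T) / Sep T) * m / Loc T))" by linarith
      have "2 * D \<le> T powr (\<rho> - 4 * \<kappa>) / 48" using elim(10) by simp
      also have "\<dots> = Eps T * (Sep T * (1 / 3))"
        by (simp add: Eps_def Sep_def powr_add[symmetric])
      also have "\<dots> \<le> Eps T * (Sep T * exp (- (ln ((Vmax T + 2 * Sep T) / Sep T) * m / Loc T)))"
        using ex g0 by (intro mult_left_mono) (auto simp: Eps_def)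
      finally show ?thesis .
    qed
    show ?case using T1 S1 S2 S3 S4 S5 S6 S7 S8 S9 S10 by (auto simp: Gap_def)
  qed
qed

end

sublocale pareto_potential \<subseteq> scales "CARD('d)" \<alpha>
  by unfold_locales (use alpha in \<open>auto simp: Suc_leI\<close>)

section \<open>Concentration for a fixed potential of controlled growth\<close>

context pareto_potential begin

text \<open>Beyond the box \<open>M\<close> is \<open>n powr \<theta>\<close>: since \<open>(1 +
  \<rho> + \<nu>) * (1 - \<theta>) = 1 + \<nu> - \<eta> * \<nu>\<close> exceeds \<open>1\<close>,
  the time \<open>T\<close> is negligible against \<open>n powr (1 - \<theta>)\<close>. The finitely
  many sites without the growth bound are absorbed by the constant \<open>c\<close>.\<close>

lemma eventually_growth_conditions:
  fixes V :: "int ^ 'd \<Rightarrow> real"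
  assumes growth: "\<And>z. N0 \<le> norm1 z \<Longrightarrow> V z \<le> norm1 z powr \<theta>"
  shows "\<forall>\<^sub>F T in at_top. (\<forall>z\<in>lball 0 (Rad T). V z \<le> Vmax T) \<and>
    (\<forall>n>Rad T. \<exists>M\<ge>6 * deg TYPE('d). (\<forall>z\<in>lball 0 n. V z \<le> M) \<and> 6 * T * M \<le> n)"
proof -
  define c where "c = Max (V ` lball 0 N0)"
  have c: "V z \<le> c" if "norm1 z \<le> N0" for z
  proof -
    have "z \<in> lball 0 N0" using that by (simp add: lball_def)
    then show ?thesis unfolding c_def by (intro Max_ge finite_imageI finite_lball imageI)
  qed
  obtain x0 where x0: "\<And>x. x0 \<le> x \<Longrightarrow> max c (6 * deg TYPE('d)) \<le> x powr \<theta>"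
    using eventually_const_le_powr[OF theta_bounds(1), of "max c (6 * deg TYPE('d))"]
    by (auto simp: eventually_at_top_linorder)
  have ball: "(\<forall>z\<in>lball 0 n. V z \<le> real n powr \<theta>) \<and> 6 * deg TYPE('d) \<le> real n powr \<theta>" if n: "x0 \<le> real n" for n
  proof (intro conjI ballI)
    show "6 * deg TYPE('d) \<le> real n powr \<theta>" using x0[OF n] by simp
    fix z :: "int ^ 'd" assume z: "z \<in> lball 0 n"
    show "V z \<le> real n powr \<theta>"
    proof (cases "N0 \<le> norm1 z")
      case True
      have "V z \<le> norm1 z powr \<theta>" by (rule growth[OF True])
      also have "\<dots> \<le> real n powr \<theta>" using z theta_bounds by (intro powr_mono2) (auto simp: lball_def)
      finally show ?thesis .
    next
      case False
      then show ?thesis using c[of z] x0[OF n] by simp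
    qed
  qed
  have "\<forall>\<^sub>F T in at_top. 6 * T powr 1 \<le> T powr (1 + \<nu> - \<eta> * \<nu>)"
    using eta_nu by (intro eventually_powr_le) auto
  then show ?thesis using eventually_ge_at_top[of "max 1 x0"]
  proof eventually_elim
    case (elim T)
    then have T1: "T \<ge> 1" and Tx: "T \<ge> x0" by auto
    have "T powr 1 \<le> T powr (1 + \<rho> + \<nu>)" using T1 rho_pos nu_bounds by (intro powr_mono) auto
    then have TR: "T \<le> real (Rad T)" using Rad_bounds(1)[OF T1] T1 by simp
    show ?case
    proof (intro conjI ballI allI impI)
      fix z :: "int ^ 'd" assume z: "z \<in> lball 0 (Rad T)"
      have "V z \<le> real (Rad T) powr \<theta>" using ball[of "Rad T"] TR Tx z by auto
      also have "\<dots> \<le> (2 * T powr (1 + \<rho> + \<nu>)) powr \<theta>"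
        using Rad_bounds(2)[OF T1] theta_bounds by (intro powr_mono2) auto
      also have "\<dots> = 2 powr \<theta> * T powr (\<rho> + \<eta> * \<nu>)"
        by (simp add: powr_mult powr_powr theta_eq mult.commute)
      also have "2 powr \<theta> \<le> 2 powr (1::real)" using theta_bounds by (intro powr_mono) auto
      then have "2 powr \<theta> * T powr (\<rho> + \<eta> * \<nu>) \<le> Vmax T" unfolding Vmax_def by (intro mult_right_mono) auto
      finally show "V z \<le> Vmax T" .
    next
      fix n assume n: "n > Rad T"
      have nT: "T powr (1 + \<rho> + \<nu>) \<le> real n" using Rad_bounds(1)[OF T1] n by linarith
      have n0: "real n > 0" using n by simp
      have "6 * T \<le> T powr (1 + \<nu> - \<eta> * \<nu>)" using elim(1) T1 by simp
      also have "1 + \<nu> - \<eta> * \<nu> = (1 + \<rho> + \<nu>) * (1 - \<theta>)" using theta_eq by (simp add: algebra_simps)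
      also have "T powr ((1 + \<rho> + \<nu>) * (1 - \<theta>)) = (T powr (1 + \<rho> + \<nu>)) powr (1 - \<theta>)" by (simp add: powr_powr)
      also have "\<dots> \<le> real n powr (1 - \<theta>)" using nT theta_bounds by (intro powr_mono2) auto
      finally have "6 * T * real n powr \<theta> \<le> real n powr (1 - \<theta>) * real n powr \<theta>" by (intro mult_right_mono) auto
      also have "\<dots> = real n" using n0 by (simp add: powr_add[symmetric])
      finally have "6 * T * real n powr \<theta> \<le> real n" .
      moreover have "x0 \<le> real n" using TR Tx n by linarith
      ultimately show "\<exists>M\<ge>6 * deg TYPE('d). (\<forall>z\<in>lball 0 n. V z \<le> M) \<and> 6 * T * M \<le> n" using ball[of n] by blast
    qed
  qed
qed

lemma peak_value_shift: "peak_value V b t w = peak_value V b T w + (t - T) * V w"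
  by (simp add: peak_value_def algebra_simps)

text \<open>The solution is taken at time \<open>t\<close>, but peak values are compared at the
  earlier time \<open>T\<close>. Until \<open>t\<close> no competitor in the box gains more than
  \<open>(t - T) * Vmax T\<close>, so half of the gap survives.\<close>

lemma eventually_concentration:
  fixes V :: "int ^ 'd \<Rightarrow> real" and m :: nat
  assumes V1: "\<And>z. 1 \<le> V z" and growth: "\<forall>z. N0 \<le> norm1 z \<longrightarrow> V z \<le> norm1 z powr \<theta>" and \<epsilon>0: "\<epsilon>0 > 0"
  shows "\<forall>\<^sub>F T in at_top. \<forall>t W S z1 F. T \<le> t \<longrightarrow> t \<le> 2 * T \<longrightarrow> (t - T) * Vmax T \<le> Gap T / 2 \<longrightarrow>
     (\<forall>x\<in>lball 0 (Rad T). card (lball x (Loc T) \<inter> {y. Base T < V y}) \<le> m) \<longrightarrow>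
     (\<forall>z. (\<lambda>k. t ^ k / fact k * path_weight V k z) sums W z) \<longrightarrow>
     finite S \<longrightarrow> card S \<le> 2 \<longrightarrow> z1 \<in> S \<longrightarrow> S \<subseteq> lball 0 (Rad T) \<longrightarrow> Top T \<le> peak_value V (Base T) T z1 \<longrightarrow>
     (\<forall>w\<in>lball 0 (Rad T). w \<notin> S \<longrightarrow> peak_value V (Base T) T w + Gap T \<le> peak_value V (Base T) T z1) \<longrightarrow>
     finite F \<longrightarrow> F \<inter> S = {} \<longrightarrow> (\<Sum>y\<in>F. W y) \<le> \<epsilon>0 * (\<Sum>z\<in>S. W z)"
proof -
  let ?d = "deg TYPE('d)"
  define D where "D = ?d + ln ?d + 4"
  have d2: "?d \<ge> 2" by (rule deg_ge_2)
  have lnd: "ln ?d \<ge> 0" using d2 by simp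
  have D: "?d \<le> D" "ln ?d + 4 \<le> D" using d2 lnd by (auto simp: D_def)
  obtain n0 where n0: "\<And>n. n0 \<le> n \<Longrightarrow> 9 * (2 * real n + 1) ^ CARD('d) \<le> 2 ^ n"
    using eventually_poly_le_power2[of 9 "CARD('d)"] by (auto simp: eventually_sequentially)
  have ev: "\<forall>\<^sub>F T in at_top. (\<forall>z\<in>lball 0 (Rad T). V z \<le> Vmax T) \<and>
    (\<forall>n>Rad T. \<exists>M\<ge>6 * ?d. (\<forall>z\<in>lball 0 n. V z \<le> M) \<and> 6 * T * M \<le> n)"
    by (rule eventually_growth_conditions[of N0 V]) (rule growth[rule_format])
  show ?thesis
    using ev eventually_scale_conditions[OF \<epsilon>0, of D m]
      eventually_path_error_le[of m] eventually_ge_at_top[of "max 1 (real n0)"]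
  proof eventually_elim
    case (elim T)
    have T1: "T \<ge> 1" and Tn: "real n0 \<le> T" using elim(4) by auto
    have T0: "T > 0" using T1 by linarith
    have b0: "Base T > 0" using T0 by (simp add: Base_def)
    have g0: "Sep T > 0" using T0 by (simp add: Sep_def)
    have lnb: "ln ?d + 4 \<le> ln (Base T)" using elim(2) D by auto
    have SG: "4 * T * Sep T = Gap T / 4"
      using T0 by (simp add: Sep_def Gap_def powr_mult_base algebra_simps)
    show ?case
    proof (intro allI impI)
      fix t W S z1 F
      assume t: "T \<le> t" "t \<le> 2 * T" "(t - T) * Vmax T \<le> Gap T / 2"
        and sparse: "\<forall>x\<in>lball 0 (Rad T). card (lball x (Loc T) \<inter> {y. Base T < V y}) \<le> m"
        and W: "\<forall>z. (\<lambda>k. t ^ k / fact k * path_weight V k z) sums W z"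
        and S: "finite S" "card S \<le> 2" "z1 \<in> S" "S \<subseteq> lball 0 (Rad T)" and top: "Top T \<le> peak_value V (Base T) T z1"
        and gap: "\<forall>w\<in>lball 0 (Rad T). w \<notin> S \<longrightarrow> peak_value V (Base T) T w + Gap T \<le> peak_value V (Base T) T z1"
        and F: "finite F" "F \<inter> S = {}"
      have V0: "0 \<le> V z" for z using V1[of z] by linarith
      have pk: "peak_value V (Base T) T z1 + 4 * norm1 z1 \<le> T * V z1"
        unfolding peak_value_eq by (rule peak_fun_le[OF lnb b0])
      have mono: "peak_value V (Base T) T z1 \<le> peak_value V (Base T) t z1"
        using t V0 by (simp add: peak_value_shift[of V "Base T" t z1 T])
      let ?E = "2 * (2 * real (Rad T) + 1) ^ CARD('d) * path_error CARD('d) (Sep T) m (Loc T) (Rad T) (Eps T) (Vmax T)"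
      have "(\<Sum>y\<in>F. W y) \<le> (16 * ?d / Sep T + ?E * exp (2 * Sep T * t - Gap T / 2) + 2 * exp (- peak_value V (Base T) t z1)) * (\<Sum>z\<in>S. W z)"
      proof (rule mass_concentration[where \<psi> = "Base T" and b = "Base T"])
        show "V z \<le> Vmax T" if "z \<in> lball 0 (Rad T)" for z using elim(1) that by blast
        show "card (lball x (Loc T) \<inter> {y. Base T < V y}) \<le> m" if "x \<in> lball 0 (Rad T)" for x
          using sparse that by blast
        show "1 \<le> Loc T" using Loc_bounds(1)[OF T1] ge_one_powr_ge_zero[OF T1, of "3 * \<kappa>"] kappa_bounds by linarith
        show "4 * ?d \<le> Sep T" using elim(2) D by linarith
        show "2 * ?d \<le> Eps T * (Sep T * exp (- (ln ((Vmax T + 2 * Sep T) / Sep T) * m / Loc T)))"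
          using elim(2) D by linarith
        show "0 < Eps T" using T0 by (simp add: Eps_def)
        show "\<exists>M\<ge>6 * ?d. (\<forall>z\<in>lball 0 n. V z \<le> M) \<and> 3 * t * M \<le> n" if n: "n > Rad T" for n
        proof -
          obtain M where M: "6 * ?d \<le> M" "\<forall>z\<in>lball 0 n. V z \<le> M" "6 * T * M \<le> n" using elim(1) n by blast
          have "3 * t * M \<le> 6 * T * M" using t M(1) d2 by (intro mult_right_mono) auto
          then have "3 * t * M \<le> n" using M(3) by linarith
          then show ?thesis using M(1,2) by blast
        qed
        show "9 * (2 * real n + 1) ^ CARD('d) \<le> 2 ^ n" if n: "n > Rad T" for n
        proof -
          have "T powr 1 \<le> T powr (1 + \<rho> + \<nu>)" using T1 rho_pos nu_bounds by (intro powr_mono) auto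
          then have "T \<le> real (Rad T)" using Rad_bounds(1)[OF T1] T1 by simp
          then show ?thesis using n Tn by (intro n0) linarith
        qed
        show "peak_value V (Base T) t w + Gap T / 2 \<le> peak_value V (Base T) t z1" if w: "w \<in> lball 0 (Rad T)" "w \<notin> S" for w
        proof -
          have "(t - T) * V w \<le> (t - T) * Vmax T" using t elim(1) w by (intro mult_left_mono) auto
          then have "peak_value V (Base T) t w \<le> peak_value V (Base T) T w + Gap T / 2"
            using t(3) by (simp add: peak_value_shift[of V "Base T" t w T])
          then show ?thesis using gap w mono by fastforce
        qed
        have "T * Base T \<le> T * V z1" using pk top elim(2) by linarith
        then show "Base T \<le> V z1" using T0 by simp
        have "2 * (real (norm1 z1) + 1) \<le> T * V z1"
        proof -
          have "4 * real (norm1 z1) \<le> T * V z1" "4 \<le> T * V z1" using pk top elim(2) by linarith+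
          then show ?thesis unfolding distrib_left by linarith
        qed
        also have "T * V z1 \<le> t * V z1" using t V0 by (intro mult_right_mono) auto
        finally show "2 * (real (norm1 z1) + 1) \<le> t * V z1" .
      qed (use V0 elim(2) b0 t T0 W S F in auto)
      also have "\<dots> \<le> \<epsilon>0 * (\<Sum>z\<in>S. W z)"
      proof (rule mult_right_mono)
        have "?E * exp (2 * Sep T * t - Gap T / 2) \<le> exp (Gap T / 8) * exp (- Gap T / 4)"
        proof (intro mult_mono)
          show "?E \<le> exp (Gap T / 8)" by (rule elim(3))
          have "2 * Sep T * t \<le> 2 * Sep T * (2 * T)" using t g0 by (intro mult_left_mono) auto
          then have "2 * Sep T * t \<le> 4 * T * Sep T" by (simp add: mult_ac)
          then have "2 * Sep T * t - Gap T / 2 \<le> - Gap T / 4" using SG by linarith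
          then show "exp (2 * Sep T * t - Gap T / 2) \<le> exp (- Gap T / 4)" by simp
        qed auto
        moreover have "2 * exp (- peak_value V (Base T) t z1) \<le> 2 * exp (- Top T)" using mono top by simp
        moreover have "16 * ?d / Sep T \<le> 16 * D / Sep T" using D g0 by (intro divide_right_mono) auto
        ultimately show "16 * ?d / Sep T + ?E * exp (2 * Sep T * t - Gap T / 2) + 2 * exp (- peak_value V (Base T) t z1) \<le> \<epsilon>0"
          using elim(2) by linarith
        have "0 \<le> W z" for z
        proof (rule sums_le[OF _ sums_zero W[rule_format, of z]])
          show "0 \<le> t ^ k / fact k * path_weight V k z" for k
            using t T0 path_weight_nonneg[of V k z, OF V0] by (intro mult_nonneg_nonneg) auto
        qed
        then show "0 \<le> (\<Sum>z\<in>S. W z)" by (intro sum_nonneg)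
      qed
      finally show "(\<Sum>y\<in>F. W y) \<le> \<epsilon>0 * (\<Sum>z\<in>S. W z)" .
    qed
  qed
qed

end

section \<open>Almost sure properties of the potential\<close>

context pareto_potential begin

text \<open>Borel-Cantelli over dyadic balls; the decay rate
  \<open>2 powr (CARD('d) - \<theta> * \<alpha>)\<close> is below \<open>1\<close> by
  \<open>theta_alpha\<close>.\<close>

lemma AE_growth: "AE \<omega> in M. \<exists>N0. \<forall>z. N0 \<le> norm1 z \<longrightarrow> \<xi> z \<omega> \<le> norm1 z powr \<theta>"
proof -
  define A where "A n = hits 1 (lball 0 (2 ^ (n + 1))) (\<lambda>_. {2 powr (real n * \<theta>)..})" for n
  have meas: "A n \<in> events" for n unfolding A_def by (intro sets_hits) auto
  have prob_A: "prob (A n) \<le> 5 ^ CARD('d) * (2 powr (real CARD('d) - \<theta> * \<alpha>)) ^ n" for n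
  proof -
    have one: "1 \<le> 2 powr (real n * \<theta>)" using theta_bounds by (intro ge_one_powr_ge_zero) auto
    have "prob (A n) \<le> (real (card (lball (0 :: int ^ 'd) (2 ^ (n + 1)))) * (2 powr (real n * \<theta>)) powr (-\<alpha>)) ^ 1"
      unfolding A_def
    proof (rule prob_hits_le)
      show "prob {\<omega> \<in> space M. \<xi> z \<omega> \<in> {2 powr (real n * \<theta>)..}} \<le> (2 powr (real n * \<theta>)) powr - \<alpha>" for z
        using prob_ge[OF one, of z] by simp
    qed auto
    also have "\<dots> \<le> (5 * 2 ^ n) ^ CARD('d) * 2 powr (- (real n * \<theta> * \<alpha>))"
    proof -
      have "real (card (lball (0 :: int ^ 'd) (2 ^ (n + 1)))) \<le> real ((2 * 2 ^ (n + 1) + 1) ^ CARD('d))"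
        by (rule of_nat_mono[OF card_lball_le])
      also have "\<dots> = (4 * 2 ^ n + 1) ^ CARD('d)" by (simp add: add.commute)
      also have "\<dots> \<le> (5 * 2 ^ n) ^ CARD('d)" by (intro power_mono) auto
      finally show ?thesis by (simp add: powr_powr mult_right_mono)
    qed
    also have "\<dots> = 5 ^ CARD('d) * (2 powr (real CARD('d) - \<theta> * \<alpha>)) ^ n"
    proof -
      have "(2 ^ n) ^ CARD('d) * 2 powr (- (real n * \<theta> * \<alpha>)) = 2 powr (real n * CARD('d) - real n * \<theta> * \<alpha>)"
        by (simp add: powr_realpow[symmetric] powr_powr powr_diff powr_minus divide_inverse flip: powr_realpow)
      also have "\<dots> = (2 powr (real CARD('d) - \<theta> * \<alpha>)) ^ n"
        by (simp add: powr_realpow[symmetric] powr_powr algebra_simps)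
      finally show ?thesis by (simp add: power_mult_distrib mult.assoc)
    qed
    finally show ?thesis .
  qed
  have summ: "summable (\<lambda>n. prob (A n))"
  proof (rule summable_comparison_test[OF _ summable_mult])
    show "\<exists>N. \<forall>n\<ge>N. norm (prob (A n)) \<le> 5 ^ CARD('d) * (2 powr (real CARD('d) - \<theta> * \<alpha>)) ^ n"
      using prob_A by auto
    show "summable ((^) (2 powr (real CARD('d) - \<theta> * \<alpha>)))"
      using theta_alpha by (intro summable_geometric) (simp add: powr_less_one)
  qed
  have "AE \<omega> in M. \<forall>\<^sub>F n in sequentially. \<omega> \<in> space M - A n"
    by (rule borel_cantelli_AE1[OF meas _ summ]) (simp add: emeasure_eq_measure)
  then show ?thesis
  proof eventually_elim
    case (elim \<omega>)
    then obtain N where N: "\<And>n. N \<le> n \<Longrightarrow> \<omega> \<in> space M - A n" by (auto simp: eventually_sequentially)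
    show ?case
    proof (intro exI[of _ "2 ^ N"] allI impI)
      fix z :: "int ^ 'd" assume z: "2 ^ N \<le> norm1 z"
      then have "1 \<le> norm1 z" using one_le_power[of "2 :: nat" N] by linarith
      then obtain n where n: "2 ^ n \<le> norm1 z" "norm1 z < 2 ^ (n + 1)"
        using ex_power_ivl1[of 2 "norm1 z"] by auto
      have "(2::nat) ^ N < 2 ^ (n + 1)" using z n by linarith
      then have "N < n + 1" by (rule power_less_imp_less_exp[rotated]) simp
      then have "\<omega> \<in> space M" "\<omega> \<notin> A n" using N[of n] by auto
      then have "\<not> (\<exists>A'\<subseteq>lball 0 (2 ^ (n + 1)). card A' = 1 \<and> (\<forall>z\<in>A'. \<xi> z \<omega> \<in> {2 powr (real n * \<theta>)..}))"
        by (simp add: A_def hits_def)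
      moreover have "{z} \<subseteq> lball 0 (2 ^ (n + 1))" using n by (simp add: lball_def)
      ultimately have "\<xi> z \<omega> < 2 powr (real n * \<theta>)"
        by (metis atLeast_iff is_singletonI is_singleton_altdef not_less singletonD)
      also have "\<dots> = (2 ^ n) powr \<theta>" by (simp add: powr_realpow[symmetric] powr_powr)
      also have "\<dots> \<le> norm1 z powr \<theta>"
        using n(1) theta_bounds by (intro powr_mono2) (auto simp: numeral_power_le_of_nat_cancel_iff)
      finally show "\<xi> z \<omega> \<le> norm1 z powr \<theta>" by simp
    qed
  qed
qed

section \<open>Almost sure properties along the time grid\<close>

definition grid :: "nat \<Rightarrow> real" where "grid j = real j powr \<beta>"

lemma beta_pos: "\<beta> > 0" using kappa_bounds by (simp add: \<beta>_def)

lemma filterlim_grid: "filterlim grid at_top sequentially"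
proof (rule filterlim_compose[OF _ filterlim_real_sequentially, where g = "\<lambda>x. x powr \<beta>", folded grid_def])
  show "filterlim (\<lambda>x::real. x powr \<beta>) at_top at_top"
    unfolding filterlim_at_top using eventually_const_le_powr[OF beta_pos] by blast
qed

lemma AE_eventually_grid:
  assumes meas: "\<And>T. A T \<in> events" and bound: "\<forall>\<^sub>F T in at_top. prob (A T) \<le> C * T powr (- e)" and e: "e * \<beta> > 1"
  shows "AE \<omega> in M. \<forall>\<^sub>F j in sequentially. \<omega> \<notin> A (grid j)"
proof -
  have ev: "\<forall>\<^sub>F j in sequentially. prob (A (grid j)) \<le> C * grid j powr (- e)"
    using filterlim_grid bound by (rule eventually_compose_filterlim[rotated])
  have summ: "summable (\<lambda>j. prob (A (grid j)))"
  proof (rule summable_comparison_test_ev)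
    show "\<forall>\<^sub>F j in sequentially. norm (prob (A (grid j))) \<le> C * real j powr (- (e * \<beta>))"
      using ev by eventually_elim (simp add: grid_def powr_powr mult.commute)
    show "summable (\<lambda>j. C * real j powr (- (e * \<beta>)))"
      using e by (intro summable_mult) (simp add: summable_real_powr_iff)
  qed
  have "AE \<omega> in M. \<forall>\<^sub>F j in sequentially. \<omega> \<in> space M - A (grid j)"
    by (rule borel_cantelli_AE1[OF meas _ summ]) (simp add: emeasure_eq_measure)
  then show ?thesis by eventually_elim (auto elim: eventually_mono)
qed

lemma card_ball_real_le:
  assumes "T \<ge> 1" shows "(2 * real (Rad T) + 1) ^ CARD('d) \<le> 5 ^ CARD('d) * T powr (real CARD('d) * (1 + \<rho> + \<nu>))"
    and "(2 * real (Loc T) + 1) ^ CARD('d) \<le> 5 ^ CARD('d) * T powr (real CARD('d) * (3 * \<kappa>))"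
proof -
  have *: "(2 * x + 1) ^ CARD('d) \<le> 5 ^ CARD('d) * T powr (real CARD('d) * a)"
    if "0 \<le> x" "x \<le> 2 * T powr a" "a \<ge> 0" for x a
  proof -
    have "1 \<le> T powr a" using assms that by (intro ge_one_powr_ge_zero)
    then have "(2 * x + 1) ^ CARD('d) \<le> (5 * T powr a) ^ CARD('d)" using that by (intro power_mono) auto
    also have "\<dots> = 5 ^ CARD('d) * T powr (real CARD('d) * a)"
      using assms by (simp add: power_mult_distrib powr_power mult.commute)
    finally show ?thesis .
  qed
  show "(2 * real (Rad T) + 1) ^ CARD('d) \<le> 5 ^ CARD('d) * T powr (real CARD('d) * (1 + \<rho> + \<nu>))"
    using Rad_bounds[OF assms] rho_pos nu_bounds by (intro *) auto
  show "(2 * real (Loc T) + 1) ^ CARD('d) \<le> 5 ^ CARD('d) * T powr (real CARD('d) * (3 * \<kappa>))"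
    using Loc_bounds[OF assms] kappa_bounds by (intro *) auto
qed

text \<open>The expected number of high sites in a ball of radius \<open>Loc T\<close> is of order
  at most \<open>T powr (- e)\<close> with \<open>e > 0\<close>, so \<open>Suc m\<close> of them
  have probability of order at most \<open>T powr (- e * Suc m)\<close>. A large \<open>m\<close>
  outweighs both the number of centres and the grid.\<close>

lemma AE_sparse:
  "\<exists>m. AE \<omega> in M. \<forall>\<^sub>F j in sequentially.
     \<forall>x\<in>lball 0 (Rad (grid j)). card (lball x (Loc (grid j)) \<inter> {y. Base (grid j) < \<xi> y \<omega>}) \<le> m"
proof -
  define e where "e = \<alpha> * (\<rho> - 2 * \<kappa>) - 3 * \<kappa> * CARD('d)"
  have e: "e > 0"
  proof -
    have "3 * \<kappa> * CARD('d) < 3 * \<kappa> * \<alpha>" using alpha kappa_bounds by (intro mult_strict_left_mono) auto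
    moreover have "3 * \<kappa> * \<alpha> \<le> (\<rho> - 2 * \<kappa>) * \<alpha>" using kappa_bounds alpha_pos by (intro mult_right_mono) auto
    ultimately show ?thesis by (simp add: e_def mult.commute)
  qed
  obtain m :: nat where m: "(CARD('d) * (1 + \<rho> + \<nu>) + 2 / \<beta>) / e < real m" using reals_Archimedean2 by blast
  define A where "A T = (\<Union>x\<in>lball 0 (Rad T). hits (Suc m) (lball x (Loc T)) (\<lambda>_. {Base T<..}))" for T
  have meas: "A T \<in> events" for T unfolding A_def by (intro sets.finite_UN sets_hits) auto
  define C :: real where "C = 5 ^ CARD('d) * (5 ^ CARD('d)) ^ Suc m"
  have "\<forall>\<^sub>F T in at_top. prob (A T) \<le> C * T powr (- (2 / \<beta>))"
    using eventually_ge_at_top[of "1::real"]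
  proof eventually_elim
    case (elim T)
    have b1: "1 \<le> Base T" using elim kappa_bounds unfolding Base_def by (intro ge_one_powr_ge_zero) auto
    let ?q = "Base T powr (-\<alpha>)"
    have q: "prob {\<omega> \<in> space M. \<xi> z \<omega> \<in> {Base T<..}} \<le> ?q" for z
    proof -
      have "prob {\<omega> \<in> space M. \<xi> z \<omega> \<in> {Base T<..}} \<le> prob {\<omega> \<in> space M. Base T \<le> \<xi> z \<omega>}"
        by (intro finite_measure_mono) auto
      then show ?thesis using prob_ge[OF b1] by simp
    qed
    have "prob (A T) \<le> (\<Sum>x\<in>lball 0 (Rad T). prob (hits (Suc m) (lball x (Loc T)) (\<lambda>_. {Base T<..})))"
      unfolding A_def by (intro finite_measure_subadditive_finite) (auto intro!: sets_hits)
    also have "\<dots> \<le> (\<Sum>x\<in>lball (0 :: int ^ 'd) (Rad T). ((2 * real (Loc T) + 1) ^ CARD('d) * ?q) ^ Suc m)"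
    proof (rule sum_mono)
      fix x :: "int ^ 'd"
      have "prob (hits (Suc m) (lball x (Loc T)) (\<lambda>_. {Base T<..})) \<le> (real (card (lball x (Loc T))) * ?q) ^ Suc m"
        using q by (intro prob_hits_le) auto
      also have "\<dots> \<le> ((2 * real (Loc T) + 1) ^ CARD('d) * ?q) ^ Suc m"
      proof (rule power_mono[OF mult_right_mono])
        show "real (card (lball x (Loc T))) \<le> (2 * real (Loc T) + 1) ^ CARD('d)" by (rule real_card_lball_le)
      qed auto
      finally show "prob (hits (Suc m) (lball x (Loc T)) (\<lambda>_. {Base T<..})) \<le> ((2 * real (Loc T) + 1) ^ CARD('d) * ?q) ^ Suc m" .
    qed
    also have "\<dots> = real (card (lball (0 :: int ^ 'd) (Rad T))) * ((2 * real (Loc T) + 1) ^ CARD('d) * ?q) ^ Suc m" by simp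
    also have "\<dots> \<le> (5 ^ CARD('d) * T powr (CARD('d) * (1 + \<rho> + \<nu>))) * (5 ^ CARD('d) * T powr (CARD('d) * (3 * \<kappa>)) * ?q) ^ Suc m"
    proof (rule mult_mono[OF _ power_mono[OF mult_right_mono]])
      have "real (card (lball (0 :: int ^ 'd) (Rad T))) \<le> (2 * real (Rad T) + 1) ^ CARD('d)" by (rule real_card_lball_le)
      also have "\<dots> \<le> 5 ^ CARD('d) * T powr (CARD('d) * (1 + \<rho> + \<nu>))" by (rule card_ball_real_le(1)[OF elim])
      finally show "real (card (lball (0 :: int ^ 'd) (Rad T))) \<le> 5 ^ CARD('d) * T powr (CARD('d) * (1 + \<rho> + \<nu>))" .
      show "(2 * real (Loc T) + 1) ^ CARD('d) \<le> 5 ^ CARD('d) * T powr (CARD('d) * (3 * \<kappa>))" by (rule card_ball_real_le(2)[OF elim])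
    qed auto
    also have "\<dots> = C * (T powr (CARD('d) * (1 + \<rho> + \<nu>)) * (T powr (CARD('d) * (3 * \<kappa>)) * ?q) ^ Suc m)"
      unfolding C_def power_mult_distrib by (simp only: mult_ac)
    also have "T powr (CARD('d) * (3 * \<kappa>)) * ?q = T powr (- e)"
      using elim by (simp add: Base_def powr_powr powr_add[symmetric] e_def algebra_simps)
    also have "T powr (CARD('d) * (1 + \<rho> + \<nu>)) * (T powr (- e)) ^ Suc m = T powr (CARD('d) * (1 + \<rho> + \<nu>) - e * real (Suc m))"
    proof -
      have "(T powr (- e)) ^ Suc m = T powr (- e * real (Suc m))" using elim by (simp add: powr_power mult.commute del: power_Suc of_nat_Suc)
      then show ?thesis by (simp add: powr_add[symmetric] del: power_Suc of_nat_Suc)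
    qed
    also have "C * \<dots> \<le> C * T powr (- (2 / \<beta>))"
    proof (intro mult_left_mono powr_mono)
      have "CARD('d) * (1 + \<rho> + \<nu>) + 2 / \<beta> < real m * e" using m e by (simp add: divide_less_eq)
      also have "\<dots> \<le> e * real (Suc m)" using e by simp
      finally show "CARD('d) * (1 + \<rho> + \<nu>) - e * real (Suc m) \<le> - (2 / \<beta>)" by linarith
    qed (use elim in \<open>auto simp: C_def\<close>)
    finally show ?case .
  qed
  then have "AE \<omega> in M. \<forall>\<^sub>F j in sequentially. \<omega> \<notin> A (grid j)"
    by (rule AE_eventually_grid[OF meas]) (use beta_pos in auto)
  then have "AE \<omega> in M. \<forall>\<^sub>F j in sequentially.
     \<forall>x\<in>lball 0 (Rad (grid j)). card (lball x (Loc (grid j)) \<inter> {y. Base (grid j) < \<xi> y \<omega>}) \<le> m"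
    using AE_space
  proof eventually_elim
    case (elim \<omega>)
    show ?case
      using elim(1)
    proof eventually_elim
      case (elim j)
      show ?case
      proof (rule ballI, rule ccontr)
        fix x :: "int ^ 'd" assume x: "x \<in> lball 0 (Rad (grid j))"
          and n: "\<not> card (lball x (Loc (grid j)) \<inter> {y. Base (grid j) < \<xi> y \<omega>}) \<le> m"
        then obtain A' where A': "A' \<subseteq> lball x (Loc (grid j)) \<inter> {y. Base (grid j) < \<xi> y \<omega>}" "card A' = Suc m"
          by (metis not_less_eq_eq obtain_subset_with_card_n)
        then have "\<omega> \<in> A (grid j)" using x \<open>\<omega> \<in> space M\<close> unfolding A_def hits_def by auto
        then show False using elim by simp
      qed
    qed
  qed
  then show ?thesis by blast
qed

text \<open>A ball slightly smaller than the natural scale: \<open>\<nu> / \<eta> > \<nu>\<close>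
  keeps the cost of reaching its sites below \<open>Top\<close>, and
  \<open>\<eta> > d / \<alpha>\<close> leaves enough sites for one with potential
  \<open>2 * T powr (\<rho> - \<nu>)\<close>.\<close>

definition Inner :: "real \<Rightarrow> nat" where "Inner T = nat \<lceil>T powr (1 + \<rho> - \<nu> / \<eta>)\<rceil>"

lemma nu_eta: "\<nu> < \<nu> / \<eta>" "CARD('d) * (\<nu> / \<eta>) < \<alpha> * \<nu>" "\<nu> / \<eta> < 1"
proof -
  show "\<nu> < \<nu> / \<eta>" using eta_bounds nu_bounds by (simp add: less_divide_eq)
  have "CARD('d) / \<alpha> * \<alpha> < \<eta> * \<alpha>" using eta_bounds alpha_pos by (intro mult_strict_right_mono) auto
  then have "CARD('d) < \<alpha> * \<eta>" using alpha_pos by (simp add: mult.commute)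
  then have "CARD('d) * \<nu> < \<alpha> * \<eta> * \<nu>" using nu_bounds by (intro mult_strict_right_mono) auto
  then show *: "CARD('d) * (\<nu> / \<eta>) < \<alpha> * \<nu>" using eta_bounds by (simp add: field_simps)
  have "1 * (\<nu> / \<eta>) \<le> CARD('d) * (\<nu> / \<eta>)"
    using nu_bounds eta_bounds by (intro mult_right_mono) (auto simp: Suc_leI)
  then show "\<nu> / \<eta> < 1" using * nu_bounds kappa_bounds by linarith
qed

lemma Inner_bounds:
  assumes "T \<ge> 1" shows "T powr (1 + \<rho> - \<nu> / \<eta>) \<le> Inner T" "Inner T \<le> 2 * T powr (1 + \<rho> - \<nu> / \<eta>)" "Inner T \<le> Rad T"
proof -
  have "1 \<le> T powr (1 + \<rho> - \<nu> / \<eta>)" using assms rho_pos nu_eta by (intro ge_one_powr_ge_zero) auto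
  then show "T powr (1 + \<rho> - \<nu> / \<eta>) \<le> Inner T" "Inner T \<le> 2 * T powr (1 + \<rho> - \<nu> / \<eta>)"
    unfolding Inner_def by linarith+
  show "Inner T \<le> Rad T" unfolding Inner_def Rad_def
    using assms nu_eta nu_bounds by (intro nat_mono ceiling_mono powr_mono) auto
qed

text \<open>The expected number of such sites has order \<open>T powr \<delta>\<close> with
  \<open>\<delta> > 0\<close>, so by independence their absence has probability at most
  \<open>exp (- (c * T powr \<delta>))\<close>.\<close>

lemma AE_high_site:
  "AE \<omega> in M. \<forall>\<^sub>F j in sequentially. \<exists>z\<in>lball 0 (Inner (grid j)). 2 * Top (grid j) \<le> grid j * \<xi> z \<omega>"
proof -
  define x where "x T = 2 * T powr (\<rho> - \<nu>)" for T :: real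
  define A where "A T = {\<omega> \<in> space M. \<forall>z\<in>lball 0 (Inner T). \<xi> z \<omega> < x T}" for T
  define \<delta> where "\<delta> = \<alpha> * \<nu> - CARD('d) * (\<nu> / \<eta>)"
  define c where "c = (1 / CARD('d)) ^ CARD('d) * 2 powr (-\<alpha>)"
  have \<delta>: "\<delta> > 0" using nu_eta by (simp add: \<delta>_def)
  have c: "c > 0" by (simp add: c_def)
  have ne: "lball (0 :: int ^ 'd) n \<noteq> {}" for n by (auto simp: lball_def intro!: exI[of _ 0])
  have meas: "A T \<in> events" for T
    unfolding A_def by (intro sets.sets_Collect_finite_All) auto
  have "\<forall>\<^sub>F T in at_top. (2 / \<beta> / c) * (ln T * T powr 0) \<le> T powr \<delta>"
    by (rule eventually_ln_powr_le[OF \<delta>])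
  then have "\<forall>\<^sub>F T in at_top. prob (A T) \<le> 1 * T powr (- (2 / \<beta>))"
    using eventually_ge_at_top[of "1::real"]
  proof eventually_elim
    case (elim T)
    note T1 = elim(2)
    have x1: "1 \<le> x T"
      using ge_one_powr_ge_zero[OF T1, of "\<rho> - \<nu>"] kappa_bounds nu_bounds by (simp add: x_def)
    have "prob (A T) \<le> exp (- (real (card (lball (0 :: int ^ 'd) (Inner T))) * x T powr (-\<alpha>)))"
      unfolding A_def by (rule prob_all_less_le(2)[OF finite_lball ne x1])
    also have "\<dots> \<le> exp (- (c * T powr \<delta>))"
    proof -
      have "c * T powr \<delta> = (T powr (1 + \<rho> - \<nu> / \<eta>) / CARD('d)) ^ CARD('d) * x T powr (-\<alpha>)"
      proof -
        have "T powr \<delta> = T powr (CARD('d) * (1 + \<rho> - \<nu> / \<eta>)) * T powr (- \<alpha> * (\<rho> - \<nu>))"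
          using rho_alpha by (simp add: powr_add[symmetric] \<delta>_def algebra_simps)
        moreover have "T powr (CARD('d) * (1 + \<rho> - \<nu> / \<eta>)) = (T powr (1 + \<rho> - \<nu> / \<eta>)) ^ CARD('d)"
          using T1 by (simp add: powr_power mult.commute)
        moreover have "x T powr (-\<alpha>) = 2 powr (-\<alpha>) * T powr (- \<alpha> * (\<rho> - \<nu>))"
          by (simp add: x_def powr_mult powr_powr mult.commute)
        ultimately show ?thesis by (simp add: c_def power_divide)
      qed
      also have "\<dots> \<le> real (card (lball (0 :: int ^ 'd) (Inner T))) * x T powr (-\<alpha>)"
      proof (rule mult_right_mono)
        have "(T powr (1 + \<rho> - \<nu> / \<eta>) / CARD('d)) ^ CARD('d) \<le> (real (Inner T) / CARD('d)) ^ CARD('d)"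
          using Inner_bounds(1)[OF T1] by (intro power_mono divide_right_mono) auto
        also have "\<dots> \<le> real (card (lball (0 :: int ^ 'd) (Inner T)))" by (rule card_lball_ge)
        finally show "(T powr (1 + \<rho> - \<nu> / \<eta>) / CARD('d)) ^ CARD('d) \<le> real (card (lball (0 :: int ^ 'd) (Inner T)))" .
      qed simp
      finally show ?thesis by simp
    qed
    also have "\<dots> \<le> exp (- (2 / \<beta> * ln T))"
    proof -
      have "c * ((2 / \<beta> / c) * ln T) \<le> c * T powr \<delta>" using elim(1) c T1 by (intro mult_left_mono) auto
      moreover have "c * ((2 / \<beta> / c) * ln T) = 2 / \<beta> * ln T" using c by simp
      ultimately have "2 / \<beta> * ln T \<le> c * T powr \<delta>" by linarith
      then show ?thesis by simp
    qed
    also have "\<dots> = 1 * T powr (- (2 / \<beta>))" using T1 by (simp add: powr_def)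
    finally show ?case .
  qed
  then have "AE \<omega> in M. \<forall>\<^sub>F j in sequentially. \<omega> \<notin> A (grid j)"
    by (rule AE_eventually_grid[OF meas]) (use beta_pos in auto)
  then show ?thesis using AE_space
  proof eventually_elim
    case (elim \<omega>)
    show ?case
      using elim(1) eventually_gt_at_top[of 0]
    proof eventually_elim
      case (elim j)
      then obtain z where z: "z \<in> lball 0 (Inner (grid j))" "x (grid j) \<le> \<xi> z \<omega>"
        using \<open>\<omega> \<in> space M\<close> by (auto simp: A_def not_less)
      have g0: "grid j > 0" using elim(2) by (simp add: grid_def)
      have "2 * Top (grid j) = grid j * x (grid j)"
        using g0 by (simp add: Top_def x_def powr_mult_base add_diff_eq)
      also have "\<dots> \<le> grid j * \<xi> z \<omega>" using z g0 by (intro mult_left_mono) auto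
      finally show ?case using z by blast
    qed
  qed
qed

lemma eventually_peak_ge_Top:
  "\<forall>\<^sub>F T in at_top. \<forall>V :: int ^ 'd \<Rightarrow> real. (\<forall>z\<in>lball 0 (Rad T). V z \<le> Vmax T) \<longrightarrow>
     (\<forall>z\<in>lball 0 (Inner T). 2 * Top T \<le> T * V z \<longrightarrow> Top T \<le> peak_value V (Base T) T z)"
proof -
  have "\<forall>\<^sub>F T in at_top. (2 * (1 + \<rho> + \<eta> * \<nu>)) * (ln T * T powr (1 + \<rho> - \<nu> / \<eta>)) \<le> T powr (1 + \<rho> - \<nu>)"
    using nu_eta by (intro eventually_ln_powr_le) auto
  then show ?thesis using eventually_ge_at_top[of "2::real"]
  proof eventually_elim
    case (elim T)
    then have T1: "T \<ge> 1" by simp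
    show ?case
    proof (intro allI impI ballI)
      fix V :: "int ^ 'd \<Rightarrow> real" and z
      assume V: "\<forall>z\<in>lball 0 (Rad T). V z \<le> Vmax T" and z: "z \<in> lball 0 (Inner T)" "2 * Top T \<le> T * V z"
      have "norm1 z \<le> Rad T" using z Inner_bounds(3)[OF T1] by (simp add: lball_def)
      then have Vz: "V z \<le> Vmax T" using V by (simp add: lball_def)
      have Bv: "Base T \<le> Vmax T"
      proof -
        have "T powr (\<rho> - 2 * \<kappa>) \<le> T powr (\<rho> + \<eta> * \<nu>)" using T1 kappa_bounds eta_nu by (intro powr_mono) auto
        then show ?thesis unfolding Base_def Vmax_def using powr_ge_zero[of T "\<rho> + \<eta> * \<nu>"] by linarith
      qed
      have B0: "0 < Base T" using T1 by (simp add: Base_def)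
      have "ln (max (V z) (Base T)) \<le> ln (Vmax T)" using Vz Bv B0 by (intro ln_mono) auto
      also have "\<dots> = ln 2 + (\<rho> + \<eta> * \<nu>) * ln T" using T1 by (simp add: Vmax_def ln_mult ln_powr)
      also have "\<dots> \<le> (1 + \<rho> + \<eta> * \<nu>) * ln T" using elim(2) by (simp add: algebra_simps)
      finally have l: "ln (max (V z) (Base T)) \<le> (1 + \<rho> + \<eta> * \<nu>) * ln T" .
      have "norm1 z * ln (max (V z) (Base T)) \<le> norm1 z * ((1 + \<rho> + \<eta> * \<nu>) * ln T)"
        using l by (intro mult_left_mono) auto
      also have "\<dots> \<le> (2 * T powr (1 + \<rho> - \<nu> / \<eta>)) * ((1 + \<rho> + \<eta> * \<nu>) * ln T)"
      proof (rule mult_right_mono)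
        have "real (norm1 z) \<le> real (Inner T)" using z by (simp add: lball_def)
        then show "real (norm1 z) \<le> 2 * T powr (1 + \<rho> - \<nu> / \<eta>)" using Inner_bounds(2)[OF T1] by linarith
        show "0 \<le> (1 + \<rho> + \<eta> * \<nu>) * ln T" using T1 rho_pos eta_nu by (intro mult_nonneg_nonneg) auto
      qed
      also have "\<dots> = (2 * (1 + \<rho> + \<eta> * \<nu>)) * (ln T * T powr (1 + \<rho> - \<nu> / \<eta>))" by (simp only: mult_ac)
      also have "\<dots> \<le> Top T" using elim(1) by (simp only: Top_def)
      finally show "Top T \<le> peak_value V (Base T) T z"
        using z ln_geodesics_bounds(1)[of z] by (simp add: peak_value_def)
    qed
  qed
qed

text \<open>Bins of width \<open>Gap T\<close> must reach up to \<open>T * Vmax T\<close>, which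
  bounds all peak values in the box; the quotient is
  \<open>2 * T powr (\<eta> * \<nu> + \<kappa>)\<close>.\<close>

definition Bins :: "real \<Rightarrow> nat" where "Bins T = nat \<lceil>2 * T powr (\<eta> * \<nu> + \<kappa>)\<rceil>"

text \<open>The bins start at \<open>Top T / 2\<close> because a competitor within
  \<open>Gap T\<close> of a peak value above \<open>Top T\<close> is still above this level.\<close>

definition near_ties :: "nat \<Rightarrow> real \<Rightarrow> 'a set" where
  "near_ties k T = ties k (Rad T) (Base T) T (Top T / 2) (Gap T) (Bins T)"

lemma sets_near_ties: "near_ties k T \<in> events"
  unfolding near_ties_def by (rule sets_ties)

text \<open>The exponent is that of the number of bins plus \<open>k\<close> times that of the
  expected number of sites in a bin. The latter combines volume, window width
  \<open>Gap T / T\<close> and Pareto density; by \<open>rho_alpha\<close> all that remains is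
  \<open>- \<kappa>\<close> and multiples of \<open>\<nu>\<close>.\<close>

lemma prob_near_ties_le:
  "\<exists>C. \<forall>\<^sub>F T in at_top. prob (near_ties k T) \<le> C * T powr (\<eta> * \<nu> + \<kappa> + ((CARD('d) + \<alpha> + 1) * \<nu> - \<kappa>) * k)"
proof -
  define D where "D = ln (deg TYPE('d)) + 4"
  define C where "C = 3 * (5 ^ CARD('d) * (12 * \<alpha> * 2 powr (\<alpha> + 1))) ^ k"
  have "\<forall>\<^sub>F T in at_top. 2 \<le> T powr (\<rho> - \<nu>)"
    using kappa_bounds nu_bounds by (intro eventually_const_le_powr) auto
  then have "\<forall>\<^sub>F T in at_top. prob (near_ties k T) \<le> C * T powr (\<eta> * \<nu> + \<kappa> + ((CARD('d) + \<alpha> + 1) * \<nu> - \<kappa>) * k)"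
    using eventually_scale_conditions[OF zero_less_one, of D 0]
  proof eventually_elim
    case (elim T)
    have T1: "T \<ge> 1" using elim(2) by simp
    have T0: "T > 0" using T1 by linarith
    let ?d = "CARD('d)"
    let ?E = "(?d + \<alpha> + 1) * \<nu> - \<kappa>"
    have tt: "Top T / 2 / T = T powr (\<rho> - \<nu>) / 2"
    proof -
      have "Top T = T * T powr (\<rho> - \<nu>)" using T0 by (simp add: Top_def powr_mult_base add_diff_eq)
      then show ?thesis using T0 by simp
    qed
    have gt: "Gap T / T = T powr (\<rho> - \<kappa>)"
    proof -
      have "Gap T = T * T powr (\<rho> - \<kappa>)" using T0 by (simp add: Gap_def powr_mult_base add_diff_eq)
      then show ?thesis using T0 by simp
    qed
    have N: "real (Bins T) \<le> 3 * T powr (\<eta> * \<nu> + \<kappa>)"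
    proof -
      have "1 \<le> T powr (\<eta> * \<nu> + \<kappa>)" using T1 eta_nu kappa_bounds by (intro ge_one_powr_ge_zero) auto
      then show ?thesis unfolding Bins_def by linarith
    qed
    have "prob (near_ties k T) \<le> Bins T * ((2 * real (Rad T) + 1) ^ ?d * (12 * \<alpha> * (Gap T / T) * (Top T / 2 / T) powr (-\<alpha> - 1))) ^ k"
      unfolding near_ties_def
    proof (rule prob_ties_le)
      show "ln (deg TYPE('d)) + 4 \<le> ln (Base T)" "T * Base T \<le> Top T / 2" using elim(2) by (auto simp: D_def)
      show "1 \<le> Top T / 2 / T" using elim(1) unfolding tt by simp
    qed (use T0 in \<open>auto simp: Base_def Gap_def\<close>)
    also have "\<dots> \<le> (3 * T powr (\<eta> * \<nu> + \<kappa>)) * ((5 ^ ?d * (12 * \<alpha> * 2 powr (\<alpha> + 1))) * T powr ?E) ^ k"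
    proof (rule mult_mono[OF N power_mono])
      have "(2 * real (Rad T) + 1) ^ ?d * (12 * \<alpha> * (Gap T / T) * (Top T / 2 / T) powr (-\<alpha> - 1)) \<le>
          (5 ^ ?d * T powr (?d * (1 + \<rho> + \<nu>))) * (12 * \<alpha> * (Gap T / T) * (Top T / 2 / T) powr (-\<alpha> - 1))"
        using alpha_pos T0 by (intro mult_right_mono card_ball_real_le(1)[OF T1]) (auto simp: Gap_def)
      moreover have tp: "(Top T / 2 / T) powr (-\<alpha> - 1) = 2 powr (\<alpha> + 1) * T powr ((\<rho> - \<nu>) * (-\<alpha> - 1))"
      proof -
        have "2 powr (-\<alpha> - 1) = 1 / 2 powr (\<alpha> + 1)"
          using powr_minus_divide[of 2 "\<alpha> + 1"] by simp
        then show ?thesis unfolding tt by (simp add: powr_divide powr_powr)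
      qed
      moreover have "(5 ^ ?d * T powr (?d * (1 + \<rho> + \<nu>))) * (12 * \<alpha> * (Gap T / T) * (2 powr (\<alpha> + 1) * T powr ((\<rho> - \<nu>) * (-\<alpha> - 1)))) =
          (5 ^ ?d * (12 * \<alpha> * 2 powr (\<alpha> + 1))) * (T powr (?d * (1 + \<rho> + \<nu>)) * T powr (\<rho> - \<kappa>) * T powr ((\<rho> - \<nu>) * (-\<alpha> - 1)))"
        unfolding gt by (simp only: mult_ac)
      moreover have "T powr (?d * (1 + \<rho> + \<nu>)) * T powr (\<rho> - \<kappa>) * T powr ((\<rho> - \<nu>) * (-\<alpha> - 1)) = T powr ?E"
      proof -
        have "?d * (1 + \<rho> + \<nu>) + (\<rho> - \<kappa>) + (\<rho> - \<nu>) * (-\<alpha> - 1) = ?E"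
          using rho_alpha by (simp add: algebra_simps)
        then show ?thesis by (simp only: powr_add[symmetric])
      qed
      ultimately show "(2 * real (Rad T) + 1) ^ ?d * (12 * \<alpha> * (Gap T / T) * (Top T / 2 / T) powr (-\<alpha> - 1)) \<le>
          (5 ^ ?d * (12 * \<alpha> * 2 powr (\<alpha> + 1))) * T powr ?E" by simp
      show "0 \<le> (2 * real (Rad T) + 1) ^ ?d * (12 * \<alpha> * (Gap T / T) * (Top T / 2 / T) powr (-\<alpha> - 1))"
        using alpha_pos T0 by (intro mult_nonneg_nonneg) (auto simp: Gap_def)
      then show "0 \<le> ((2 * real (Rad T) + 1) ^ ?d * (12 * \<alpha> * (Gap T / T) * (Top T / 2 / T) powr (-\<alpha> - 1))) ^ k"
        by (rule zero_le_power)
    qed simp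
    also have "\<dots> = C * (T powr (\<eta> * \<nu> + \<kappa>) * (T powr ?E) ^ k)"
      unfolding C_def power_mult_distrib by (simp only: mult_ac)
    also have "T powr (\<eta> * \<nu> + \<kappa>) * (T powr ?E) ^ k = T powr (\<eta> * \<nu> + \<kappa> + ?E * k)"
      using T1 by (simp add: powr_power powr_add mult.commute)
    finally show ?case .
  qed
  then show ?thesis by blast
qed

lemma AE_not_near_ties_3: "AE \<omega> in M. \<forall>\<^sub>F j in sequentially. \<omega> \<notin> near_ties 3 (grid j)"
proof -
  define e where "e = - (\<eta> * \<nu> + \<kappa> + ((CARD('d) + \<alpha> + 1) * \<nu> - \<kappa>) * real (3 :: nat))"
  obtain C where C: "\<forall>\<^sub>F T in at_top. prob (near_ties 3 T) \<le> C * T powr (- e)"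
    using prob_near_ties_le[of 3] unfolding e_def by auto
  have "CARD('d) * \<nu> \<le> \<alpha> * \<nu>" "\<nu> \<le> \<alpha> * \<nu>"
    using alpha alpha_pos nu_bounds by (auto intro!: mult_right_mono simp: mult_le_cancel_right)
  moreover have "e = 2 * \<kappa> - \<eta> * \<nu> - 3 * (CARD('d) * \<nu>) - 3 * (\<alpha> * \<nu>) - 3 * \<nu>" by (simp add: e_def algebra_simps)
  ultimately have "3 / 2 * \<kappa> < e" using eta_nu(2) nu_bounds kappa_bounds(1) by linarith
  then have "1 < e * \<beta>" using kappa_bounds by (simp add: \<beta>_def field_simps)
  then show ?thesis by (rule AE_eventually_grid[OF sets_near_ties C])
qed

lemma prob_near_ties_2: "((\<lambda>T. prob (near_ties 2 T)) \<longlongrightarrow> 0) at_top"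
proof -
  define e where "e = \<eta> * \<nu> + \<kappa> + ((CARD('d) + \<alpha> + 1) * \<nu> - \<kappa>) * real (2 :: nat)"
  obtain C where C: "\<forall>\<^sub>F T in at_top. prob (near_ties 2 T) \<le> C * T powr e"
    using prob_near_ties_le[of 2] unfolding e_def by auto
  have "CARD('d) * \<nu> \<le> \<alpha> * \<nu>" "\<nu> \<le> \<alpha> * \<nu>"
    using alpha alpha_pos nu_bounds by (auto intro!: mult_right_mono simp: mult_le_cancel_right)
  moreover have "e = \<eta> * \<nu> + 2 * (CARD('d) * \<nu>) + 2 * (\<alpha> * \<nu>) + 2 * \<nu> - \<kappa>" by (simp add: e_def algebra_simps)
  ultimately have e: "e < 0" using eta_nu(2) nu_bounds kappa_bounds(1) by linarith
  have "((\<lambda>T. C * T powr e) \<longlongrightarrow> C * 0) at_top"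
    using e by (intro tendsto_mult tendsto_const tendsto_neg_powr filterlim_ident)
  then show ?thesis
    by (intro tendsto_sandwich[OF _ C tendsto_const]) auto
qed

end

section \<open>The two cities\<close>

text \<open>A maximiser of \<open>f\<close> on \<open>C\<close>; choosing the one with the least
  code makes the choice measurable.\<close>

definition pick :: "('b :: countable \<Rightarrow> real) \<Rightarrow> 'b set \<Rightarrow> 'b" where
  "pick f C = from_nat (LEAST n. from_nat n \<in> C \<and> (\<forall>w\<in>C. f w \<le> f (from_nat n)))"

lemma pick:
  assumes "finite C" "C \<noteq> {}" shows "pick f C \<in> C" "\<And>w. w \<in> C \<Longrightarrow> f w \<le> f (pick f C)"
proof -
  have "Max (f ` C) \<in> f ` C" using assms by (intro Max_in) auto
  then obtain z where z: "z \<in> C" "f z = Max (f ` C)" by auto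
  have "from_nat (to_nat z) \<in> C \<and> (\<forall>w\<in>C. f w \<le> f (from_nat (to_nat z)))" using z assms by simp
  from LeastI[of "\<lambda>n. from_nat n \<in> C \<and> (\<forall>w\<in>C. f w \<le> f (from_nat n))", OF this]
  show "pick f C \<in> C" "\<And>w. w \<in> C \<Longrightarrow> f w \<le> f (pick f C)" by (auto simp: pick_def)
qed

lemma measurable_pick:
  assumes [measurable]: "\<And>z. (\<lambda>\<omega>. f \<omega> z) \<in> borel_measurable M" and C: "finite C"
  shows "(\<lambda>\<omega>. pick (f \<omega>) C) \<in> measurable M (count_space UNIV)"
proof -
  have "(\<lambda>\<omega>. LEAST n. from_nat n \<in> C \<and> (\<forall>w\<in>C. f \<omega> w \<le> f \<omega> (from_nat n))) \<in> measurable M (count_space UNIV)"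
  proof (rule measurable_Least)
    fix n :: nat
    have "Measurable.pred M (\<lambda>\<omega>. \<forall>w\<in>C. f \<omega> w \<le> f \<omega> (from_nat n))"
      using C by (intro pred_intros_finite) measurable
    then show "Measurable.pred M (\<lambda>\<omega>. from_nat n \<in> C \<and> (\<forall>w\<in>C. f \<omega> w \<le> f \<omega> (from_nat n)))" by simp
  qed
  from measurable_compose[OF this, of from_nat "count_space UNIV"] show ?thesis
    by (simp add: pick_def)
qed

text \<open>Presents the total mass as the limit of a sequence of finite sums, for measurability in
  the potential.\<close>

lemma tendsto_infsum_lball:
  fixes f :: "int ^ 'd \<Rightarrow> real"
  assumes "f summable_on UNIV"
  shows "(\<lambda>n. \<Sum>z\<in>lball 0 n. f z) \<longlonglongrightarrow> infsum f UNIV"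
proof -
  have "(sum f \<longlongrightarrow> infsum f UNIV) (finite_subsets_at_top UNIV)"
    using has_sum_infsum[OF assms] by (simp add: has_sum_def)
  moreover have "filterlim (\<lambda>n. lball (0 :: int ^ 'd) n) (finite_subsets_at_top UNIV) sequentially"
    unfolding filterlim_finite_subsets_at_top
  proof (intro allI impI)
    fix X :: "(int ^ 'd) set" assume X: "finite X \<and> X \<subseteq> UNIV"
    show "\<forall>\<^sub>F n in sequentially. finite (lball (0 :: int ^ 'd) n) \<and> X \<subseteq> lball 0 n \<and> lball (0 :: int ^ 'd) n \<subseteq> UNIV"
      using eventually_ge_at_top[of "Max (norm1 ` X)"]
    proof eventually_elim
      case (elim n)
      have "norm1 x \<le> n" if "x \<in> X" for x
      proof -
        have "norm1 x \<le> Max (norm1 ` X)" using X that by (intro Max_ge finite_imageI imageI) auto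
        then show ?thesis using elim by linarith
      qed
      then have "X \<subseteq> lball 0 n" by (auto simp: lball_def)
      then show ?case by simp
    qed
  qed
  ultimately show ?thesis by (rule filterlim_compose)
qed

text \<open>Bounded finite sums give summability, and the ratio lies between
  \<open>1 / (1 + e) >= 1 - e\<close> and \<open>1\<close>.\<close>

lemma mass_ratio:
  fixes f :: "int ^ 'd \<Rightarrow> real"
  assumes f: "\<And>z. 0 \<le> f z" and S: "finite S" "0 < (\<Sum>z\<in>S. f z)"
    and F: "\<And>F. finite F \<Longrightarrow> F \<inter> S = {} \<Longrightarrow> (\<Sum>z\<in>F. f z) \<le> e * (\<Sum>z\<in>S. f z)" and e: "0 \<le> e"
  shows "f summable_on UNIV" "\<bar>(\<Sum>z\<in>S. f z) / infsum f UNIV - 1\<bar> \<le> e"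
proof -
  let ?s = "\<Sum>z\<in>S. f z"
  have bound: "(\<Sum>z\<in>F. f z) \<le> (1 + e) * ?s" if "finite F" for F
  proof -
    have "(\<Sum>z\<in>F. f z) = (\<Sum>z\<in>F \<inter> S. f z) + (\<Sum>z\<in>F - S. f z)"
      using that by (subst sum.union_disjoint[symmetric]) (auto intro: sum.cong simp: Int_Diff_Un)
    also have "(\<Sum>z\<in>F \<inter> S. f z) \<le> ?s" using S f by (intro sum_mono2) auto
    also have "(\<Sum>z\<in>F - S. f z) \<le> e * ?s" using that by (intro F) auto
    finally show ?thesis by (simp add: algebra_simps)
  qed
  show sm: "f summable_on UNIV"
    using bound f by (intro nonneg_bdd_above_summable_on) (auto intro!: bdd_aboveI)
  have 1: "?s \<le> infsum f UNIV" using S f by (intro finite_sum_le_infsum[OF sm]) auto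
  have 2: "infsum f UNIV \<le> (1 + e) * ?s" by (rule infsum_le_finite_sums[OF sm]) (rule bound)
  have p: "0 < infsum f UNIV" using 1 S by linarith
  have "?s / infsum f UNIV \<le> 1" using 1 p by simp
  moreover have "1 - e \<le> ?s / infsum f UNIV"
  proof -
    have "(1 - e) * infsum f UNIV \<le> ?s"
    proof (cases "e \<le> 1")
      case True
      have "(1 - e) * infsum f UNIV \<le> (1 - e) * ((1 + e) * ?s)" using True 2 by (intro mult_left_mono) auto
      also have "\<dots> = ?s - e * e * ?s" by (simp add: algebra_simps)
      also have "\<dots> \<le> ?s" using S by simp
      finally show ?thesis .
    next
      case False
      then have "(1 - e) * infsum f UNIV \<le> 0" using p by (intro mult_nonpos_nonneg) auto
      then show ?thesis using S by linarith
    qed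
    then show ?thesis using p by (simp add: pos_le_divide_eq)
  qed
  ultimately show "\<bar>?s / infsum f UNIV - 1\<bar> \<le> e" by linarith
qed

lemma measurable_completion_AE_eq:
  fixes f g :: "'a \<Rightarrow> real"
  assumes g: "g \<in> borel_measurable M" and eq: "AE x in M. f x = g x"
  shows "f \<in> borel_measurable (completion M)"
proof (rule measurableI)
  fix B :: "real set" assume B: "B \<in> sets borel"
  have g': "g \<in> borel_measurable (completion M)" using g by (rule measurable_completion)
  have 1: "Measurable.pred (completion M) (\<lambda>x. f x \<noteq> g x \<and> f x \<in> B)"
    by (rule sets_completion_AE) (use eq in eventually_elim, auto)
  have 2: "Measurable.pred (completion M) (\<lambda>x. f x \<noteq> g x)"
    by (rule sets_completion_AE) (use eq in eventually_elim, auto)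
  have 3: "Measurable.pred (completion M) (\<lambda>x. g x \<in> B)"
    using measurable_sets[OF g' B] by (simp add: pred_def vimage_def Int_def conj_commute)
  have "Measurable.pred (completion M) (\<lambda>x. (g x \<in> B \<and> \<not> f x \<noteq> g x) \<or> (f x \<noteq> g x \<and> f x \<in> B))"
    using 1 2 3 by measurable
  also have "(\<lambda>x. (g x \<in> B \<and> \<not> f x \<noteq> g x) \<or> (f x \<noteq> g x \<and> f x \<in> B)) = (\<lambda>x. f x \<in> B)"
    by (intro ext) metis
  finally show "f -` B \<inter> space (completion M) \<in> sets (completion M)"
    by (simp add: pred_def vimage_def Int_def conj_commute)
qed auto

lemma (in finite_measure) measure_tendsto_0_at_top:
  fixes E :: "real \<Rightarrow> 'a set"
  assumes E: "\<And>t. E t \<in> sets M" and ae: "AE \<omega> in M. \<forall>\<^sub>F t in at_top. \<omega> \<notin> E t"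
  shows "((\<lambda>t. measure M (E t)) \<longlongrightarrow> 0) at_top"
proof -
  have "((\<lambda>t. integral\<^sup>L M (\<lambda>\<omega>. indicator (E t) \<omega> :: real)) \<longlongrightarrow> integral\<^sup>L M (\<lambda>\<omega>. 0)) at_top"
  proof (rule integral_dominated_convergence_at_top[where w = "\<lambda>_. 1"])
    show "AE \<omega> in M. ((\<lambda>t. indicator (E t) \<omega> :: real) \<longlongrightarrow> 0) at_top"
      using ae
    proof eventually_elim
      case (elim \<omega>)
      then have "\<forall>\<^sub>F t in at_top. indicator (E t) \<omega> = (0 :: real)" by eventually_elim simp
      then show ?case by (rule tendsto_eventually)
    qed
  qed (use E in auto)
  moreover have "integral\<^sup>L M (\<lambda>\<omega>. indicator (E t) \<omega> :: real) = measure M (E t)" for t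
    using E[of t] sets.sets_into_space[OF E[of t]] by (simp add: Int_absorb2)
  ultimately show ?thesis by simp
qed

lemma path_weight_measurable [measurable]:
  assumes [measurable]: "\<And>z. \<xi> z \<in> borel_measurable M"
  shows "(\<lambda>\<omega>. path_weight (\<lambda>z. \<xi> z \<omega>) k z) \<in> borel_measurable M"
proof (induction k arbitrary: z)
  case (Suc k)
  note [measurable] = Suc
  show ?case unfolding path_weight_Suc by measurable
qed (simp add: path_weight_0)

lemma solution_pos:
  fixes V :: "int ^ 'd \<Rightarrow> real"
  assumes V: "\<And>z. 0 \<le> V z" and t: "t > 0" and W: "(\<lambda>k. t ^ k / fact k * path_weight V k z) sums W"
  shows "W > 0"
proof -
  have pw: "0 \<le> path_weight V k z" for k by (rule path_weight_nonneg) (rule V)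
  have "0 < t ^ norm1 z / fact (norm1 z) * path_weight V (norm1 z) z"
    using t geodesics_le_path_weight[of V z, OF V] geodesics_pos[of z] by (intro mult_pos_pos) auto
  also have "\<dots> = (\<Sum>k\<in>{norm1 z}. t ^ k / fact k * path_weight V k z)" by simp
  also have "\<dots> \<le> (\<Sum>k. t ^ k / fact k * path_weight V k z)"
    using t pw by (intro sum_le_suminf sums_summable[OF W]) auto
  finally show ?thesis using sums_unique[OF W] by simp
qed

lemma solution_mono:
  fixes V :: "int ^ 'd \<Rightarrow> real"
  assumes V: "\<And>z. 0 \<le> V z" and t: "0 \<le> t" "t \<le> t'"
    and W: "(\<lambda>k. t ^ k / fact k * path_weight V k z) sums W" "(\<lambda>k. t' ^ k / fact k * path_weight V k z) sums W'"
  shows "W \<le> W'"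
  by (rule sums_le[OF _ W]) (use t path_weight_nonneg[OF V] in \<open>auto intro!: mult_right_mono divide_right_mono power_mono\<close>)

context pareto_potential begin

text \<open>
  The two cities are kept fixed between consecutive grid points.
\<close>

definition scale :: "real \<Rightarrow> real" where "scale t = grid (max 1 (nat \<lfloor>t powr (1 / \<beta>)\<rfloor>))"

lemma scale_ge_1: "scale t \<ge> 1"
  unfolding scale_def grid_def using beta_pos by (intro ge_one_powr_ge_zero) auto

lemma filterlim_step: "filterlim (\<lambda>t. max 1 (nat \<lfloor>t powr (1 / \<beta>)\<rfloor>)) sequentially at_top"
  unfolding filterlim_at_top
proof
  fix N :: nat
  show "\<forall>\<^sub>F t in at_top. N \<le> max 1 (nat \<lfloor>t powr (1 / \<beta>)\<rfloor>)"
  proof -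
    have "\<forall>\<^sub>F t in at_top. real N \<le> t powr (1 / \<beta>)" by (rule eventually_const_le_powr) (use beta_pos in auto)
    then show ?thesis
    proof eventually_elim
      case (elim t)
      then have "N \<le> nat \<lfloor>t powr (1 / \<beta>)\<rfloor>" by (rule le_nat_floor)
      then show ?case by simp
    qed
  qed
qed

lemma filterlim_scale: "filterlim scale at_top at_top"
  unfolding scale_def by (rule filterlim_compose[OF filterlim_grid filterlim_step])

lemma beta_gt_1: "\<beta> > 1"
  using kappa_bounds by (simp add: \<beta>_def less_divide_eq)

text \<open>The mean value theorem bounds the spacing by
  \<open>C * T powr (1 - 1 / \<beta>)\<close>. Times \<open>Vmax T\<close> this is below the gap
  because \<open>1 / \<beta> = 3 / 2 * \<kappa>\<close> exceeds
  \<open>\<kappa> + \<eta> * \<nu>\<close>.\<close>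

lemma eventually_scale:
  "\<forall>\<^sub>F t in at_top. scale t \<le> t \<and> t \<le> 2 * scale t \<and> (t - scale t) * Vmax (scale t) \<le> Gap (scale t) / 2"
proof -
  define C where "C = \<beta> * 2 powr (\<beta> - 1)"
  have C0: "0 \<le> C" using beta_pos by (simp add: C_def)
  have inv: "1 / \<beta> = 3 / 2 * \<kappa>" using kappa_bounds by (simp add: \<beta>_def)
  have "\<forall>\<^sub>F T in at_top. C * T powr (1 - 1 / \<beta>) \<le> T powr 1"
    using beta_pos by (intro eventually_powr_le) auto
  moreover have "\<forall>\<^sub>F T in at_top. (4 * C) * T powr (1 - 1 / \<beta> + (\<rho> + \<eta> * \<nu>)) \<le> T powr (1 + \<rho> - \<kappa>)"
    using inv eta_nu nu_bounds by (intro eventually_powr_le) linarith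
  ultimately have "\<forall>\<^sub>F T in at_top. C * T powr (1 - 1 / \<beta>) \<le> T powr 1 \<and> (4 * C) * T powr (1 - 1 / \<beta> + (\<rho> + \<eta> * \<nu>)) \<le> T powr (1 + \<rho> - \<kappa>)"
    by (rule eventually_conj)
  then have "\<forall>\<^sub>F t in at_top. C * scale t powr (1 - 1 / \<beta>) \<le> scale t powr 1 \<and>
      (4 * C) * scale t powr (1 - 1 / \<beta> + (\<rho> + \<eta> * \<nu>)) \<le> scale t powr (1 + \<rho> - \<kappa>)"
    by (rule eventually_compose_filterlim[OF _ filterlim_scale])
  then show ?thesis using eventually_ge_at_top[of 1]
  proof eventually_elim
    case (elim t)
    define x where "x = t powr (1 / \<beta>)"
    define j where "j = nat \<lfloor>x\<rfloor>"
    have x1: "x \<ge> 1" unfolding x_def using elim(2) beta_pos by (intro ge_one_powr_ge_zero) auto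
    have j: "1 \<le> real j" "real j \<le> x" "x < real j + 1" using x1 by (auto simp: j_def)
    have T: "scale t = real j powr \<beta>" using j by (simp add: scale_def grid_def x_def[symmetric] j_def[symmetric])
    have t: "t = x powr \<beta>" using elim(2) beta_pos by (simp add: x_def powr_powr)
    have T1: "scale t \<ge> 1" by (rule scale_ge_1)
    have "real j powr \<beta> \<le> x powr \<beta>" using j beta_pos by (intro powr_mono2) auto
    then have le: "scale t \<le> t" using T t by linarith
    have "(real j + 1) powr \<beta> - real j powr \<beta> \<le> C * real j powr (\<beta> - 1)"
    proof -
      have "\<exists>z. real j < z \<and> z < real j + 1 \<and> (real j + 1) powr \<beta> - real j powr \<beta> = (real j + 1 - real j) * (\<beta> * z powr (\<beta> - 1))"
        using j by (intro MVT2) (auto intro!: has_real_derivative_powr)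
      then obtain z where z: "real j < z" "z < real j + 1" "(real j + 1) powr \<beta> - real j powr \<beta> = \<beta> * z powr (\<beta> - 1)" by auto
      have "z powr (\<beta> - 1) \<le> (2 * real j) powr (\<beta> - 1)" using z j beta_gt_1 by (intro powr_mono2) auto
      also have "\<dots> = 2 powr (\<beta> - 1) * real j powr (\<beta> - 1)" by (simp add: powr_mult)
      finally show ?thesis unfolding z(3) C_def using beta_pos by (simp add: mult_left_mono)
    qed
    moreover have "t \<le> (real j + 1) powr \<beta>" unfolding t using j beta_pos x1 by (intro powr_mono2) auto
    ultimately have "t - scale t \<le> C * real j powr (\<beta> - 1)" using T by linarith
    moreover have "real j powr (\<beta> - 1) = scale t powr (1 - 1 / \<beta>)"
      unfolding T using beta_pos by (simp add: powr_powr algebra_simps)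
    ultimately have diff: "t - scale t \<le> C * scale t powr (1 - 1 / \<beta>)" by simp
    have "(t - scale t) * Vmax (scale t) \<le> (C * scale t powr (1 - 1 / \<beta>)) * Vmax (scale t)"
      by (intro mult_right_mono diff) (simp add: Vmax_def)
    also have "\<dots> = (4 * C) * scale t powr (1 - 1 / \<beta> + (\<rho> + \<eta> * \<nu>)) / 2"
      by (simp add: Vmax_def powr_add)
    also have "\<dots> \<le> Gap (scale t) / 2" using elim(1) by (simp add: Gap_def)
    finally show ?case using le diff elim(1) T1 by simp
  qed
qed

section \<open>Choice of the cities\<close>

definition peak :: "real \<Rightarrow> 'a \<Rightarrow> int ^ 'd \<Rightarrow> real" where
  "peak t \<omega> = peak_value (\<lambda>z. \<xi> z \<omega>) (Base (scale t)) (scale t)"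

definition city1 :: "real \<Rightarrow> 'a \<Rightarrow> int ^ 'd" where
  "city1 t \<omega> = pick (peak t \<omega>) (lball 0 (Rad (scale t)))"

definition city2 :: "real \<Rightarrow> 'a \<Rightarrow> int ^ 'd" where
  "city2 t \<omega> = pick (peak t \<omega>) (lball 0 (Rad (scale t)) - {city1 t \<omega>})"

lemma peak_measurable [measurable]: "(\<lambda>\<omega>. peak t \<omega> z) \<in> borel_measurable M"
  unfolding peak_def peak_value_def by measurable

lemma city1_measurable [measurable]: "city1 t \<in> measurable M (count_space UNIV)"
  unfolding city1_def by (rule measurable_pick) (auto intro: peak_measurable)

lemma city2_measurable [measurable]: "city2 t \<in> measurable M (count_space UNIV)"
proof -
  have "(\<lambda>\<omega>. pick (peak t \<omega>) (lball 0 (Rad (scale t)) - {z})) \<in> measurable M (count_space UNIV)" for z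
    by (rule measurable_pick) (auto intro: peak_measurable)
  from measurable_compose_countable[where f = "\<lambda>z \<omega>. pick (peak t \<omega>) (lball 0 (Rad (scale t)) - {z})", OF this city1_measurable[of t]]
  show ?thesis by (simp add: city2_def[abs_def])
qed

lemma city1_in: "city1 t \<omega> \<in> lball 0 (Rad (scale t))"
  and city1_max: "w \<in> lball 0 (Rad (scale t)) \<Longrightarrow> peak t \<omega> w \<le> peak t \<omega> (city1 t \<omega>)"
proof -
  have "lball (0 :: int ^ 'd) (Rad (scale t)) \<noteq> {}" by (auto simp: lball_def intro!: exI[of _ 0])
  from pick[OF finite_lball this] show "city1 t \<omega> \<in> lball 0 (Rad (scale t))"
    "w \<in> lball 0 (Rad (scale t)) \<Longrightarrow> peak t \<omega> w \<le> peak t \<omega> (city1 t \<omega>)" by (auto simp: city1_def)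
qed

lemma city2_in: "city2 t \<omega> \<in> lball 0 (Rad (scale t)) - {city1 t \<omega>}"
  and city2_max: "w \<in> lball 0 (Rad (scale t)) \<Longrightarrow> w \<noteq> city1 t \<omega> \<Longrightarrow> peak t \<omega> w \<le> peak t \<omega> (city2 t \<omega>)"
proof -
  obtain i :: 'd where True by blast
  have "1 \<le> scale t powr (1 + \<rho> + \<nu>)" using scale_ge_1[of t] rho_pos nu_bounds by (intro ge_one_powr_ge_zero) auto
  then have "1 \<le> Rad (scale t)" using Rad_bounds(1)[OF scale_ge_1[of t]] by linarith
  \<comment> \<open>The ball contains at least two sites, so one remains when the first city is
    removed.\<close>
  then have "axis i 1 \<in> lball (0 :: int ^ 'd) (Rad (scale t))" "0 \<in> lball (0 :: int ^ 'd) (Rad (scale t))"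
    by (auto simp: lball_def)
  moreover have "axis i 1 \<noteq> (0 :: int ^ 'd)" by (simp add: axis_eq_0_iff)
  ultimately have ne: "lball (0 :: int ^ 'd) (Rad (scale t)) - {city1 t \<omega>} \<noteq> {}" by (metis Diff_eq_empty_iff singletonD subsetD)
  from pick[OF finite_Diff[OF finite_lball] ne] show "city2 t \<omega> \<in> lball 0 (Rad (scale t)) - {city1 t \<omega>}"
    "w \<in> lball 0 (Rad (scale t)) \<Longrightarrow> w \<noteq> city1 t \<omega> \<Longrightarrow> peak t \<omega> w \<le> peak t \<omega> (city2 t \<omega>)" by (auto simp: city2_def)
qed

text \<open>Otherwise the peak values of \<open>w\<close> and of all sites of \<open>S\<close> lie
  between that of \<open>w\<close> and \<open>Gap T\<close> above it, a tie of
  \<open>Suc (card S)\<close> sites.\<close>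

lemma gap_of_no_ties:
  assumes \<omega>: "\<omega> \<in> space M" "\<omega> \<notin> near_ties (Suc (card S)) T"
    and S: "S \<subseteq> lball 0 (Rad T)" "z1 \<in> S" and w: "w \<in> lball 0 (Rad T)" "w \<notin> S"
    and le: "\<And>z. z \<in> S \<Longrightarrow> peak_value (\<lambda>z. \<xi> z \<omega>) (Base T) T w \<le> peak_value (\<lambda>z. \<xi> z \<omega>) (Base T) T z"
      "\<And>z. z \<in> S \<Longrightarrow> peak_value (\<lambda>z. \<xi> z \<omega>) (Base T) T z \<le> peak_value (\<lambda>z. \<xi> z \<omega>) (Base T) T z1"
    and T: "T \<ge> 1" "ln (deg TYPE('d)) + 4 \<le> ln (Base T)" "2 * Gap T \<le> Top T"
    and top: "Top T \<le> peak_value (\<lambda>z. \<xi> z \<omega>) (Base T) T z1" and Vw: "\<xi> w \<omega> \<le> Vmax T"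
  shows "peak_value (\<lambda>z. \<xi> z \<omega>) (Base T) T w + Gap T \<le> peak_value (\<lambda>z. \<xi> z \<omega>) (Base T) T z1"
proof (rule ccontr)
  let ?p = "peak_value (\<lambda>z. \<xi> z \<omega>) (Base T) T"
  assume "\<not> ?p w + Gap T \<le> ?p z1"
  then have close: "?p z1 < ?p w + Gap T" by simp
  have T0: "T > 0" using T by linarith
  have fS: "finite S" using S(1) finite_subset finite_lball by blast
  have g0: "Gap T > 0" using T0 by (simp add: Gap_def)
  have t0: "Top T > 0" using T0 by (simp add: Top_def)
  obtain z where z: "z \<in> insert w S" "?p w + Gap T < ?p z"
  proof (rule not_tiesD[OF \<omega>(1) \<omega>(2)[unfolded near_ties_def] g0, where A = "insert w S" and x = "?p w"])
    show "insert w S \<subseteq> lball 0 (Rad T)" using S w by auto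
    show "card (insert w S) = Suc (card S)" using fS w by simp
    show "Top T / 2 \<le> ?p w" using close top T(3) by linarith
    have "?p w + 4 * norm1 w \<le> T * \<xi> w \<omega>"
      unfolding peak_value_eq using T0 by (intro peak_fun_le[OF T(2)]) (simp add: Base_def)
    also have "\<dots> \<le> T * Vmax T" using Vw T0 by (intro mult_left_mono) auto
    also have "\<dots> = (2 * T powr (\<eta> * \<nu> + \<kappa>)) * Gap T"
    proof -
      have "T * T powr (\<rho> + \<eta> * \<nu>) = T powr (1 + (\<rho> + \<eta> * \<nu>))" using T0 by (simp add: powr_mult_base)
      also have "1 + (\<rho> + \<eta> * \<nu>) = (\<eta> * \<nu> + \<kappa>) + (1 + \<rho> - \<kappa>)" by simp
      also have "T powr \<dots> = T powr (\<eta> * \<nu> + \<kappa>) * Gap T" unfolding Gap_def by (rule powr_add)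
      finally show ?thesis by (simp add: Vmax_def)
    qed
    also have "\<dots> \<le> Bins T * Gap T"
      using g0 unfolding Bins_def by (intro mult_right_mono) linarith+
    finally show "?p w < Top T / 2 + Bins T * Gap T" using t0 by linarith
    show "?p w \<le> ?p z" if "z \<in> insert w S" for z using that le(1) by auto
  qed
  then have "?p z \<le> ?p z1" using le(2) z g0 by auto
  then show False using z close by linarith
qed

text \<open>One argument is run twice: with both cities, where triple ties are eventually excluded
  almost surely, and with the first alone, where the absence of double ties is a hypothesis. Passing
  from \<open>u\<close> to \<open>W\<close> multiplies by a factor that cancels in the
  ratios.\<close>

lemma AE_concentration:
  assumes sol: "AE \<omega> in M. nonneg_pam_solution (\<lambda>z. \<xi> z \<omega>) (u \<omega>)"
  shows "AE \<omega> in M. (\<forall>t>0. u \<omega> t summable_on UNIV) \<and> (\<forall>e>0. \<forall>\<^sub>F t in at_top.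
     \<bar>(u \<omega> t (city1 t \<omega>) + u \<omega> t (city2 t \<omega>)) / total_mass (u \<omega>) t - 1\<bar> \<le> e \<and>
     (\<omega> \<notin> near_ties 2 (scale t) \<longrightarrow> \<bar>u \<omega> t (city1 t \<omega>) / total_mass (u \<omega>) t - 1\<bar> \<le> e))"
proof -
  let ?d = "deg TYPE('d)"
  obtain m where sparse: "AE \<omega> in M. \<forall>\<^sub>F j in sequentially.
     \<forall>x\<in>lball 0 (Rad (grid j)). card (lball x (Loc (grid j)) \<inter> {y. Base (grid j) < \<xi> y \<omega>}) \<le> m"
    using AE_sparse by blast
  show ?thesis
    using sol AE_ge_1 AE_growth sparse AE_high_site AE_not_near_ties_3 AE_space
  proof eventually_elim
    case (elim \<omega>)
    define V where "V z = \<xi> z \<omega>" for z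
    have V1: "1 \<le> V z" for z using elim(2) by (simp add: V_def)
    then have V0: "0 \<le> V z" for z using order_trans[OF zero_le_one] by blast
    obtain N0 where N0': "\<forall>z. N0 \<le> norm1 z \<longrightarrow> V z \<le> norm1 z powr \<theta>" using elim(3) by (auto simp: V_def)
    define W where "W t z = exp (?d * t) * u \<omega> t z" for t z
    have W: "(\<lambda>k. t ^ k / fact k * path_weight V k z) sums W t z" if "t > 0" for t z
      unfolding W_def using elim(1) that by (intro pam_solution_sums V0) (auto simp: V_def)
    have Wpos: "W t z > 0" if "t > 0" for t z
      by (rule solution_pos[OF V0 that W[OF that]])
    have upos: "u \<omega> t z > 0" if "t > 0" for t z
      using Wpos[OF that, of z] by (simp add: W_def zero_less_mult_iff)
    have sumW: "(\<Sum>z\<in>F. W t z) = exp (?d * t) * (\<Sum>z\<in>F. u \<omega> t z)" for F t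
      by (simp add: W_def sum_distrib_left)
    have main: "\<forall>\<^sub>F t in at_top. t > 0 \<and>
        (\<forall>F. finite F \<longrightarrow> F \<inter> {city1 t \<omega>, city2 t \<omega>} = {} \<longrightarrow> (\<Sum>z\<in>F. W t z) \<le> e * (\<Sum>z\<in>{city1 t \<omega>, city2 t \<omega>}. W t z)) \<and>
        (\<omega> \<notin> near_ties 2 (scale t) \<longrightarrow> (\<forall>F. finite F \<longrightarrow> F \<inter> {city1 t \<omega>} = {} \<longrightarrow> (\<Sum>z\<in>F. W t z) \<le> e * (\<Sum>z\<in>{city1 t \<omega>}. W t z)))"
      if e: "e > 0" for e
    proof -
      have growth: "\<forall>\<^sub>F T in at_top. (\<forall>z\<in>lball 0 (Rad T). V z \<le> Vmax T) \<and>
          (\<forall>n>Rad T. \<exists>M\<ge>6 * ?d. (\<forall>z\<in>lball 0 n. V z \<le> M) \<and> 6 * T * M \<le> n)"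
        by (rule eventually_growth_conditions[of N0 V]) (rule N0'[rule_format])
      note conc = eventually_concentration[OF V1 N0' e, of m]
      note at_scale = eventually_compose_filterlim[OF _ filterlim_scale]
      note at_step = eventually_compose_filterlim[OF _ filterlim_step]
      show ?thesis
        using at_scale[OF growth] at_scale[OF conc] at_scale[OF eventually_scale_conditions[OF zero_less_one, of "ln ?d + 4" 0]]
          at_scale[OF eventually_peak_ge_Top] at_step[OF elim(4), folded scale_def] at_step[OF elim(5), folded scale_def] at_step[OF elim(6), folded scale_def] eventually_scale
          eventually_gt_at_top[of 0]
      proof eventually_elim
        case (elim t)
        let ?T = "scale t" and ?p = "peak t \<omega>"
        have p: "?p = peak_value V (Base ?T) ?T" by (simp add: peak_def V_def[abs_def])
        note T1 = scale_ge_1[of t]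
        have VM: "V z \<le> Vmax ?T" if "z \<in> lball 0 (Rad ?T)" for z using elim(1) that by blast
        obtain z0 where z0: "z0 \<in> lball 0 (Inner ?T)" "2 * Top ?T \<le> ?T * V z0" using elim(6) by (auto simp: V_def)
        then have "Top ?T \<le> ?p z0" using elim(4) VM unfolding p by blast
        moreover have "z0 \<in> lball 0 (Rad ?T)" using z0 Inner_bounds(3)[OF T1] by (simp add: lball_def)
        ultimately have top: "Top ?T \<le> ?p (city1 t \<omega>)" using city1_max[of z0 t \<omega>] by linarith
        have c1: "city1 t \<omega> \<in> lball 0 (Rad ?T)" by (rule city1_in)
        have c2: "city2 t \<omega> \<in> lball 0 (Rad ?T)" "city2 t \<omega> \<noteq> city1 t \<omega>" using city2_in[of t \<omega>] by auto
        have conc: "(\<Sum>z\<in>F. W t z) \<le> e * (\<Sum>z\<in>S. W t z)"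
          if S: "finite S" "card S \<le> 2" "city1 t \<omega> \<in> S" "S \<subseteq> lball 0 (Rad ?T)"
            and nt: "\<omega> \<notin> near_ties (Suc (card S)) ?T"
            and max: "\<And>w z. w \<in> lball 0 (Rad ?T) \<Longrightarrow> w \<notin> S \<Longrightarrow> z \<in> S \<Longrightarrow> ?p w \<le> ?p z"
            and F: "finite F" "F \<inter> S = {}" for S F
        proof -
          have "?p w + Gap ?T \<le> ?p (city1 t \<omega>)" if w: "w \<in> lball 0 (Rad ?T)" "w \<notin> S" for w
            unfolding peak_def
          proof (rule gap_of_no_ties[OF \<open>\<omega> \<in> space M\<close> nt S(4,3) w])
            fix z assume z: "z \<in> S"
            show "peak_value (\<lambda>z. \<xi> z \<omega>) (Base ?T) ?T w \<le> peak_value (\<lambda>z. \<xi> z \<omega>) (Base ?T) ?T z"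
              using max[OF w z] by (simp add: peak_def)
            show "peak_value (\<lambda>z. \<xi> z \<omega>) (Base ?T) ?T z \<le> peak_value (\<lambda>z. \<xi> z \<omega>) (Base ?T) ?T (city1 t \<omega>)"
              using city1_max[of z t \<omega>] z S by (auto simp: peak_def)
          qed (use T1 elim(3) top VM[OF w(1)] in \<open>auto simp: peak_def V_def\<close>)
          then have gap: "\<forall>w\<in>lball 0 (Rad ?T). w \<notin> S \<longrightarrow> peak_value V (Base ?T) ?T w + Gap ?T \<le> peak_value V (Base ?T) ?T (city1 t \<omega>)"
            unfolding p by blast
          have sp: "\<forall>x\<in>lball 0 (Rad ?T). card (lball x (Loc ?T) \<inter> {y. Base ?T < V y}) \<le> m"
            using elim(5) unfolding V_def .
          have Wt: "\<forall>z. (\<lambda>k. t ^ k / fact k * path_weight V k z) sums W t z" using W[OF elim(9)] by blast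
          have tp: "Top ?T \<le> peak_value V (Base ?T) ?T (city1 t \<omega>)" using top unfolding p .
          note c = elim(2)[THEN spec, of t, THEN spec, of "W t", THEN spec, of S, THEN spec, of "city1 t \<omega>", THEN spec, of F]
          show ?thesis
            by (rule c[THEN mp, THEN mp, THEN mp, THEN mp, THEN mp, THEN mp, THEN mp, THEN mp, THEN mp, THEN mp, THEN mp, THEN mp, THEN mp])
               (rule elim(8)[THEN conjunct1] elim(8)[THEN conjunct2, THEN conjunct1]
                  elim(8)[THEN conjunct2, THEN conjunct2] sp Wt S tp gap F)+
        qed
        have 1: "(\<Sum>z\<in>F. W t z) \<le> e * (\<Sum>z\<in>{city1 t \<omega>, city2 t \<omega>}. W t z)"
          if F: "finite F" "F \<inter> {city1 t \<omega>, city2 t \<omega>} = {}" for F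
        proof (rule conc[OF _ _ _ _ _ _ F])
          have "card {city1 t \<omega>, city2 t \<omega>} = 2" using c2 by simp
          then show "card {city1 t \<omega>, city2 t \<omega>} \<le> 2" "\<omega> \<notin> near_ties (Suc (card {city1 t \<omega>, city2 t \<omega>})) ?T"
            using elim(7) by (simp_all add: numeral_3_eq_3 numeral_2_eq_2)
          show "?p w \<le> ?p z" if "w \<in> lball 0 (Rad ?T)" "w \<notin> {city1 t \<omega>, city2 t \<omega>}" "z \<in> {city1 t \<omega>, city2 t \<omega>}" for w z
            using that city1_max city2_max by auto
        qed (use c1 c2 in auto)
        have 2: "(\<Sum>z\<in>F. W t z) \<le> e * (\<Sum>z\<in>{city1 t \<omega>}. W t z)"
          if "\<omega> \<notin> near_ties 2 ?T" and F: "finite F" "F \<inter> {city1 t \<omega>} = {}" for F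
        proof (rule conc[OF _ _ _ _ _ _ F])
          show "\<omega> \<notin> near_ties (Suc (card {city1 t \<omega>})) ?T" using that(1) by (simp add: numeral_2_eq_2)
          show "?p w \<le> ?p z" if "w \<in> lball 0 (Rad ?T)" "w \<notin> {city1 t \<omega>}" "z \<in> {city1 t \<omega>}" for w z
            using that city1_max by auto
        qed (use c1 in auto)
        show ?case using 1 2 elim(9) by blast
      qed
    qed
    have ratio: "u \<omega> t summable_on UNIV \<and> \<bar>(\<Sum>z\<in>S. u \<omega> t z) / total_mass (u \<omega>) t - 1\<bar> \<le> e"
      if "t > 0" "finite S" "S \<noteq> {}" "e > 0" and small: "\<forall>F. finite F \<longrightarrow> F \<inter> S = {} \<longrightarrow> (\<Sum>z\<in>F. W t z) \<le> e * (\<Sum>z\<in>S. W t z)" for t S e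
    proof -
      have "(\<Sum>z\<in>F. u \<omega> t z) \<le> e * (\<Sum>z\<in>S. u \<omega> t z)" if "finite F" "F \<inter> S = {}" for F
      proof -
        have "exp (?d * t) * (\<Sum>z\<in>F. u \<omega> t z) \<le> exp (?d * t) * (e * (\<Sum>z\<in>S. u \<omega> t z))"
          using small that unfolding sumW by (simp add: mult.left_commute)
        then show ?thesis by simp
      qed
      moreover have "0 < (\<Sum>z\<in>S. u \<omega> t z)" using that upos by (intro sum_pos) auto
      ultimately show ?thesis
        using mass_ratio[of "u \<omega> t" S e] upos[OF \<open>t > 0\<close>] that unfolding total_mass_def by (auto intro: less_imp_le)
    qed
    show ?case
    proof (intro conjI allI impI)
      fix t :: real assume t: "t > 0"
      \<comment> \<open>Concentration gives summability at large times only; \<open>W\<close> is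
        nondecreasing in time, which carries it back to \<open>t\<close>.\<close>
      obtain t' where t': "t' > t" "\<forall>F. finite F \<longrightarrow> F \<inter> {city1 t' \<omega>, city2 t' \<omega>} = {} \<longrightarrow>
          (\<Sum>z\<in>F. W t' z) \<le> 1 * (\<Sum>z\<in>{city1 t' \<omega>, city2 t' \<omega>}. W t' z)"
        using eventually_happens[OF eventually_conj[OF main[OF zero_less_one] eventually_gt_at_top[of t]]] by auto
      have "u \<omega> t' summable_on UNIV"
        using ratio[of t' "{city1 t' \<omega>, city2 t' \<omega>}" 1] t t' by auto
      then have "W t' summable_on UNIV"
        unfolding W_def[abs_def] by (rule summable_on_cmult_right)
      then have "W t summable_on UNIV"
      proof (rule summable_on_comparison_test)
        fix z
        show "W t z \<le> W t' z"
          by (rule solution_mono[OF V0 less_imp_le[OF t] less_imp_le[OF t'(1)] W[OF t] W[OF less_trans[OF t t'(1)]]])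
        show "0 \<le> W t z" using Wpos[OF t, of z] by simp
      qed
      then have "(\<lambda>z. exp (- (?d * t)) * W t z) summable_on UNIV"
        by (rule summable_on_cmult_right)
      moreover have "exp (- (?d * t)) * W t z = u \<omega> t z" for z
        by (simp add: W_def mult.assoc[symmetric] exp_add[symmetric])
      ultimately show "u \<omega> t summable_on UNIV" by simp
    next
      fix e :: real assume e: "e > 0"
      show "\<forall>\<^sub>F t in at_top.
         \<bar>(u \<omega> t (city1 t \<omega>) + u \<omega> t (city2 t \<omega>)) / total_mass (u \<omega>) t - 1\<bar> \<le> e \<and>
         (\<omega> \<notin> near_ties 2 (scale t) \<longrightarrow> \<bar>u \<omega> t (city1 t \<omega>) / total_mass (u \<omega>) t - 1\<bar> \<le> e)"
        using main[OF e]
      proof eventually_elim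
        case (elim t)
        have ne: "city1 t \<omega> \<noteq> city2 t \<omega>" using city2_in[of t \<omega>] by auto
        show ?case
          using ratio[of t "{city1 t \<omega>, city2 t \<omega>}" e] ratio[of t "{city1 t \<omega>}" e] elim e ne by auto
      qed
    qed
  qed
qed

end

theorem theorem1p2:
  fixes M :: "'a measure"
    and \<alpha> :: real
    and \<xi> :: "int ^ 'd \<Rightarrow> 'a \<Rightarrow> real"
    and u :: "'a \<Rightarrow> real \<Rightarrow> int ^ 'd \<Rightarrow> real"
  assumes "prob_space M"
    and "\<alpha> > real CARD('d)"
    and "prob_space.indep_vars M (\<lambda>_. borel) \<xi> UNIV"
    and "\<And>z x. x \<ge> 1 \<Longrightarrow> measure M {\<omega> \<in> space M. \<xi> z \<omega> < x} = 1 - x powr (-\<alpha>)"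
    and "AE \<omega> in M. nonneg_pam_solution (\<lambda>z. \<xi> z \<omega>) (u \<omega>)"
  shows "\<exists>Z1 Z2 :: real \<Rightarrow> 'a \<Rightarrow> int ^ 'd.
    (\<forall>t>0. Z1 t \<in> measurable M (count_space UNIV)) \<and>
    (\<forall>t>0. Z2 t \<in> measurable M (count_space UNIV)) \<and>
    (\<forall>t>0. \<forall>\<omega>\<in>space M. Z1 t \<omega> \<noteq> Z2 t \<omega>) \<and>
    (AE \<omega> in M.
       ((\<lambda>t. (u \<omega> t (Z1 t \<omega>) + u \<omega> t (Z2 t \<omega>)) / total_mass (u \<omega>) t) \<longlongrightarrow> 1) at_top) \<and>
    tendsto_in_prob (completion M)
      (\<lambda>t \<omega>. u \<omega> t (Z1 t \<omega>) / total_mass (u \<omega>) t) 1 at_top"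
proof -
  interpret prob_space M by fact
  interpret pareto_potential M \<alpha> \<xi>
    by unfold_locales (use assms in auto)
  let ?d = "deg TYPE('d)"
  define X where "X t \<omega> = u \<omega> t (city1 t \<omega>) / total_mass (u \<omega>) t" for t \<omega>
  note conc = AE_concentration[OF assms(5)]
  have limit: "AE \<omega> in M. ((\<lambda>t. (u \<omega> t (city1 t \<omega>) + u \<omega> t (city2 t \<omega>)) / total_mass (u \<omega>) t) \<longlongrightarrow> 1) at_top"
    using conc
  proof eventually_elim
    case (elim \<omega>)
    show ?case
    proof (rule tendstoI)
      fix e :: real assume "e > 0"
      then have "\<forall>\<^sub>F t in at_top. \<bar>(u \<omega> t (city1 t \<omega>) + u \<omega> t (city2 t \<omega>)) / total_mass (u \<omega>) t - 1\<bar> \<le> e / 2"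
        using elim by (auto elim!: allE[of _ "e / 2"] eventually_mono)
      then show "\<forall>\<^sub>F t in at_top. dist ((u \<omega> t (city1 t \<omega>) + u \<omega> t (city2 t \<omega>)) / total_mass (u \<omega>) t) 1 < e"
        by eventually_elim (use \<open>e > 0\<close> in \<open>simp add: dist_real_def\<close>)
    qed
  qed
  have X_measurable: "X t \<in> borel_measurable (completion M)" if t: "t > 0" for t
  proof -
    \<comment> \<open>The map from outcomes to \<open>u\<close> need not be measurable, as
      \<open>u\<close> is a solution only almost surely. The series \<open>w\<close> is a measurable
      version, equal to \<open>u\<close> off a null set.\<close>
    define w where "w z \<omega> = exp (- (?d * t)) * (\<Sum>k. t ^ k / fact k * path_weight (\<lambda>z. \<xi> z \<omega>) k z)" for z \<omega>
    have [measurable]: "w z \<in> borel_measurable M" for z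
      unfolding w_def by measurable
    have [measurable]: "(\<lambda>\<omega>. w (city1 t \<omega>) \<omega>) \<in> borel_measurable M"
      by (rule measurable_compose_countable[OF _ city1_measurable]) measurable
    have meas: "(\<lambda>\<omega>. w (city1 t \<omega>) \<omega> / lim (\<lambda>n. \<Sum>z\<in>lball 0 n. w z \<omega>)) \<in> borel_measurable M"
      by measurable
    show ?thesis
    proof (rule measurable_completion_AE_eq[OF meas])
      show "AE \<omega> in M. X t \<omega> = w (city1 t \<omega>) \<omega> / lim (\<lambda>n. \<Sum>z\<in>lball 0 n. w z \<omega>)"
        using conc assms(5) AE_ge_1
      proof eventually_elim
        case (elim \<omega>)
        have "0 \<le> \<xi> z \<omega>" for z using elim(3) order_trans[OF zero_le_one] by blast
        then have "(\<lambda>k. t ^ k / fact k * path_weight (\<lambda>z. \<xi> z \<omega>) k z) sums (exp (?d * t) * u \<omega> t z)" for z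
          by (rule pam_solution_sums[OF _ elim(2) t])
        then have "w z \<omega> = u \<omega> t z" for z
          unfolding w_def by (subst sums_unique[symmetric], assumption)
            (simp add: mult.assoc[symmetric] exp_add[symmetric])
        moreover have "lim (\<lambda>n. \<Sum>z\<in>lball 0 n. u \<omega> t z) = total_mass (u \<omega>) t"
          unfolding total_mass_def using elim(1) t by (intro limI tendsto_infsum_lball) auto
        ultimately show ?case by (simp add: X_def)
      qed
    qed
  qed
  interpret C: finite_measure "completion M"
    by (rule finite_measureI) (simp add: emeasure_space_1)
  have in_prob: "((\<lambda>t. measure (completion M) {\<omega> \<in> space (completion M). \<bar>X t \<omega> - 1\<bar> > e}) \<longlongrightarrow> 0) at_top" if e: "e > 0" for e
  proof -
    define B where "B t = {\<omega> \<in> space (completion M). \<bar>X t \<omega> - 1\<bar> > e}" for t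
    \<comment> \<open>Without a double tie the deviation almost surely ceases, so \<open>E\<close>
      tends to probability zero and the rest of \<open>B\<close> is covered by
      \<open>near_ties\<close>. The empty set at nonpositive times keeps every \<open>E t\<close>
      measurable.\<close>
    define E where "E t = (if t > 0 then B t - near_ties 2 (scale t) else {})" for t
    have B: "B t \<in> sets (completion M)" if "t > 0" for t
    proof -
      note [measurable] = X_measurable[OF that]
      show ?thesis unfolding B_def by measurable
    qed
    have N: "near_ties 2 (scale t) \<in> sets (completion M)" for t using sets_near_ties by auto
    have E: "E t \<in> sets (completion M)" for t using B N by (auto simp: E_def)
    have "AE \<omega> in M. \<forall>\<^sub>F t in at_top. \<omega> \<notin> E t"
      using conc
    proof eventually_elim
      case (elim \<omega>)
      then have "\<forall>\<^sub>F t in at_top. \<omega> \<notin> near_ties 2 (scale t) \<longrightarrow> \<bar>X t \<omega> - 1\<bar> \<le> e"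
        using e by (auto simp: X_def elim!: allE[of _ e] eventually_mono)
      then show ?case by eventually_elim (auto simp: E_def B_def)
    qed
    then have "AE \<omega> in completion M. \<forall>\<^sub>F t in at_top. \<omega> \<notin> E t" by (rule AE_completion)
    then have limE: "((\<lambda>t. measure (completion M) (E t)) \<longlongrightarrow> 0) at_top"
      by (rule C.measure_tendsto_0_at_top[OF E])
    have "((\<lambda>t. prob (near_ties 2 (scale t))) \<longlongrightarrow> 0) at_top"
      by (rule filterlim_compose[OF prob_near_ties_2 filterlim_scale])
    from tendsto_add[OF this limE]
    have lim: "((\<lambda>t. prob (near_ties 2 (scale t)) + measure (completion M) (E t)) \<longlongrightarrow> 0) at_top" by simp
    have le: "\<forall>\<^sub>F t in at_top. measure (completion M) (B t) \<le> prob (near_ties 2 (scale t)) + measure (completion M) (E t)"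
      using eventually_gt_at_top[of 0]
    proof eventually_elim
      case (elim t)
      have "measure (completion M) (B t) \<le> measure (completion M) (near_ties 2 (scale t) \<union> E t)"
        using elim by (intro C.finite_measure_mono sets.Un N E) (auto simp: E_def)
      also have "\<dots> \<le> measure (completion M) (near_ties 2 (scale t)) + measure (completion M) (E t)"
        by (rule measure_Un_le[OF N E])
      finally show ?case by (simp add: sets_near_ties)
    qed
    have "((\<lambda>t. measure (completion M) (B t)) \<longlongrightarrow> 0) at_top"
      by (rule tendsto_sandwich[OF _ le tendsto_const lim]) simp
    then show ?thesis by (simp only: B_def)
  qed
  have "\<forall>\<^sub>F t in at_top. X t \<in> borel_measurable (completion M)"
    using eventually_gt_at_top[of 0] by eventually_elim (rule X_measurable)
  then have "tendsto_in_prob (completion M) X 1 at_top"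
    using in_prob by (simp add: tendsto_in_prob_def)
  then have conv: "tendsto_in_prob (completion M) (\<lambda>t \<omega>. u \<omega> t (city1 t \<omega>) / total_mass (u \<omega>) t) 1 at_top"
    by (simp add: X_def[abs_def])
  have ne: "city1 t \<omega> \<noteq> city2 t \<omega>" for t \<omega> using city2_in[of t \<omega>] by auto
  show ?thesis
    by (rule exI[of _ city1], rule exI[of _ city2]) (use limit conv ne city1_measurable city2_measurable in blast)
qed

end
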